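(* Let $\varphi$ be a polynomial mapping of $\mathbf{C}[x,y]$ with invertible Jacobian matrix. If $\varphi$, viewed as a map $\mathbf{C}^2\to\mathbf{C}^2$, is injective on some line in $\mathbf{C}^2$, then $\varphi$ is an automorphism.
   Context: A polynomial mapping $\varphi$ of $\mathbf{C}[x,y]$ is a $\mathbf{C}$-algebra endomorphism $x\mapsto p(x,y)$, $y\mapsto q(x,y)$; it corresponds to the map $\mathbf{C}^2\to\mathbf{C}^2$, $(a,b)\mapsto (p(a,b),q(a,b))$. Its Jacobian matrix is the $2\times 2$ matrix of partial derivatives of $p,q$ with respect to $x,y$, and invertible means invertible over $\mathbf{C}[x,y]$. A line is an affine complex line in $\mathbf{C}^2$. Automorphism means $\mathbf{C}$-algebra automorphism of $\mathbf{C}[x,y]$. *)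

theory Defs
  imports "HOL-Analysis.Cartesian_Space" "HOL-Computational_Algebra.Polynomial"
begin

text \<open>The ring \<open>\<complex>[x,y]\<close> is represented as \<open>\<complex>[x][y]\<close>: the coefficients of the outer polynomial,
  whose variable is \<open>y\<close>, are polynomials in \<open>x\<close>.\<close>

type_synonym bipoly = "complex poly poly"

definition const2 :: "complex \<Rightarrow> bipoly" where
  "const2 c = [:[:c:]:]"

definition var_x :: bipoly where
  "var_x = [:[:0, 1:]:]"

definition var_y :: bipoly where
  "var_y = [:0, 1:]"

definition eval2 :: "bipoly \<Rightarrow> complex \<times> complex \<Rightarrow> complex" where
  "eval2 f = (\<lambda>(a, b). poly (poly f [:b:]) a)"

definition d_x :: "bipoly \<Rightarrow> bipoly" where
  "d_x f = map_poly pderiv f"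

definition d_y :: "bipoly \<Rightarrow> bipoly" where
  "d_y f = pderiv f"

text \<open>Preservation of the constants, together with multiplicativity, is \<open>\<complex>\<close>-linearity;
  it includes \<open>\<phi> 1 = 1\<close>.\<close>

definition polynomial_mapping :: "(bipoly \<Rightarrow> bipoly) \<Rightarrow> bool" where
  "polynomial_mapping \<phi> \<longleftrightarrow>
     (\<forall>f g. \<phi> (f + g) = \<phi> f + \<phi> g) \<and>
     (\<forall>f g. \<phi> (f * g) = \<phi> f * \<phi> g) \<and>
     (\<forall>c. \<phi> (const2 c) = const2 c)"

text \<open>The inverse of a bijective \<open>\<complex>\<close>-algebra endomorphism is again one.\<close>

definition polynomial_automorphism :: "(bipoly \<Rightarrow> bipoly) \<Rightarrow> bool" where
  "polynomial_automorphism \<phi> \<longleftrightarrow> polynomial_mapping \<phi> \<and> bij \<phi>"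

definition jacobian_matrix :: "(bipoly \<Rightarrow> bipoly) \<Rightarrow> bipoly ^ 2 ^ 2" where
  "jacobian_matrix \<phi> =
     vector [vector [d_x (\<phi> var_x), d_y (\<phi> var_x)],
             vector [d_x (\<phi> var_y), d_y (\<phi> var_y)]]"

definition induced_map :: "(bipoly \<Rightarrow> bipoly) \<Rightarrow> complex \<times> complex \<Rightarrow> complex \<times> complex" where
  "induced_map \<phi> z = (eval2 (\<phi> var_x) z, eval2 (\<phi> var_y) z)"

definition complex_line :: "(complex \<times> complex) set \<Rightarrow> bool" where
  "complex_line L \<longleftrightarrow>
     (\<exists>a b u v. (u, v) \<noteq> (0, 0) \<and> L = range (\<lambda>t. (a + t * u, b + t * v)))"

end

theory Submission
  imports
    Defs
    "HOL-Analysis.Determinants"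
    "HOL-Library.Real_Mod"
    "HOL-Computational_Algebra.Formal_Laurent_Series"
    "HOL-Computational_Algebra.Fundamental_Theorem_Algebra"
    "HOL-Computational_Algebra.Polynomial_FPS"
    "Jordan_Normal_Form.Char_Poly"
begin

text \<open>An affine change of coordinates moves the line to \<open>x = 0\<close>, where \<open>u(t) = p(0, t)\<close> and
  \<open>v(t) = q(0, t)\<close> form an injective immersion, hence an embedding of the line. By the theorem of
  Abhyankar, Moh and Suzuki one of \<open>deg u\<close>, \<open>deg v\<close> divides the other, so an elementary
  automorphism lowers \<open>deg u + deg v\<close>, until \<open>(u, v) = (0, t)\<close>. In that position the edge of
  largest slope in the Newton polygons of \<open>p\<close> and \<open>q\<close> would produce a nonconstant monomial in
  the Jacobian; so there is no such edge, \<open>p = c x\<close> and \<open>q = y + l(x)\<close>.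

  For the divisibility, substitute \<open>u(t) = \<tau>\<^sup>m\<close> at infinity, so that \<open>v\<close> becomes a series
  \<open>V(\<tau>)\<close> with conjugates \<open>V(\<omega>\<^sup>i \<tau>)\<close>. The resultant of the difference quotients of \<open>u\<close> and
  \<open>v\<close> has no zero, hence is constant, and therefore the degrees of \<open>V(\<tau>) - V(\<omega>\<^sup>i \<tau>)\<close> add up
  to \<open>m - 1\<close>. On the other hand, the approximate roots of the characteristic polynomial of \<open>v\<close>
  over \<open>\<complex>[u]\<close> take nonconstant polynomial values at \<open>v\<close>, of positive degree; their degrees are
  bounded in terms of the characteristic exponents of \<open>V\<close>. Summed over the exponents these bounds
  give at least \<open>m - 1\<close>, with equality only if \<open>deg v\<close>, when it is not a multiple of
  \<open>m\<close>, divides \<open>m\<close>.\<close>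

section \<open>Degrees of Laurent series at infinity\<close>

no_notation index_mat (infixl "$$" 100)
notation fls_nth (infixl "$$" 75)
hide_const (open) Module.smult

text \<open>Two polynomials compete at each characteristic exponent. The product \<open>g\<close>
  over the conjugates of the truncated series has a degree \<delta> at \<open>V\<close> that can be
  read off from the exponents, but its coefficients are merely series in \<open>1 / u\<close>. An
  approximate root has coefficients in C[u], because its construction divides only by integers; so
  its value at \<open>v\<close> is a polynomial in t. That value is not constant, for otherwise the
  root minus the constant would vanish at all m conjugates of \<open>V\<close>, although its degree
  is below m. Since approximate roots are unique, the root inherits the bound of \<open>g\<close>,
  and so \<delta> > 0. Positivity alone would not suffice for the count. But \<delta> is a multiple
  of d', the gcd of m with the exponents down to the present one, hence \<delta> is at least d'. If
  d = n d' is the preceding gcd, the exponent contributes (n - 1) \<delta>, which is at least d -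
  d', and these differences telescope from m down to 1. The total m - 1 leaves no slack, so equality
  holds at every exponent, in particular at the first one, where \<delta> is the degree of
  \<open>v\<close> if m does not divide it.\<close>

text \<open>A Laurent series in \<open>X\<close> is read as a series in \<open>\<tau> = 1 / X\<close>: \<open>deg_le x k\<close> says that its
  degree in \<open>\<tau>\<close> is at most \<open>k\<close>, and \<open>x $$ (- k)\<close> is the coefficient of \<open>\<tau>\<^sup>k\<close>.\<close>

definition deg_le :: "'a::zero fls \<Rightarrow> int \<Rightarrow> bool" where
  "deg_le x k \<longleftrightarrow> (\<forall>j< - k. x $$ j = 0)"

lemma deg_leD: "deg_le x k \<Longrightarrow> j < -k \<Longrightarrow> x $$ j = 0"
  by (simp add: deg_le_def)

lemma deg_le_iff_subdegree: "deg_le x k \<longleftrightarrow> x = 0 \<or> -k \<le> fls_subdegree x"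
proof -
  have "deg_le x k" if "- k \<le> fls_subdegree x"
    using that by (auto simp: deg_le_def)
  then show ?thesis
    by (auto simp: deg_le_def intro: fls_subdegree_geI)
qed

lemma deg_le_0 [simp]: "deg_le 0 k"
  by (simp add: deg_le_def)

lemma deg_le_mono: "deg_le x k \<Longrightarrow> k \<le> l \<Longrightarrow> deg_le x l"
  by (auto simp: deg_le_def)

lemma deg_le_add: "deg_le x k \<Longrightarrow> deg_le y k \<Longrightarrow> deg_le (x + y) k"
  for x :: "'a::monoid_add fls"
  by (auto simp: deg_le_def)

lemma deg_le_diff: "deg_le x k \<Longrightarrow> deg_le y k \<Longrightarrow> deg_le (x - y) k"
  for x :: "'a::group_add fls"
  by (auto simp: deg_le_def)

lemma deg_le_uminus: "deg_le x k \<Longrightarrow> deg_le (-x) k"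
  for x :: "'a::group_add fls"
  by (auto simp: deg_le_def)

lemma deg_le_sum: "(\<And>i. i \<in> A \<Longrightarrow> deg_le (f i) k) \<Longrightarrow> deg_le (sum f A) k"
  for f :: "'i \<Rightarrow> 'a::comm_monoid_add fls"
  by (induction A rule: infinite_finite_induct) (auto intro: deg_le_add)

lemma nth_sum_fls: "sum f A $$ k = (\<Sum>i\<in>A. f i $$ k)"
  for f :: "'i \<Rightarrow> 'a::comm_monoid_add fls"
  by (induction A rule: infinite_finite_induct) auto

text \<open>The coefficient at the bound is multiplicative even if a bound is not attained, since
  both sides are then 0. Leading-term computations therefore never need exact degrees.\<close>

lemma
  fixes x y :: "'a::field fls"
  assumes x: "deg_le x a" and y: "deg_le y b"
  shows deg_le_mult: "deg_le (x * y) (a + b)"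
    and nth_mult_deg_le: "(x * y) $$ (- a - b) = x $$ (- a) * y $$ (- b)"
proof -
  have *: "deg_le (x * y) (a + b) \<and> (x * y) $$ (- a - b) = x $$ (- a) * y $$ (- b)"
  proof (cases "x = 0 \<or> y = 0")
    case False
    then have nz: "x \<noteq> 0" "y \<noteq> 0" and s: "- a \<le> fls_subdegree x" "- b \<le> fls_subdegree y"
      using x y by (auto simp: deg_le_iff_subdegree)
    have "deg_le (x * y) (a + b)"
      using s nz by (simp add: deg_le_iff_subdegree)
    moreover have "(x * y) $$ (- a - b) = x $$ (- a) * y $$ (- b)"
    proof (cases "- a = fls_subdegree x \<and> - b = fls_subdegree y")
      case True
      then have "- a - b = fls_subdegree x + fls_subdegree y"
        by simp
      then have "(x * y) $$ (- a - b) = x $$ fls_subdegree x * y $$ fls_subdegree y"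
        by (metis fls_times_base)
      then show ?thesis
        using True by simp
    next
      case False
      then have "- a - b < fls_subdegree x + fls_subdegree y" "- a < fls_subdegree x \<or> - b < fls_subdegree y"
        using s by linarith+
      then show ?thesis
        by (auto simp: fls_times_nth_eq0)
    qed
    ultimately show ?thesis ..
  qed auto
  then show "deg_le (x * y) (a + b)" "(x * y) $$ (- a - b) = x $$ (- a) * y $$ (- b)"
    by blast+
qed

lemma deg_le_1 [simp]: "deg_le (1 :: 'a::field fls) 0"
  by (simp add: deg_le_iff_subdegree)

lemma
  fixes f :: "'i \<Rightarrow> 'a::field fls"
  assumes "\<And>i. i \<in> A \<Longrightarrow> deg_le (f i) (k i)"
  shows deg_le_prod: "deg_le (prod f A) (sum k A)"
    and nth_prod_deg_le: "prod f A $$ (- sum k A) = (\<Prod>i\<in>A. f i $$ (- k i))"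
proof -
  have "deg_le (prod f A) (sum k A) \<and> prod f A $$ (- sum k A) = (\<Prod>i\<in>A. f i $$ (- k i))"
    using assms
  proof (induction A rule: infinite_finite_induct)
    case (insert i A)
    then have *: "deg_le (f i) (k i)" "deg_le (prod f A) (sum k A)"
        "prod f A $$ (- sum k A) = (\<Prod>i\<in>A. f i $$ (- k i))"
      by auto
    show ?case
      using insert(1,2) deg_le_mult[OF *(1,2)] nth_mult_deg_le[OF *(1,2)] *(3) by simp
  qed auto
  then show "deg_le (prod f A) (sum k A)" "prod f A $$ (- sum k A) = (\<Prod>i\<in>A. f i $$ (- k i))"
    by blast+
qed

lemma
  fixes x :: "'a::field fls"
  assumes "deg_le x k"
  shows deg_le_power: "deg_le (x ^ n) (int n * k)"
    and nth_power_deg_le: "(x ^ n) $$ (- (int n * k)) = (x $$ (- k)) ^ n"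
  using deg_le_prod[of "{..<n}" "\<lambda>_. x" "\<lambda>_. k"] nth_prod_deg_le[of "{..<n}" "\<lambda>_. x" "\<lambda>_. k"] assms
  by simp_all

lemma deg_le_self: "deg_le x (- fls_subdegree x)"
  by (auto simp: deg_le_iff_subdegree)

lemma deg_le_divide:
  fixes x :: "'a::field fls"
  assumes "deg_le x a" "y \<noteq> 0"
  shows "deg_le (x / y) (a + fls_subdegree y)"
proof -
  have "deg_le (inverse y) (fls_subdegree y)"
    by (simp add: deg_le_iff_subdegree)
  then show ?thesis
    using deg_le_mult[OF assms(1)] by (simp add: field_class.field_divide_inverse)
qed

text \<open>The substitution X -> c X. For c running through the m-th roots of unity this is the
  Galois action over the Laurent series in X^m.\<close>

definition rot :: "'a::field \<Rightarrow> 'a fls \<Rightarrow> 'a fls" where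
  "rot c x = fls_compose_fps x (fps_const c * fps_X)"

lemma nth_rot: "c \<noteq> 0 \<Longrightarrow> rot c x $$ n = x $$ n * c powi n"
  unfolding rot_def by (rule fls_nth_fls_compose_fps_linear)

lemma rot_field_hom: "c \<noteq> 0 \<Longrightarrow> field_hom (rot c)"
  unfolding rot_def
  by unfold_locales (simp_all add: fls_compose_fps_add fls_compose_fps_mult fls_compose_fps_inverse)

lemma rot_rot: "c \<noteq> 0 \<Longrightarrow> d \<noteq> 0 \<Longrightarrow> rot c (rot d x) = rot (c * d) x"
  by (rule fls_eqI) (simp add: nth_rot power_int_mult_distrib)

lemma rot_1 [simp]: "rot 1 x = x"
  by (rule fls_eqI) (simp add: nth_rot)

lemma deg_le_rot [simp]: "c \<noteq> 0 \<Longrightarrow> deg_le (rot c x) k \<longleftrightarrow> deg_le x k"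
  by (simp add: deg_le_def nth_rot)

lemma fls_subdegree_rot [simp]: "c \<noteq> 0 \<Longrightarrow> fls_subdegree (rot c x) = fls_subdegree x"
  unfolding rot_def by simp

section \<open>Approximate roots\<close>

text \<open>Second-order Taylor remainder: every surviving term contains \<open>h\<close> twice and
  at most d - 2 further factors of degree N. As \<open>degree h < N\<close>, it lies below the
  degree of the linear term for monic \<open>B\<close> and nonzero \<open>d * h\<close>, so the
  linear term governs how a correction of \<open>B\<close> by \<open>h\<close> acts on
  \<open>B ^ d\<close>.\<close>

lemma degree_binomial_remainder:
  fixes B h :: "'a::comm_ring_1 poly"
  assumes "degree B = N" "degree h < N" "2 \<le> d"
  shows "degree ((B + h) ^ d - B ^ d - of_nat d * h * B ^ (d - 1)) \<le> (d - 2) * N + 2 * degree h"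
  using \<open>2 \<le> d\<close>
proof (induction d rule: dec_induct)
  case base
  have "(B + h) ^ 2 - B ^ 2 - of_nat 2 * h * B ^ (2 - 1) = h * h"
    by (simp add: power2_eq_square algebra_simps)
  then show ?case
    using degree_mult_le[of h h] by simp
next
  case (step d)
  define Z where "Z = (B + h) ^ d - B ^ d - of_nat d * h * B ^ (d - 1)"
  obtain k where d: "d = Suc (Suc k)"
    using step(1) by (metis add_2_eq_Suc le_Suc_ex)
  have *: "(B + h) ^ Suc d - B ^ Suc d - of_nat (Suc d) * h * B ^ (Suc d - 1) =
      Z * (B + h) + of_nat d * (h * h * B ^ (d - 1))"
    by (simp add: Z_def d algebra_simps)
  have "degree (B + h) \<le> N"
    using assms by (intro degree_add_le) auto
  moreover have "degree Z \<le> (d - 2) * N + 2 * degree h"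
    using step.IH by (simp add: Z_def)
  ultimately have 1: "degree (Z * (B + h)) \<le> (d - 1) * N + 2 * degree h"
    using degree_mult_le[of Z "B + h"] by (simp add: d)
  have "degree (h * h * B ^ (d - 1)) \<le> (d - 1) * N + 2 * degree h"
    using degree_mult_le[of "h * h" "B ^ (d - 1)"] degree_mult_le[of h h]
      degree_power_le[of B "d - 1"] assms by (simp add: mult.commute)
  then have 2: "degree (of_nat d * (h * h * B ^ (d - 1))) \<le> (d - 1) * N + 2 * degree h"
    using degree_mult_le[of "of_nat d" "h * h * B ^ (d - 1)"] by simp
  show ?case
    unfolding * using degree_add_le[OF 1 2] by simp
qed

lemma degree_mult_monic_power:
  fixes B h :: "'a::idom poly"
  assumes "degree B = N" "lead_coeff B = 1" "h \<noteq> 0"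
  shows "degree (h * B ^ k) = degree h + k * N"
proof -
  have "B \<noteq> 0"
    using assms(2) by auto
  then show ?thesis
    using assms by (simp add: degree_mult_eq degree_power_eq)
qed

text \<open>If \<open>h = A - B\<close> were nonzero, the linear term
  \<open>d * h * B ^ (d - 1)\<close> would dominate \<open>A ^ d - B ^ d\<close> and give it degree
  at least (d - 1) N. The lemma later identifies a root built over C[u] with one built from
  series.\<close>

lemma approximate_root_unique:
  fixes A B P :: "'a::{idom,ring_char_0} poly"
  assumes A: "degree A = N" "lead_coeff A = 1" and B: "degree B = N" "lead_coeff B = 1"
    and "2 \<le> d"
    and PA: "degree (P - A ^ d) < (d - 1) * N" and PB: "degree (P - B ^ d) < (d - 1) * N"
  shows "A = B"
proof (rule ccontr)
  define h where "h = A - B"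
  assume "A \<noteq> B"
  then have h0: "h \<noteq> 0"
    by (simp add: h_def)
  have "N > 0"
    using PA by (cases N) auto
  have hN: "degree h < N"
    using A B h0 \<open>N > 0\<close> unfolding h_def
    by (metis coeff_diff degree_diff_less diff_self leading_coeff_0_iff order_less_le degree_diff_le_max max.idem)
  define Z where "Z = (B + h) ^ d - B ^ d - of_nat d * h * B ^ (d - 1)"
  have Z: "degree Z \<le> (d - 2) * N + 2 * degree h"
    unfolding Z_def using B(1) hN \<open>2 \<le> d\<close> by (rule degree_binomial_remainder)
  have "(d - 1) * N = (d - 2) * N + N"
    using \<open>2 \<le> d\<close> by (metis Suc_1 Suc_diff_Suc Suc_le_eq mult_Suc add.commute diff_Suc_1 numeral_2_eq_2 diff_Suc_Suc)
  then have Z': "degree Z < (d - 1) * N + degree h"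
    using Z hN by simp
  have dh: "degree (of_nat d * h * B ^ (d - 1)) = degree h + (d - 1) * N"
    using degree_mult_monic_power[OF B, of "of_nat d * h" "d - 1"] h0 \<open>2 \<le> d\<close>
    by (simp add: degree_mult_eq)
  have "A ^ d - B ^ d = of_nat d * h * B ^ (d - 1) + Z"
    by (simp add: Z_def h_def)
  then have "degree (A ^ d - B ^ d) = degree h + (d - 1) * N"
    using degree_add_eq_left[of Z "of_nat d * h * B ^ (d - 1)"] Z' dh by simp
  moreover have "degree (A ^ d - B ^ d) < (d - 1) * N"
    using degree_diff_less[OF PB PA] by simp
  ultimately show False
    by simp
qed

text \<open>Repeated division by powers of \<open>B\<close>. \<open>Q\<close> stands for invariance
  under conjugation, which division with remainder preserves; the last clause keeps the top digit
  accessible as a quotient.\<close>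

lemma digit_expansion:
  fixes B :: "'a::field poly"
  assumes B: "degree B = N" "lead_coeff B = 1" "0 < N"
    and Q1: "\<And>p q. Q p \<Longrightarrow> Q q \<Longrightarrow> Q (p div q)" and Q2: "\<And>p q. Q p \<Longrightarrow> Q q \<Longrightarrow> Q (p mod q)"
    and Q3: "\<And>k. Q (B ^ k)"
  shows "Q p \<Longrightarrow> degree p < n * N \<Longrightarrow>
    \<exists>s. (\<forall>a<n. degree (s a) < N \<and> Q (s a)) \<and> p = (\<Sum>a<n. s a * B ^ a) \<and>
      (0 < n \<longrightarrow> s (n - 1) = p div B ^ (n - 1))"
proof (induction n arbitrary: p)
  case (Suc n)
  have B0: "B \<noteq> 0"
    using B by auto
  have dB: "degree (B ^ n) = n * N"
    using B B0 by (simp add: degree_power_eq)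
  have r: "degree (p mod B ^ n) < n * N" if "n > 0"
  proof (cases "p mod B ^ n = 0")
    case False
    then show ?thesis
      using degree_mod_less[of "B ^ n" p] B0 dB by auto
  qed (use that B in simp)
  have r0: "p mod B ^ n = 0" if "n = 0"
    using that by simp
  have "\<exists>s. (\<forall>a<n. degree (s a) < N \<and> Q (s a)) \<and> p mod B ^ n = (\<Sum>a<n. s a * B ^ a)"
    using r r0 Suc.IH[of "p mod B ^ n"] Q2[OF Suc.prems(1) Q3] by (cases "n = 0") auto
  then obtain s where s: "\<forall>a<n. degree (s a) < N \<and> Q (s a)" "p mod B ^ n = (\<Sum>a<n. s a * B ^ a)"
    by blast
  have "degree (p div B ^ n) < N"
  proof (cases "p div B ^ n = 0")
    case False
    let ?q = "p div B ^ n * B ^ n"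
    have q: "degree ?q = degree (p div B ^ n) + n * N"
      using degree_mult_monic_power[OF B(1,2) False] .
    have "degree (?q + p mod B ^ n) = degree ?q"
    proof (cases "n = 0")
      case False
      then show ?thesis
        using r q by (intro degree_add_eq_left) simp
    qed (simp add: r0)
    then have "degree p = degree (p div B ^ n) + n * N"
      using q by (simp only: div_mult_mod_eq)
    then show ?thesis
      using Suc.prems(2) by simp
  qed (use B in simp)
  moreover have "p = p mod B ^ n + (p div B ^ n) * B ^ n"
    by (simp only: mod_div_mult_eq)
  ultimately show ?case
    using s Q1[OF Suc.prems(1) Q3]
    by (intro exI[of _ "\<lambda>a. if a = n then p div B ^ n else s a"]) (auto simp: less_Suc_eq)
qed simp


section \<open>Invariant polynomials on discs around conjugate series\<close>

text \<open>\<open>W\<close> is the part of a Puiseux series above the exponent \<open>\<kappa>\<close>; the \<open>N\<close> discs of radius \<open>\<kappa>\<close>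
  around its conjugates are disjoint, and \<open>\<delta>\<close> is the degree of \<open>g = \<Prod> (Y - W\<^sub>i)\<close> on the
  disc around \<open>W\<close>.\<close>

locale conjugates =
  fixes N :: nat and \<omega> :: "'a::field_char_0" and \<kappa> :: int and W :: "'a fls"
  assumes omega: "\<omega> \<noteq> 0" and N_pos: "0 < N"
    and rot_W: "rot (\<omega> ^ N) W = W"
    and apart: "\<And>i. 0 < i \<Longrightarrow> i < N \<Longrightarrow> \<not> deg_le (W - rot (\<omega> ^ i) W) \<kappa>"
begin

sublocale rot: field_hom "rot \<omega>"
  using omega by (rule rot_field_hom)

sublocale rot_poly: map_poly_inj_idom_hom "rot \<omega>" ..

definition fixed :: "'a fls poly \<Rightarrow> bool" where
  "fixed f \<longleftrightarrow> map_poly (rot \<omega>) f = f"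

definition W_conj :: "nat \<Rightarrow> 'a fls" where
  "W_conj i = rot (\<omega> ^ i) W"

text \<open>This is the value at \<open>W\<close> of the derivative of \<open>g\<close>, hence the
  denominator in Lagrange interpolation.\<close>

definition E :: "'a fls" where
  "E = (\<Prod>i\<in>{0<..<N}. W - W_conj i)"

definition D :: int where
  "D = - fls_subdegree E"

definition \<delta> :: int where
  "\<delta> = \<kappa> + D"

definition g :: "'a fls poly" where
  "g = (\<Prod>i<N. [:- W_conj i, 1:])"

lemma omega_power: "\<omega> ^ i \<noteq> 0"
  using omega by simp

lemma W_conj_0 [simp]: "W_conj 0 = W"
  by (simp add: W_conj_def)

lemma W_conj_diff: "i \<le> j \<Longrightarrow> W_conj i - W_conj j = rot (\<omega> ^ i) (W - W_conj (j - i))"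
proof -
  assume "i \<le> j"
  interpret r: field_hom "rot (\<omega> ^ i)"
    using omega_power by (rule rot_field_hom)
  have "\<omega> ^ i * \<omega> ^ (j - i) = \<omega> ^ j"
    using \<open>i \<le> j\<close> by (simp flip: power_add)
  then show ?thesis
    by (simp add: W_conj_def r.hom_minus rot_rot[OF omega_power omega_power])
qed

lemma W_conj_apart: "0 < i \<Longrightarrow> i < N \<Longrightarrow> \<not> deg_le (W - W_conj i) \<kappa>"
  unfolding W_conj_def by (rule apart)

lemma W_conj_apart2: "i < N \<Longrightarrow> j < N \<Longrightarrow> i \<noteq> j \<Longrightarrow> \<not> deg_le (W_conj i - W_conj j) \<kappa>"
proof (induction i j rule: linorder_wlog)
  case (le i j)
  then show ?case
    using W_conj_apart[of "j - i"] by (simp add: W_conj_diff deg_le_rot[OF omega_power])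
next
  case (sym i j)
  then show ?case
    by (metis minus_diff_eq deg_le_uminus)
qed

lemma W_conj_inj: "i < N \<Longrightarrow> j < N \<Longrightarrow> W_conj i = W_conj j \<Longrightarrow> i = j"
  using W_conj_apart2[of i j] by auto

lemma fixed_poly: "fixed f \<Longrightarrow> poly f (rot \<omega> x) = rot \<omega> (poly f x)"
  unfolding fixed_def by (metis rot.poly_map_poly)

lemma rot_power_Suc: "rot (\<omega> ^ Suc i) x = rot \<omega> (rot (\<omega> ^ i) x)"
  using omega omega_power by (simp add: rot_rot)

lemma fixed_poly_power: "fixed f \<Longrightarrow> poly f (rot (\<omega> ^ i) x) = rot (\<omega> ^ i) (poly f x)"
  by (induction i) (simp_all add: rot_power_Suc fixed_poly del: power_Suc)

lemma fixed_0 [simp]: "fixed 0" and fixed_1 [simp]: "fixed 1"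
  by (simp_all add: fixed_def)

lemma fixed_arith:
  assumes "fixed p" "fixed q"
  shows "fixed (p + q)" "fixed (p - q)" "fixed (p * q)" "fixed (p ^ n)" "fixed (p div q)" "fixed (p mod q)"
    "fixed (pderiv p)"
  using assms unfolding fixed_def
  by (simp_all add: hom_distribs rot.map_poly_div rot.map_poly_mod rot.map_poly_pderiv)

lemma fixed_divide_nat: "fixed (smult (1 / of_nat d) p)" if "fixed p"
  using that unfolding fixed_def by (simp add: hom_distribs)

lemma fixed_g: "fixed g"
proof -
  have *: "rot \<omega> (W_conj i) = W_conj (Suc i)" for i
    unfolding W_conj_def rot_power_Suc ..
  have "W_conj N = W"
    by (simp add: W_conj_def rot_W)
  moreover have "map_poly (rot \<omega>) g = (\<Prod>i<N. [:- W_conj (Suc i), 1:])"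
    by (simp add: g_def hom_distribs rot_poly.hom_prod *)
  moreover have "(\<Prod>i<N. [:- W_conj (Suc i), 1:]) = (\<Prod>i\<in>{1..N}. [:- W_conj i, 1:])"
    by (rule prod.reindex_bij_witness[of _ "\<lambda>i. i - 1" Suc]) auto
  moreover have "{1..N} = insert N {1..<N}" "{..<N} = insert 0 {1..<N}"
    using N_pos by auto
  ultimately show ?thesis
    by (simp add: fixed_def g_def)
qed

lemma degree_g: "degree g = N" and lead_coeff_g: "lead_coeff g = 1"
proof -
  show "degree g = N"
    unfolding g_def by (subst degree_prod_eq_sum_degree) auto
  show "lead_coeff g = 1"
    unfolding g_def lead_coeff_prod by simp
qed

lemma E_nonzero: "E \<noteq> 0"
proof -
  have "W - W_conj i \<noteq> 0" if "0 < i" "i < N" for i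
    using W_conj_apart[OF that] by auto
  then show ?thesis
    by (auto simp: E_def)
qed

lemma deg_le_E: "deg_le E D" and nth_E: "E $$ (- D) \<noteq> 0"
  using E_nonzero by (simp_all add: D_def deg_le_self)

lemma D_eq: "D = (\<Sum>i\<in>{0<..<N}. - fls_subdegree (W - W_conj i))"
proof -
  have "W - W_conj i \<noteq> 0" if "i \<in> {0<..<N}" for i
    using W_conj_apart[of i] that by auto
  then have "fls_subdegree E = (\<Sum>i\<in>{0<..<N}. fls_subdegree (W - W_conj i))"
    unfolding E_def by (rule fls_subdegree_prod)
  then show ?thesis
    by (simp add: D_def sum_negf)
qed

text \<open>Both sides are the derivative of \<open>g\<close> at the j-th conjugate: the derivative
  is invariant, so its value there is the conjugate of its value \<open>E\<close> at
  \<open>W\<close>.\<close>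

lemma prod_W_conj_diff: "j < N \<Longrightarrow> (\<Prod>i\<in>{..<N} - {j}. W_conj j - W_conj i) = rot (\<omega> ^ j) E"
proof -
  assume j: "j < N"
  have *: "poly (pderiv g) (W_conj j) = (\<Prod>i\<in>{..<N} - {j}. W_conj j - W_conj i)" if "j < N" for j
  proof -
    have "poly (pderiv g) (W_conj j) = (\<Sum>a<N. \<Prod>i\<in>{..<N} - {a}. W_conj j - W_conj i)"
      unfolding g_def pderiv_prod poly_sum by (simp add: poly_prod pderiv_pCons)
    also have "\<dots> = (\<Sum>a\<in>{j}. \<Prod>i\<in>{..<N} - {a}. W_conj j - W_conj i)"
      using that by (intro sum.mono_neutral_right) auto
    finally show ?thesis
      by simp
  qed
  have "E = poly (pderiv g) W"
    using *[OF N_pos] unfolding E_def by (simp, intro prod.cong) auto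
  then show ?thesis
    using *[OF j] fixed_poly_power[OF fixed_arith(7)[OF fixed_g fixed_g], of j W] by (simp add: W_conj_def)
qed

text \<open>The values of an invariant \<open>f\<close> at the conjugates are the conjugates of
  \<open>poly f W\<close>, and the denominators are those of \<open>E\<close>. So the single series
  \<open>poly f W / E\<close> determines \<open>f\<close>, whose degree is below the number N of
  nodes.\<close>

lemma lagrange:
  assumes "fixed f" "degree f < N"
  shows "poly f x = (\<Sum>j<N. rot (\<omega> ^ j) (poly f W / E) * (\<Prod>i\<in>{..<N} - {j}. x - W_conj i))"
proof -
  define h where "h = (\<Sum>j<N. smult (rot (\<omega> ^ j) (poly f W / E)) (\<Prod>i\<in>{..<N} - {j}. [:- W_conj i, 1:]))"
  have h: "poly h x = (\<Sum>j<N. rot (\<omega> ^ j) (poly f W / E) * (\<Prod>i\<in>{..<N} - {j}. x - W_conj i))" for x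
    by (simp add: h_def poly_sum poly_prod)
  have eq: "poly h (W_conj a) = poly f (W_conj a)" if a: "a < N" for a
  proof -
    interpret r: field_hom "rot (\<omega> ^ a)"
      using omega_power by (rule rot_field_hom)
    have "poly h (W_conj a) = (\<Sum>j\<in>{a}. rot (\<omega> ^ j) (poly f W / E) * (\<Prod>i\<in>{..<N} - {j}. W_conj a - W_conj i))"
      unfolding h using a by (intro sum.mono_neutral_right) auto
    also have "\<dots> = rot (\<omega> ^ a) (poly f W / E) * rot (\<omega> ^ a) E"
      using prod_W_conj_diff[OF a] by simp
    also have "\<dots> = rot (\<omega> ^ a) (poly f W)"
      using E_nonzero by (simp flip: r.hom_mult)
    finally show ?thesis
      by (simp add: W_conj_def fixed_poly_power[OF assms(1)])
  qed
  have dh: "degree h < N"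
  proof -
    have "degree (\<Prod>i\<in>{..<N} - {j}. [:- W_conj i, 1:]) \<le> N - 1" if "j < N" for j
      using that by (subst degree_prod_eq_sum_degree) auto
    then have "degree h \<le> N - 1"
      unfolding h_def by (intro degree_sum_le order.trans[OF degree_smult_le]) auto
    then show ?thesis
      using N_pos by simp
  qed
  have "h = f"
  proof (rule ccontr)
    assume "h \<noteq> f"
    then have nz: "h - f \<noteq> 0"
      by simp
    have "card (W_conj ` {..<N}) \<le> card {x. poly (h - f) x = 0}"
      using eq by (intro card_mono poly_roots_finite[OF nz]) auto
    moreover have "card (W_conj ` {..<N}) = N"
      using W_conj_inj by (subst card_image) (auto intro: inj_onI)
    ultimately show False
      using card_poly_roots_bound[OF nz] degree_diff_less[OF dh assms(2)] by simp
  qed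
  then show ?thesis
    using h[of x] by (simp only:)
qed

lemma W_conj_subdegree:
  assumes "0 < i" "i < N"
  shows "\<kappa> < - fls_subdegree (W - W_conj i)" "W - W_conj i \<noteq> 0"
  using W_conj_apart[OF assms] by (auto simp: deg_le_iff_subdegree)

text \<open>The difference \<open>W - W_conj i\<close> has degree above \<kappa>, so a shift by
  \<open>e\<close> of degree at most \<kappa> cannot touch its leading term.\<close>

lemma
  assumes e: "deg_le e \<kappa>" and i: "0 < i" "i < N"
  shows deg_le_shifted: "deg_le (W + e - W_conj i) (- fls_subdegree (W - W_conj i))"
    and nth_shifted: "(W + e - W_conj i) $$ fls_subdegree (W - W_conj i) =
      (W - W_conj i) $$ fls_subdegree (W - W_conj i)"
proof -
  let ?k = "- fls_subdegree (W - W_conj i)"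
  have *: "W + e - W_conj i = (W - W_conj i) + e"
    by simp
  show "deg_le (W + e - W_conj i) ?k"
    unfolding * using W_conj_subdegree(1)[OF i]
    by (intro deg_le_add deg_le_self deg_le_mono[OF e]) simp
  show "(W + e - W_conj i) $$ fls_subdegree (W - W_conj i) =
      (W - W_conj i) $$ fls_subdegree (W - W_conj i)"
    unfolding * using W_conj_subdegree(1)[OF i] deg_leD[OF e] by simp
qed

lemma
  assumes e: "deg_le e \<kappa>"
  shows deg_le_shifted_prod: "deg_le (\<Prod>i\<in>{0<..<N}. W + e - W_conj i) D"
    and nth_shifted_prod: "(\<Prod>i\<in>{0<..<N}. W + e - W_conj i) $$ (- D) = E $$ (- D)"
proof -
  let ?k = "\<lambda>i. - fls_subdegree (W - W_conj i)"
  have 1: "deg_le (W + e - W_conj i) (?k i)" if "i \<in> {0<..<N}" for i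
    using deg_le_shifted[OF e, of i] that by auto
  show "deg_le (\<Prod>i\<in>{0<..<N}. W + e - W_conj i) D"
    unfolding D_eq by (rule deg_le_prod[OF 1])
  have "(\<Prod>i\<in>{0<..<N}. W + e - W_conj i) $$ (- D) = (\<Prod>i\<in>{0<..<N}. (W + e - W_conj i) $$ (- ?k i))"
    unfolding D_eq using 1 by (rule nth_prod_deg_le)
  also have "\<dots> = (\<Prod>i\<in>{0<..<N}. (W - W_conj i) $$ (- ?k i))"
    using nth_shifted[OF e] by (intro prod.cong) auto
  also have "\<dots> = E $$ (- D)"
    unfolding D_eq E_def by (rule nth_prod_deg_le[symmetric]) (rule deg_le_self)
  finally show "(\<Prod>i\<in>{0<..<N}. W + e - W_conj i) $$ (- D) = E $$ (- D)" .
qed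

text \<open>An invariant polynomial of degree below \<open>N\<close> is constant on the disc to leading order:
  in its interpolation at the conjugates of \<open>W\<close> only the term of \<open>W\<close> itself has full degree.\<close>

lemma
  assumes f: "fixed f" "degree f < N" and e: "deg_le e \<kappa>" and fW: "deg_le (poly f W) \<phi>"
  shows deg_le_poly_shifted: "deg_le (poly f (W + e)) \<phi>"
    and nth_poly_shifted: "poly f (W + e) $$ (- \<phi>) = poly f W $$ (- \<phi>)"
proof -
  let ?Q = "poly f W / E"
  let ?G = "\<lambda>j. \<Prod>i\<in>{..<N} - {j}. W + e - W_conj i"
  let ?t = "\<lambda>j. rot (\<omega> ^ j) ?Q * ?G j"
  have Q: "deg_le ?Q (\<phi> - D)"
    using deg_le_divide[OF fW E_nonzero] by (simp add: D_def)
  have "?Q * E = poly f W"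
    using E_nonzero by simp
  then have nQ: "?Q $$ (- (\<phi> - D)) * E $$ (- D) = poly f W $$ (- \<phi>)"
    using nth_mult_deg_le[OF Q deg_le_E] by simp
  have G0: "?G 0 = (\<Prod>i\<in>{0<..<N}. W + e - W_conj i)"
    by (intro prod.cong) auto
  have t0: "deg_le (?t 0) \<phi>" "?t 0 $$ (- \<phi>) = poly f W $$ (- \<phi>)"
    using deg_le_mult[OF Q deg_le_shifted_prod[OF e]] nth_mult_deg_le[OF Q deg_le_shifted_prod[OF e]] nQ
    unfolding G0 nth_shifted_prod[OF e] by simp_all
  \<comment> \<open>For j > 0 the product contains the factor \<open>e\<close> coming from i = 0 and
    lacks the j-th factor. A factor of degree above \<kappa> is thus traded for one of degree at
    most \<kappa>, which costs at least one degree.\<close>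
  have t: "deg_le (?t j) (\<phi> - 1)" if j: "0 < j" "j < N" for j
  proof -
    have "{..<N} - {j} = insert 0 ({0<..<N} - {j})"
      using j by auto
    then have "?G j = e * (\<Prod>i\<in>{0<..<N} - {j}. W + e - W_conj i)"
      by simp
    moreover have "deg_le (\<Prod>i\<in>{0<..<N} - {j}. W + e - W_conj i)
        (\<Sum>i\<in>{0<..<N} - {j}. - fls_subdegree (W - W_conj i))"
      using deg_le_shifted[OF e] by (intro deg_le_prod) auto
    ultimately have "deg_le (?G j) (\<kappa> + (\<Sum>i\<in>{0<..<N} - {j}. - fls_subdegree (W - W_conj i)))"
      using deg_le_mult[OF e] by simp
    moreover have "(\<Sum>i\<in>{0<..<N} - {j}. - fls_subdegree (W - W_conj i)) = D + fls_subdegree (W - W_conj j)"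
      unfolding D_eq using j by (subst sum_diff1) auto
    ultimately have "deg_le (?G j) (D - 1)"
      using W_conj_subdegree(1)[OF j] by (auto elim!: deg_le_mono)
    moreover have "deg_le (rot (\<omega> ^ j) ?Q) (\<phi> - D)"
      using Q by (simp only: deg_le_rot[OF omega_power])
    moreover have "\<phi> - D + (D - 1) = \<phi> - 1"
      by simp
    ultimately show ?thesis
      using deg_le_mult[of "rot (\<omega> ^ j) ?Q" "\<phi> - D" "?G j" "D - 1"] by (simp only:)
  qed
  have "{..<N} = insert 0 {0<..<N}"
    using N_pos by auto
  then have eq: "poly f (W + e) = ?t 0 + (\<Sum>j\<in>{0<..<N}. ?t j)"
    using lagrange[OF f, of "W + e"] by (simp only: sum.insert finite_greaterThanLessThan greaterThanLessThan_iff less_irrefl simp_thms)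
  have r: "deg_le (\<Sum>j\<in>{0<..<N}. ?t j) (\<phi> - 1)"
    using t by (intro deg_le_sum) auto
  show "deg_le (poly f (W + e)) \<phi>"
    unfolding eq using t0(1) deg_le_mono[OF r, of \<phi>] by (intro deg_le_add) auto
  show "poly f (W + e) $$ (- \<phi>) = poly f W $$ (- \<phi>)"
    unfolding eq using t0(2) deg_leD[OF r, of "- \<phi>"] by simp
qed

text \<open>On the disc the leading coefficient of \<open>g\<close> is linear in that of
  \<open>e\<close>, with nonzero slope \<open>E $$ (- D)\<close>. This dependence is what later
  excludes cancellation between digits.\<close>

lemma
  assumes e: "deg_le e \<kappa>"
  shows deg_le_poly_g: "deg_le (poly g (W + e)) \<delta>"
    and nth_poly_g: "poly g (W + e) $$ (- \<delta>) = E $$ (- D) * e $$ (- \<kappa>)"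
proof -
  have "{..<N} = insert 0 {0<..<N}"
    using N_pos by auto
  then have "poly g (W + e) = e * (\<Prod>i\<in>{0<..<N}. W + e - W_conj i)"
    by (simp add: g_def poly_prod flip: left_diff_distrib)
  then show "deg_le (poly g (W + e)) \<delta>" "poly g (W + e) $$ (- \<delta>) = E $$ (- D) * e $$ (- \<kappa>)"
    using deg_le_mult[OF e deg_le_shifted_prod[OF e]] nth_mult_deg_le[OF e deg_le_shifted_prod[OF e]]
    by (simp_all add: \<delta>_def nth_shifted_prod[OF e])
qed

lemma
  assumes R: "fixed R" "degree R < N" "deg_le (poly R W) \<delta>" and e: "deg_le e \<kappa>"
  shows deg_le_perturbed: "deg_le (poly (g + R) (W + e)) \<delta>"
    and nth_perturbed: "poly (g + R) (W + e) $$ (- \<delta>) = E $$ (- D) * e $$ (- \<kappa>) + poly R W $$ (- \<delta>)"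
  using deg_le_add[OF deg_le_poly_g[OF e] deg_le_poly_shifted[OF R(1,2) e R(3)]]
    nth_poly_g[OF e] nth_poly_shifted[OF R(1,2) e R(3)]
  by simp_all

lemma degree_perturbed:
  assumes "degree R < N"
  shows "degree (g + R) = N" "lead_coeff (g + R) = 1"
  using assms lead_coeff_g degree_g by (simp_all add: degree_add_eq_left coeff_eq_0)

text \<open>On the points \<open>W + z \<tau>\<^sup>\<kappa>\<close> the digits are constant to leading order while \<open>g + R\<close> grows like
  \<open>(c z + r) \<tau>\<^sup>\<delta>\<close>; since \<open>z\<close> is arbitrary, the leading terms of the expansion cannot cancel.\<close>

lemma digit_bound:
  assumes R: "fixed R" "degree R < N" "deg_le (poly R W) \<delta>"
    and P: "\<And>e. deg_le e \<kappa> \<Longrightarrow> deg_le (poly P (W + e)) \<mu>"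
    and s: "\<And>a. a < n \<Longrightarrow> fixed (s a) \<and> degree (s a) < N"
    and P_eq: "P = (\<Sum>a<n. s a * (g + R) ^ a)"
    and a: "a < n"
  shows "deg_le (poly (s a) W) (\<mu> - int a * \<delta>)"
proof (rule ccontr)
  assume contr: "\<not> deg_le (poly (s a) W) (\<mu> - int a * \<delta>)"
  define d where "d b = int b * \<delta> - fls_subdegree (poly (s b) W)" for b
  define A where "A = {b. b < n \<and> poly (s b) W \<noteq> 0}"
  define M where "M = Max (d ` A)"
  have "finite A"
    by (simp add: A_def)
  have aA: "a \<in> A" and da: "\<mu> < d a"
    using contr a by (auto simp: A_def d_def deg_le_iff_subdegree)
  then have M: "\<mu> < M"
    using \<open>finite A\<close> by (metis M_def Max_ge finite_imageI image_eqI less_le_trans)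
  have "M \<in> d ` A"
    unfolding M_def using \<open>finite A\<close> aA by (intro Max_in) auto
  then obtain b where b: "b \<in> A" "d b = M"
    by blast
  have sb: "deg_le (poly (s b) W) (M - int b * \<delta>)" if "b < n" for b
  proof (cases "b \<in> A")
    case True
    then have "d b \<le> M"
      using \<open>finite A\<close> by (simp add: M_def)
    then show ?thesis
      by (simp add: deg_le_iff_subdegree d_def)
  qed (use that in \<open>simp add: A_def\<close>)
  define c r where "c = E $$ (- D)" and "r = poly R W $$ (- \<delta>)"
  define q where "q = (\<Sum>b<n. monom (poly (s b) W $$ (int b * \<delta> - M)) b)"
  have "poly q (c * z + r) = 0" for z
  proof -
    define e where "e = fls_shift \<kappa> (fls_const z)"
    have e: "deg_le e \<kappa>" "e $$ (- \<kappa>) = z"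
      by (auto simp: e_def deg_le_def)
    have B: "deg_le (poly (g + R) (W + e)) \<delta>" "poly (g + R) (W + e) $$ (- \<delta>) = c * z + r"
      using deg_le_perturbed[OF R e(1)] nth_perturbed[OF R e(1)] e(2) by (simp_all add: c_def r_def)
    have summand: "(poly (s b) (W + e) * poly (g + R) (W + e) ^ b) $$ (- M) =
        poly (s b) W $$ (int b * \<delta> - M) * (c * z + r) ^ b" if "b < n" for b
    proof -
      note sf = conjunct1[OF s[OF that]] conjunct2[OF s[OF that]] e(1) sb[OF that]
      show ?thesis
        using nth_mult_deg_le[OF deg_le_poly_shifted[OF sf] deg_le_power[OF B(1), of b]]
          nth_poly_shifted[OF sf] nth_power_deg_le[OF B(1), of b] B(2) by simp
    qed
    have "poly P (W + e) $$ (- M) = (\<Sum>b<n. (poly (s b) (W + e) * poly (g + R) (W + e) ^ b) $$ (- M))"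
      by (simp add: P_eq poly_sum nth_sum_fls)
    also have "\<dots> = poly q (c * z + r)"
      unfolding q_def poly_sum poly_monom by (rule sum.cong) (simp_all add: summand del: poly_add)
    finally show ?thesis
      using deg_leD[OF P[OF e(1)], of "- M"] M by simp
  qed
  moreover have "c \<noteq> 0"
    by (simp add: c_def nth_E)
  ultimately have "poly q z = 0" for z
    by (metis add.commute add_diff_cancel_left' diff_add_cancel nonzero_mult_div_cancel_left times_divide_eq_right)
  then have "q = 0"
    using poly_all_0_iff_0 by blast
  then have "coeff q b = 0"
    by simp
  moreover have "coeff q b = poly (s b) W $$ (int b * \<delta> - M)"
    using b(1) by (simp add: q_def coeff_sum A_def sum.delta)
  moreover have "int b * \<delta> - M = fls_subdegree (poly (s b) W)"
    using b(2) by (simp add: d_def)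
  ultimately show False
    using b(1) by (simp add: A_def)
qed

text \<open>Tschirnhausen's iteration: if \<open>s\<close> is the top digit of \<open>P - B ^ d\<close>, then replacing \<open>B\<close> by
  \<open>B + s / d\<close> lowers the degree of \<open>P - B ^ d\<close>. This is where characteristic 0 enters.\<close>

lemma exists_approximate_root:
  assumes "2 \<le> d" and P: "fixed P" "degree P = d * N" "lead_coeff P = 1"
    and bound: "\<And>e. deg_le e \<kappa> \<Longrightarrow> deg_le (poly P (W + e)) (int d * \<delta>)"
  shows "\<exists>R. fixed R \<and> degree R < N \<and> deg_le (poly R W) \<delta> \<and> degree (P - (g + R) ^ d) < (d - 1) * N"
proof -
  define Q where "Q R \<longleftrightarrow> fixed R \<and> degree R < N \<and> deg_le (poly R W) \<delta>" for R
  have Q0: "Q 0"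
    using N_pos by (simp add: Q_def)
  \<comment> \<open>Minimality replaces the iteration: a further Tschirnhausen step would lower the
    degree below this minimum.\<close>
  obtain R where R: "Q R" and min: "\<And>R'. Q R' \<Longrightarrow> degree (P - (g + R) ^ d) \<le> degree (P - (g + R') ^ d)"
    using ex_has_least_nat[of Q 0 "\<lambda>R. degree (P - (g + R) ^ d)", OF Q0] by blast
  note R' = R[unfolded Q_def]
  define B where "B = g + R"
  have B: "degree B = N" "lead_coeff B = 1"
    using degree_perturbed[of R] R' by (simp_all add: B_def)
  define T where "T = P - B ^ d"
  have fB: "fixed B"
    using R' fixed_g by (simp add: B_def fixed_arith)
  have fT: "fixed T"
    using fB P by (simp add: T_def fixed_arith)
  have B0: "B \<noteq> 0"
    using B by auto
  have dBd: "degree (B ^ d) = d * N" "lead_coeff (B ^ d) = 1"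
    using B B0 by (simp add: degree_power_eq, simp only: lead_coeff_power power_one)
  have dT: "degree T < d * N"
  proof (cases "T = 0")
    case False
    have "degree T \<le> d * N"
      unfolding T_def using P dBd by (intro degree_diff_le) auto
    moreover have "coeff T (d * N) = 0"
      using P dBd by (simp add: T_def)
    ultimately show ?thesis
      using False by (metis leading_coeff_0_iff le_neq_implies_less)
  qed (use \<open>2 \<le> d\<close> N_pos in simp)
  have "degree T < (d - 1) * N"
  proof (rule ccontr)
    assume "\<not> degree T < (d - 1) * N"
    obtain s where s: "\<And>a. a < d \<Longrightarrow> degree (s a) < N \<and> fixed (s a)" "T = (\<Sum>a<d. s a * B ^ a)"
        "s (d - 1) = T div B ^ (d - 1)"
      using digit_expansion[of B N fixed T d, OF B N_pos _ _ _ fT dT] fixed_arith(5,6) fixed_arith(4)[OF fB fB] \<open>2 \<le> d\<close>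
      by auto
    define h where "h = s (d - 1)"
    have dm: "d - 1 < d" "d - 1 = Suc (d - 2)" "d - (d - 1) = 1"
      using \<open>2 \<le> d\<close> by auto
    have h: "degree h < N" "fixed h"
      using s(1)[OF dm(1)] by (simp_all add: h_def)
    \<comment> \<open>A digit 1 at position d turns the expansion of \<open>T\<close> into one of
      \<open>P\<close>, the polynomial for which a bound on the disc is known.\<close>
    define s' where "s' a = (if a = d then 1 else s a)" for a
    have "P = (\<Sum>a<Suc d. s' a * (g + R) ^ a)"
    proof -
      have "(\<Sum>a<d. s' a * B ^ a) = (\<Sum>a<d. s a * B ^ a)"
        by (intro sum.cong) (auto simp: s'_def)
      then show ?thesis
        unfolding B_def[symmetric] using s(2) by (simp add: s'_def T_def algebra_simps)
    qed
    then have "deg_le (poly (s' (d - 1)) W) (int d * \<delta> - int (d - 1) * \<delta>)"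
      using R' bound s(1) N_pos \<open>2 \<le> d\<close>
      by (intro digit_bound[of R P "int d * \<delta>" "Suc d" s' "d - 1"]) (auto simp: s'_def less_Suc_eq)
    moreover have "int d * \<delta> - int (d - 1) * \<delta> = \<delta>"
      using \<open>2 \<le> d\<close> by (simp add: of_nat_diff algebra_simps)
    moreover have "s' (d - 1) = h"
      using \<open>2 \<le> d\<close> by (simp add: s'_def h_def)
    ultimately have hW: "deg_le (poly h W) \<delta>"
      by (simp only:)
    have Th: "T = h * B ^ (d - 1) + T mod B ^ (d - 1)"
      unfolding h_def s(3) by (rule div_mult_mod_eq[symmetric])
    have dmod: "degree (T mod B ^ (d - 1)) < (d - 1) * N"
      using degree_mod_less[of "B ^ (d - 1)" T] B0 B N_pos \<open>2 \<le> d\<close>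
      by (auto simp: degree_power_eq mult.commute)
    have h0: "h \<noteq> 0"
      using dmod Th \<open>\<not> degree T < (d - 1) * N\<close> by auto
    have "degree (h * B ^ (d - 1)) = degree h + (d - 1) * N"
      using degree_mult_monic_power[OF B h0] .
    then have dTh: "degree T = degree h + (d - 1) * N"
      using Th dmod by (metis add.commute degree_add_eq_left trans_less_add1)
    define h' where "h' = smult (1 / of_nat d) h"
    have d0: "(of_nat d :: 'a fls) \<noteq> 0"
      using \<open>2 \<le> d\<close> by simp
    have dh': "degree h' = degree h"
      using d0 by (simp add: h'_def)
    have hh': "of_nat d * h' = h"
      using d0 by (simp add: h'_def of_nat_poly)
    have "deg_le (poly h' W) \<delta>"
    proof -
      have "poly h' W = poly h W / of_nat d"
        by (simp add: h'_def)
      then show ?thesis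
        using deg_le_divide[OF hW d0] by simp
    qed
    then have QR: "Q (R + h')"
      using R' h dh' fixed_divide_nat[OF h(2)] by (auto simp: Q_def h'_def fixed_arith intro!: degree_add_less deg_le_add)
    define Z where "Z = (B + h') ^ d - B ^ d - of_nat d * h' * B ^ (d - 1)"
    have "degree Z \<le> (d - 2) * N + 2 * degree h'"
      unfolding Z_def using B(1) h(1) dh' \<open>2 \<le> d\<close> by (intro degree_binomial_remainder) auto
    moreover have "(d - 1) * N = (d - 2) * N + N"
      by (metis dm(2) mult_Suc add.commute)
    ultimately have dZ: "degree Z < degree T"
      using dTh dh' h(1) by simp
    have "P - (g + (R + h')) ^ d = T mod B ^ (d - 1) - Z"
      using Th hh' by (simp add: T_def Z_def B_def algebra_simps)
    moreover have "degree (T mod B ^ (d - 1) - Z) < degree T"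
      using dmod dZ dTh by (intro degree_diff_less) auto
    ultimately show False
      using min[OF QR] by (simp add: T_def B_def)
  qed
  then show ?thesis
    using R' by (auto simp: T_def B_def)
qed

text \<open>By uniqueness \<open>A\<close> must be the root \<open>g + R\<close> constructed near
  \<open>W\<close>. So a root found without reference to \<open>W\<close> still obeys the bound
  \<delta>.\<close>

theorem deg_le_approximate_root:
  assumes "2 \<le> d" and P: "fixed P" "degree P = d * N" "lead_coeff P = 1"
    and bound: "\<And>e. deg_le e \<kappa> \<Longrightarrow> deg_le (poly P (W + e)) (int d * \<delta>)"
    and A: "degree A = N" "lead_coeff A = 1" "degree (P - A ^ d) < (d - 1) * N"
    and e: "deg_le e \<kappa>"
  shows "deg_le (poly A (W + e)) \<delta>"
proof -
  obtain R where R: "fixed R" "degree R < N" "deg_le (poly R W) \<delta>" "degree (P - (g + R) ^ d) < (d - 1) * N"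
    using exists_approximate_root[OF assms(1-4) bound] by blast
  have "A = g + R"
    using approximate_root_unique[OF A(1,2) degree_perturbed[OF R(2)] \<open>2 \<le> d\<close> A(3) R(4)] .
  then show ?thesis
    using deg_le_perturbed[OF R(1-3) e] by simp
qed

end

section \<open>The chain of characteristic exponents\<close>

lemma sum_mod_periodic:
  fixes f :: "nat \<Rightarrow> 'b::comm_semiring_1"
  assumes "0 < N"
  shows "(\<Sum>i<d * N. f (i mod N)) = of_nat d * (\<Sum>j<N. f j)"
proof -
  have "(\<Sum>i<d * N. f (i mod N)) = (\<Sum>k<d. \<Sum>i\<in>{k * N..<k * N + N}. f (i mod N))"
    by (rule sum.nat_group[symmetric])
  also have "\<dots> = (\<Sum>k<d. \<Sum>j<N. f j)"
    using assms
    by (intro sum.cong refl sum.reindex_bij_witness[of _ "\<lambda>j. j + _ * N" "\<lambda>i. i mod N"])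
      (auto simp: mod_if[of "_ - _"] le_mod_geq dest!: le_Suc_ex)
  also have "\<dots> = of_nat d * (\<Sum>j<N. f j)"
    by simp
  finally show ?thesis .
qed

text \<open>The combinatorial part needs only two facts about the curve: approximate roots take
  values of positive degree at \<open>V\<close> (\<open>approx_root\<close>), and the differences
  with the conjugates have total degree m - 1 (\<open>different\<close>). Both are proved for
  embedded lines in the locale \<open>embedded_line\<close>.\<close>

locale one_place =
  fixes m :: nat and \<omega> :: "'a::field_char_0" and V :: "'a fls"
  assumes m_pos: "0 < m"
    and omega: "\<omega> \<noteq> 0" and primitive: "\<And>k. \<omega> powi k = 1 \<longleftrightarrow> int m dvd k"
    and distinct: "\<And>i. 0 < i \<Longrightarrow> i < m \<Longrightarrow> V \<noteq> rot (\<omega> ^ i) V"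
    and approx_root: "\<And>d N. 2 \<le> d \<Longrightarrow> m = d * N \<Longrightarrow> \<exists>A. degree A = N \<and> lead_coeff A = 1 \<and>
      degree ((\<Prod>i<m. [:- rot (\<omega> ^ i) V, 1:]) - A ^ d) < (d - 1) * N \<and> \<not> deg_le (poly A V) 0"
    and different: "(\<Sum>i\<in>{0<..<m}. - fls_subdegree (V - rot (\<omega> ^ i) V)) = int m - 1"
begin

definition D :: "nat \<Rightarrow> int" where
  "D i = - fls_subdegree (V - rot (\<omega> ^ i) V)"

text \<open>\<open>D i\<close> is the largest exponent of \<open>V\<close> moved by \<open>\<omega> ^ i\<close>. The jumps are the quotients \<open>m / d\<close>, where
  \<open>d\<close> runs through the successive greatest common divisors of \<open>m\<close> with the characteristic exponents
  of \<open>V\<close>, and \<open>D (m / d)\<close> is the next characteristic exponent.\<close>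

definition jump :: "nat \<Rightarrow> bool" where
  "jump N \<longleftrightarrow> N dvd m \<and> 0 < N \<and> N < m \<and> (\<forall>i. 0 < i \<longrightarrow> i < N \<longrightarrow> D N < D i)"

definition S :: "nat \<Rightarrow> int" where
  "S N = (\<Sum>i\<in>{0<..<N}. D i)"

lemma omega_power: "\<omega> ^ i \<noteq> 0"
  using omega by simp

lemma rot_eq_iff: "x $$ k * (\<omega> ^ i) powi k = x $$ k \<longleftrightarrow> x $$ k = 0 \<or> int m dvd int i * k"
proof -
  have "(\<omega> ^ i) powi k = \<omega> powi (int i * k)"
    by (simp add: power_int_mult)
  then show ?thesis
    using primitive[of "int i * k"] by auto
qed

lemma nth_diff_eq_0_iff: "(V - rot (\<omega> ^ i) V) $$ k = 0 \<longleftrightarrow> V $$ k = 0 \<or> int m dvd int i * k"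
  using rot_eq_iff[of V k i] by (auto simp: nth_rot[OF omega_power])

lemma
  assumes "0 < i" "i < m"
  shows D_nth: "V $$ (- D i) \<noteq> 0" and D_not_dvd: "\<not> int m dvd int i * D i"
    and D_dvd: "\<And>k. D i < k \<Longrightarrow> V $$ (- k) \<noteq> 0 \<Longrightarrow> int m dvd int i * k"
proof -
  have "V - rot (\<omega> ^ i) V \<noteq> 0"
    using distinct[OF assms] by simp
  then have "(V - rot (\<omega> ^ i) V) $$ (- D i) \<noteq> 0"
    unfolding D_def minus_minus by (rule nth_fls_subdegree_nonzero)
  then show "V $$ (- D i) \<noteq> 0" "\<not> int m dvd int i * D i"
    using nth_diff_eq_0_iff[of i "- D i"] by auto
  show "int m dvd int i * k" if "D i < k" "V $$ (- k) \<noteq> 0" for k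
  proof -
    have "(V - rot (\<omega> ^ i) V) $$ (- k) = 0"
      using that by (intro fls_eq0_below_subdegree) (simp add: D_def)
    then show ?thesis
      using that nth_diff_eq_0_iff[of i "- k"] by auto
  qed
qed

lemma D_eqI:
  assumes "V $$ (- k) \<noteq> 0" "\<not> int m dvd int i * k"
    and "\<And>l. k < l \<Longrightarrow> V $$ (- l) \<noteq> 0 \<Longrightarrow> int m dvd int i * l"
  shows "D i = k"
proof -
  have "fls_subdegree (V - rot (\<omega> ^ i) V) = - k"
  proof (rule fls_subdegree_eqI)
    show "(V - rot (\<omega> ^ i) V) $$ (- k) \<noteq> 0"
      using assms(1,2) nth_diff_eq_0_iff[of i "- k"] by auto
    show "(V - rot (\<omega> ^ i) V) $$ j = 0" if "j < - k" for j
      using assms(3)[of "- j"] that nth_diff_eq_0_iff[of i j] by auto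
  qed
  then show ?thesis
    by (simp add: D_def)
qed

text \<open>\<open>S N + D N\<close> is the number \<open>\<delta>\<close> that bounds the degree at \<open>V\<close> of an approximate root.\<close>

lemma jump_step:
  assumes "jump N"
  defines "\<kappa> \<equiv> D N"
  shows "0 < S N + \<kappa>"
proof -
  have N: "N dvd m" "0 < N" "N < m" "\<And>i. 0 < i \<Longrightarrow> i < N \<Longrightarrow> \<kappa> < D i"
    using assms by (auto simp: jump_def)
  obtain d where m: "m = d * N"
    using N(1) by (metis dvd_def mult.commute)
  have "2 \<le> d"
  proof -
    have "d \<noteq> 0" "d \<noteq> 1"
      using m N by auto
    then show ?thesis
      by simp
  qed
  \<comment> \<open>The tail of \<open>V\<close> from exponent \<kappa> downwards; what remains is
    the truncation \<open>W\<close>, and \<open>V\<close> lies in its disc.\<close>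
  define e0 where "e0 = Abs_fls (\<lambda>k. if k < - \<kappa> then 0 else V $$ k)"
  have nth_e0: "e0 $$ k = (if k < - \<kappa> then 0 else V $$ k)" for k
    unfolding e0_def by (rule nth_Abs_fls_lower_bound) auto
  have e0: "deg_le e0 \<kappa>"
    by (simp add: deg_le_def nth_e0)
  define W where "W = V - e0"
  have nth_W: "W $$ k = (if k < - \<kappa> then V $$ k else 0)" for k
    by (simp add: W_def nth_e0)
  have V: "V = W + e0"
    by (simp add: W_def)
  interpret rot_i: field_hom "rot (\<omega> ^ i)" for i
    using omega_power by (rule rot_field_hom)
  have V_W: "V - rot (\<omega> ^ i) V = (W - rot (\<omega> ^ i) W) + (e0 - rot (\<omega> ^ i) e0)" for i
    unfolding V by (simp add: rot_i.hom_add)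
  have e0_diff: "deg_le (e0 - rot (\<omega> ^ i) e0) \<kappa>" for i
    by (intro deg_le_diff) (simp_all only: deg_le_rot[OF omega_power] e0)
  have nth_W_diff: "(W - rot (\<omega> ^ i) W) $$ k = (if k < - \<kappa> then (V - rot (\<omega> ^ i) V) $$ k else 0)" for i k
    by (simp add: nth_W nth_rot[OF omega_power])
  have nz: "(W - rot (\<omega> ^ i) W) $$ (- D i) \<noteq> 0" if i: "0 < i" "i < N" for i
  proof -
    have "V - rot (\<omega> ^ i) V \<noteq> 0"
      using distinct[of i] i N by simp
    then have "(V - rot (\<omega> ^ i) V) $$ (- D i) \<noteq> 0"
      unfolding D_def minus_minus by (rule nth_fls_subdegree_nonzero)
    then show "(W - rot (\<omega> ^ i) W) $$ (- D i) \<noteq> 0"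
      using N(4)[OF i] by (simp only: nth_W_diff) simp
  qed
  have sub: "fls_subdegree (W - rot (\<omega> ^ i) W) = - D i" if i: "0 < i" "i < N" for i
  proof (rule fls_subdegree_eqI[OF nz[OF i]])
    show "(W - rot (\<omega> ^ i) W) $$ k = 0" if "k < - D i" for k
      using that fls_eq0_below_subdegree[of k "V - rot (\<omega> ^ i) V"]
      by (simp only: nth_W_diff) (simp add: D_def)
  qed
  interpret c: conjugates N \<omega> \<kappa> W
  proof
    show "\<omega> \<noteq> 0" "0 < N"
      by (fact omega N)+
    have "W - rot (\<omega> ^ N) W = 0"
    proof (rule fls_eqI)
      fix k
      show "(W - rot (\<omega> ^ N) W) $$ k = 0 $$ k"
        unfolding nth_W_diff using fls_eq0_below_subdegree[of k "V - rot (\<omega> ^ N) V"]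
        by (simp add: \<kappa>_def D_def)
    qed
    then show "rot (\<omega> ^ N) W = W"
      by simp
    show "\<not> deg_le (W - rot (\<omega> ^ i) W) \<kappa>" if i: "0 < i" "i < N" for i
    proof
      assume "deg_le (W - rot (\<omega> ^ i) W) \<kappa>"
      moreover have "W - rot (\<omega> ^ i) W \<noteq> 0"
        using nz[OF i] by auto
      ultimately show False
        using sub[OF i] N(4)[OF i] by (simp add: deg_le_iff_subdegree)
    qed
  qed
  have cD: "c.D = S N"
    unfolding c.D_eq S_def c.W_conj_def by (intro sum.cong) (auto simp: sub)
  define P where "P = (\<Prod>i<m. [:- rot (\<omega> ^ i) V, 1:])"
  obtain A where A: "degree A = N" "lead_coeff A = 1" "degree (P - A ^ d) < (d - 1) * N" "\<not> deg_le (poly A V) 0"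
    using approx_root[OF \<open>2 \<le> d\<close> m] unfolding P_def by blast
  \<comment> \<open>Any bound below all \<open>D i\<close> makes the m full conjugates of
    \<open>V\<close> another instance of \<open>conjugates\<close>; it yields that \<open>P\<close>
    is invariant and monic of degree m.\<close>
  have "\<exists>\<kappa>'. \<forall>i. 0 < i \<longrightarrow> i < m \<longrightarrow> \<kappa>' < D i"
  proof (intro exI allI impI)
    fix i
    assume "0 < i" "i < m"
    then have "Min (D ` {0<..<m}) \<le> D i"
      by simp
    then show "Min (D ` {0<..<m}) - 1 < D i"
      by simp
  qed
  then obtain \<kappa>' where \<kappa>': "\<And>i. 0 < i \<Longrightarrow> i < m \<Longrightarrow> \<kappa>' < D i"
    by blast
  interpret v: conjugates m \<omega> \<kappa>' V
  proof
    show "\<omega> \<noteq> 0" "0 < m"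
      by (fact omega m_pos)+
    have "\<omega> ^ m = 1"
      using primitive[of "int m"] by simp
    then show "rot (\<omega> ^ m) V = V"
      by simp
    show "\<not> deg_le (V - rot (\<omega> ^ i) V) \<kappa>'" if "0 < i" "i < m" for i
      using \<kappa>'[OF that] distinct[OF that] by (auto simp: deg_le_iff_subdegree D_def)
  qed
  have vg: "v.g = P"
    by (simp add: v.g_def P_def v.W_conj_def)
  have P: "c.fixed P" "degree P = d * N" "lead_coeff P = 1"
    using v.fixed_g v.degree_g v.lead_coeff_g by (simp_all only: vg m[symmetric])
  have "deg_le (poly P (W + e)) (int d * c.\<delta>)" if e: "deg_le e \<kappa>" for e
  proof -
    \<comment> \<open>The i-th conjugate of \<open>V\<close> lies in the disc of the conjugate of
      \<open>W\<close> with index i mod N. In the disc of \<open>W\<close> itself only degree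
      \<kappa> remains; otherwise the distance has degree \<open>D j\<close>. Each residue occurs d
      times.\<close>
    define t where "t j = (if j = 0 then \<kappa> else D j)" for j
    have "deg_le (W + e - rot (\<omega> ^ i) V) (t (i mod N))" if "i < m" for i
    proof -
      define j where "j = i mod N"
      have j: "j < N"
        using N by (simp add: j_def)
      have "rot (\<omega> ^ (N * k)) W = W" for k
      proof (induction k)
        case (Suc k)
        have "rot (\<omega> ^ (N * Suc k)) W = rot (\<omega> ^ N) (rot (\<omega> ^ (N * k)) W)"
          by (simp add: rot_rot[OF omega_power omega_power] power_add)
        then show ?case
          by (simp add: Suc.IH c.rot_W)
      qed simp
      then have "rot (\<omega> ^ i) W = rot (\<omega> ^ j) W"
        using rot_rot[OF omega_power omega_power, of j "N * (i div N)" W]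
        by (simp add: j_def flip: power_add)
      then have eq: "W + e - rot (\<omega> ^ i) V = (W - rot (\<omega> ^ j) W) + (e - rot (\<omega> ^ i) e0)"
        unfolding V by (simp add: rot_i.hom_add)
      have r: "deg_le (e - rot (\<omega> ^ i) e0) \<kappa>"
        using e e0 by (intro deg_le_diff) (simp_all only: deg_le_rot[OF omega_power])
      have "\<kappa> \<le> t j"
        using N(4)[of j] j by (auto simp: t_def)
      moreover have "deg_le (W - rot (\<omega> ^ j) W) (t j)"
        using sub[of j] j by (cases "j = 0") (auto simp: t_def deg_le_iff_subdegree)
      ultimately show ?thesis
        unfolding eq j_def[symmetric] by (intro deg_le_add deg_le_mono[OF r])
    qed
    then have "deg_le (\<Prod>i<m. W + e - rot (\<omega> ^ i) V) (\<Sum>i<m. t (i mod N))"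
      by (intro deg_le_prod) auto
    moreover have "poly P (W + e) = (\<Prod>i<m. W + e - rot (\<omega> ^ i) V)"
      by (simp add: P_def poly_prod)
    moreover have "(\<Sum>j<N. t j) = c.\<delta>"
    proof -
      have "{..<N} = insert 0 {0<..<N}"
        using N by auto
      then show ?thesis
        by (simp add: t_def c.\<delta>_def cD S_def)
    qed
    ultimately show ?thesis
      using sum_mod_periodic[OF N(2), of t d] by (simp add: m)
  qed
  then have "deg_le (poly A (W + e0)) c.\<delta>"
    using c.deg_le_approximate_root[OF \<open>2 \<le> d\<close> P _ A(1-3) e0] by blast
  then show ?thesis
    using A(4) deg_le_mono[of "poly A V" c.\<delta> 0] unfolding V[symmetric] c.\<delta>_def cD
    by fastforce
qed

text \<open>Put d = m / N and let d' be the gcd of d and \<open>D N\<close>, so d = n d'. Exponents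
  of \<open>V\<close> above \<open>D N\<close> are multiples of d, hence fixed by
  \<open>\<omega> ^ N\<close>; and \<open>\<omega> ^ (N * k)\<close> moves \<open>D N\<close>
  exactly when n does not divide k. Below index N n, therefore, \<open>D i\<close> depends only on i
  mod N, with value \<open>D N\<close> at the nonzero multiples of N. Summation gives the formula
  for \<open>S\<close>.\<close>

lemma chain_step:
  assumes "jump N"
  defines "n \<equiv> m div N div gcd (m div N) (nat \<bar>D N\<bar>)"
  shows "N * n dvd m" "1 < n" "S (N * n) = int n * S N + (int n - 1) * D N"
    "int (m div (N * n)) dvd S N + D N" "int (m div (N * n)) dvd D N" "N * n < m \<Longrightarrow> jump (N * n)"
proof -
  have N: "N dvd m" "0 < N" "N < m" "\<And>i. 0 < i \<Longrightarrow> i < N \<Longrightarrow> D N < D i"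
    using assms(1) by (auto simp: jump_def)
  define \<kappa> where "\<kappa> = D N"
  define d where "d = m div N"
  have m: "m = N * d"
    using N(1) by (simp add: d_def)
  have d_pos: "0 < d"
    using m m_pos by auto
  define d' where "d' = gcd d (nat \<bar>\<kappa>\<bar>)"
  have d'_pos: "0 < d'"
    using d_pos by (simp add: d'_def)
  have "d' dvd d"
    unfolding d'_def by (rule gcd_dvd1)
  have "n = d div d'"
    unfolding n_def d_def d'_def \<kappa>_def ..
  then have d: "d = n * d'"
    using \<open>d' dvd d\<close> by simp
  have n_pos: "0 < n"
    using d d_pos by auto
  have d'\<kappa>: "int d' dvd \<kappa>"
    by (metis d'_def gcd_dvd2 int_dvd_int_iff dvd_abs_iff int_nat_eq abs_ge_zero)
  have dvd_N: "int m dvd int (N * k) * l \<longleftrightarrow> int d dvd int k * l" for k l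
    using N(2) by (simp add: m mult.assoc)
  have dvd_\<kappa>: "int d dvd int k * \<kappa> \<longleftrightarrow> n dvd k" for k
  proof -
    obtain c where c: "\<kappa> = int d' * c"
      using d'\<kappa> by auto
    have "gcd (int d) \<kappa> = int d'"
      unfolding d'_def gcd_nat_abs_right_eq by simp
    then have "int d' * gcd (int n) c = int d'"
      using d c gcd_mult_distrib_int[of "int d'" "int n" c] by (simp add: mult.commute)
    then have "coprime (int n) c"
      using d'_pos by (simp add: coprime_iff_gcd_eq_1)
    have "int d dvd int k * \<kappa> \<longleftrightarrow> int d' * int n dvd int d' * (int k * c)"
      by (simp add: d c mult_ac)
    also have "\<dots> \<longleftrightarrow> int n dvd int k * c"
      using d'_pos by simp
    also have "\<dots> \<longleftrightarrow> int n dvd int k"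
      using \<open>coprime (int n) c\<close> by (simp add: coprime_dvd_mult_left_iff)
    finally show ?thesis
      by simp
  qed
  show "N * n dvd m"
    by (simp add: m d)
  have m_div: "m div (N * n) = d'"
    using N(2) n_pos by (simp add: m d)
  have "n \<noteq> 1"
    using D_not_dvd[OF N(2,3)] dvd_\<kappa>[of 1] dvd_N[of 1 \<kappa>] by (auto simp: \<kappa>_def)
  then show "1 < n"
    using n_pos by simp
  have above: "int d dvd k" if "\<kappa> < k" "V $$ (- k) \<noteq> 0" for k
    using D_dvd[OF N(2,3), of k] that dvd_N[of 1 k] by (simp add: \<kappa>_def)
  have D_mult: "D (N * k) = \<kappa>" if "\<not> n dvd k" for k
  proof (rule D_eqI)
    show "V $$ (- \<kappa>) \<noteq> 0"
      unfolding \<kappa>_def by (rule D_nth[OF N(2,3)])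
    show "\<not> int m dvd int (N * k) * \<kappa>"
      unfolding dvd_N dvd_\<kappa> by (fact that)
    show "int m dvd int (N * k) * l" if "\<kappa> < l" "V $$ (- l) \<noteq> 0" for l
      using above[OF that] by (simp only: dvd_N) simp
  qed
  have D_mod: "D i = D (i mod N)" if "\<not> N dvd i" for i
  proof (rule D_eqI)
    let ?j = "i mod N"
    have j: "0 < ?j" "?j < N" "?j < m"
      using that N by (auto simp: mod_greater_zero_iff_not_dvd order.strict_trans[of _ N])
    have iff: "int m dvd int i * l \<longleftrightarrow> int m dvd int ?j * l" if "\<kappa> < l" "V $$ (- l) \<noteq> 0" for l
    proof -
      have "int m dvd int (N * (i div N)) * l"
        using above[OF that] by (simp only: dvd_N) simp
      moreover have "int i * l = int (N * (i div N)) * l + int ?j * l"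
        by (metis distrib_right mult_div_mod_eq of_nat_add)
      ultimately show ?thesis
        by (simp add: dvd_add_right_iff)
    qed
    have \<kappa>j: "\<kappa> < D ?j"
      using N(4) j by (simp add: \<kappa>_def)
    show "V $$ (- D ?j) \<noteq> 0"
      using D_nth j by blast
    then show "\<not> int m dvd int i * D ?j"
      using D_not_dvd[of ?j] j iff[OF \<kappa>j] by simp
    show "int m dvd int i * l" if "D ?j < l" "V $$ (- l) \<noteq> 0" for l
      using D_dvd[of ?j l] that j \<kappa>j iff[of l] by simp
  qed
  define t where "t j = (if j = 0 then \<kappa> else D j)" for j
  have t: "t (i mod N) = D i" if "0 < i" "i < N * n" for i
  proof (cases "N dvd i")
    case True
    then obtain k where k: "i = N * k" ..
    then have "\<not> n dvd k"
      using that by (auto dest: dvd_imp_le)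
    then show ?thesis
      using D_mult[of k] by (simp add: k t_def)
  next
    case False
    then show ?thesis
      using D_mod[OF False] by (simp add: t_def mod_eq_0_iff_dvd)
  qed
  have "{..<N * n} = insert 0 {0<..<N * n}" "{..<N} = insert 0 {0<..<N}"
    using N n_pos by auto
  then have "(\<Sum>i<n * N. t (i mod N)) = \<kappa> + S (N * n)" "(\<Sum>j<N. t j) = \<kappa> + S N"
    using t by (simp_all add: S_def t_def[of 0] mult.commute) (simp add: t_def)
  then have "\<kappa> + S (N * n) = int n * (\<kappa> + S N)"
    using sum_mod_periodic[OF N(2), of t n] by simp
  then show "S (N * n) = int n * S N + (int n - 1) * D N"
    by (simp add: \<kappa>_def algebra_simps)
  have "int d dvd D i" if "0 < i" "i < N" for i
    using above[of "D i"] N(4)[OF that] D_nth[of i] that N by (simp add: \<kappa>_def)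
  then have "int d dvd S N"
    by (auto simp: S_def intro: dvd_sum)
  then have "int d' dvd S N"
    using \<open>d' dvd d\<close> by (metis dvd_trans int_dvd_int_iff)
  then show "int (m div (N * n)) dvd S N + D N" "int (m div (N * n)) dvd D N"
    using d'\<kappa> by (simp_all add: m_div \<kappa>_def)
  show "jump (N * n)" if "N * n < m"
  proof -
    have nth: "V $$ (- D (N * n)) \<noteq> 0" "\<not> int m dvd int (N * n) * D (N * n)"
      using D_nth[of "N * n"] D_not_dvd[of "N * n"] that N n_pos by auto
    \<comment> \<open>The exponents of \<open>V\<close> from \<kappa> upwards are multiples of d',
      so \<open>\<omega> ^ (N * n)\<close> fixes them.\<close>
    have "D (N * n) < \<kappa>"
    proof (rule ccontr)
      assume "\<not> D (N * n) < \<kappa>"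
      then have "int d' dvd D (N * n)"
        using above[of "D (N * n)"] nth d'\<kappa> \<open>d' dvd d\<close>
        by (metis dvd_trans int_dvd_int_iff linorder_neqE)
      then have "int d dvd int n * D (N * n)"
        by (simp add: d)
      then show False
        using nth(2) by (simp only: dvd_N) simp
    qed
    moreover have "\<kappa> \<le> D i" if i: "0 < i" "i < N * n" for i
      using t[OF i] N(4)[of "i mod N"] N(2) by (auto simp: t_def \<kappa>_def split: if_splits)
    ultimately have "D (N * n) < D i" if "0 < i" "i < N * n" for i
      using that less_le_trans by blast
    then show ?thesis
      using that \<open>N * n dvd m\<close> N n_pos by (simp add: jump_def)
  qed
qed

text \<open>The excess vanishes at the first jump \<open>1\<close> and at the end \<open>m\<close> of the chain and never decreases,
  hence it is constant; the first step then gives \<open>D 1 = gcd m (D 1)\<close>.\<close>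

definition excess :: "nat \<Rightarrow> int" where
  "excess N = S N - (int m - int (m div N))"

text \<open>\<open>S N + D N\<close> is positive and divisible by d' = m / (N n), hence at least d'.
  So \<open>S\<close> grows by at least (n - 1) d', which is exactly m / N - m / (N n).\<close>

lemma excess_step:
  assumes "jump N"
  defines "n \<equiv> m div N div gcd (m div N) (nat \<bar>D N\<bar>)"
  shows "excess N \<le> excess (N * n)"
proof -
  note c = chain_step[OF assms(1), folded n_def]
  have N: "0 < N" "N dvd m"
    using assms by (auto simp: jump_def)
  let ?d' = "m div (N * n)"
  have "int ?d' \<le> S N + D N"
    using c(4) jump_step[OF assms(1)] by (rule zdvd_imp_le)
  then have "(int n - 1) * int ?d' \<le> (int n - 1) * (S N + D N)"
    using c(2) by (intro mult_left_mono) auto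
  moreover have "n * ?d' = m div N"
    using c(1) N c(2) by (metis dvd_div_mult_self div_mult2_eq dvd_mult_imp_div mult.commute)
  then have "int n * int ?d' = int (m div N)"
    by (metis of_nat_mult)
  ultimately show ?thesis
    using c(3) by (simp add: excess_def algebra_simps)
qed

lemma excess_m: "excess m = 0"
  using different m_pos by (simp add: excess_def S_def D_def)

lemma excess_nonpos: "jump N \<or> N = m \<Longrightarrow> excess N \<le> 0"
proof (induction "m - N" arbitrary: N rule: less_induct)
  case less
  show ?case
  proof (cases "N = m")
    case False
    then have N: "jump N"
      using less.prems by blast
    define n where "n = m div N div gcd (m div N) (nat \<bar>D N\<bar>)"
    note c = chain_step[OF N, folded n_def]
    have "0 < N" "N < m"
      using N by (auto simp: jump_def)
    then have "N < N * n"
      using c(2) by simp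
    moreover have "N * n \<le> m"
      using c(1) m_pos by (simp add: dvd_imp_le)
    ultimately have "excess (N * n) \<le> 0"
      using less.hyps[of "N * n"] c(6) \<open>N < m\<close> by linarith
    then show ?thesis
      using excess_step[OF N] by (simp add: n_def)
  qed (simp add: excess_m)
qed

theorem degree_divides:
  assumes "\<not> int m dvd k" "V $$ (- k) \<noteq> 0" "deg_le V k"
  shows "k dvd int m"
proof -
  have "m \<noteq> 1"
    using assms(1) by auto
  then have "1 < m"
    using m_pos by simp
  \<comment> \<open>The leading exponent k is not a multiple of m, so \<omega> itself moves
    it.\<close>
  have D1: "D 1 = k"
    using assms by (intro D_eqI) (auto simp: deg_le_def)
  have j: "jump 1"
    using \<open>1 < m\<close> by (simp add: jump_def)
  have S1: "S 1 = 0"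
  proof -
    have "{0<..<1::nat} = {}"
      by auto
    then show ?thesis
      by (simp only: S_def sum.empty)
  qed
  have k: "0 < k"
    using jump_step[OF j] by (simp only: S1 D1)
  define n where "n = m div 1 div gcd (m div 1) (nat \<bar>D 1\<bar>)"
  note c = chain_step[OF j, folded n_def]
  define d' where "d' = m div n"
  have "excess n \<le> 0"
    using c(1,6) m_pos by (intro excess_nonpos) (auto dest!: dvd_imp_le simp: le_less)
  then have "S n \<le> int m - int d'"
    by (simp add: excess_def d'_def)
  moreover have "S n = (int n - 1) * k"
    using c(3) by (simp only: S1 D1 mult_1 mult_zero_right add_0)
  moreover have m: "m = n * d'"
    using c(1) by (simp add: d'_def)
  then have "int m = int n * int d'"
    by (metis of_nat_mult)
  ultimately have "(int n - 1) * k \<le> (int n - 1) * int d'"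
    by (simp add: left_diff_distrib)
  then have "k \<le> int d'"
    using c(2) by (simp add: mult_le_cancel_left)
  moreover have "int d' dvd k"
    using c(5) by (simp only: D1 d'_def mult_1)
  ultimately have "k = int d'"
    using k by (meson zdvd_imp_le order_antisym)
  then show ?thesis
    by (simp add: m)
qed

end

section \<open>Resultants and the place at infinity\<close>

lemma monic_division:
  fixes h p :: "'a::idom poly"
  assumes "lead_coeff h = 1"
  obtains q r where "p = h * q + r" "r = 0 \<or> degree r < degree h"
proof -
  obtain q r where qr: "pseudo_divmod p h = (q, r)"
    by force
  have "h \<noteq> 0"
    using assms by auto
  then show ?thesis
    using pseudo_divmod[OF _ qr] assms that by simp
qed

text \<open>The determinant of multiplication by \<open>f\<close> modulo a monic \<open>h\<close> serves as the resultant of \<open>h\<close> and \<open>f\<close>.\<close>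

lemma multiplication_matrix:
  fixes h f :: "'a::idom poly"
  assumes "lead_coeff h = 1"
  obtains M q where "M \<in> carrier_mat (degree h) (degree h)"
    "\<And>i. i < degree h \<Longrightarrow> monom 1 i * f = (\<Sum>j<degree h. monom (index_mat M (i, j)) j) + h * q i"
proof -
  have "\<exists>q r. monom 1 i * f = h * q + r \<and> (r = 0 \<or> degree r < degree h)" for i
    using monic_division[OF assms] by metis
  then obtain q r where qr: "\<And>i. monom 1 i * f = h * q i + r i" "\<And>i. r i = 0 \<or> degree (r i) < degree h"
    by metis
  define M where "M = Matrix.mat (degree h) (degree h) (\<lambda>(i, j). coeff (r i) j)"
  have "r i = (\<Sum>j<degree h. monom (index_mat M (i, j)) j)" if "i < degree h" for i
  proof -
    have "r i = (\<Sum>j<degree h. monom (coeff (r i) j) j)"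
      using qr(2)[of i] by (intro poly_eqI) (auto simp: coeff_sum coeff_eq_0 sum.delta)
    then show ?thesis
      using that by (simp add: M_def)
  qed
  then show ?thesis
    using qr(1) by (intro that[of M q]) (auto simp: M_def)
qed

text \<open>At a root \<open>a\<close> of \<open>h\<close> the multiples of \<open>h\<close> vanish,
  so the powers of \<open>a\<close> form an eigenvector with eigenvalue \<open>f\<close> at
  \<open>a\<close>. The homomorphism \<phi> allows the coefficients to be specialised first.\<close>

lemma multiplication_matrix_root:
  fixes h f :: "'a::idom poly" and \<phi> :: "'a \<Rightarrow> 'b::idom"
  assumes hom: "comm_ring_hom \<phi>"
    and M: "monom 1 i * f = (\<Sum>j<n. monom (c j) j) + h * q"
    and root: "poly (map_poly \<phi> h) a = 0"
  shows "(\<Sum>j<n. \<phi> (c j) * a ^ j) = poly (map_poly \<phi> f) a * a ^ i"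
proof -
  interpret comm_ring_hom \<phi>
    by fact
  interpret mp: map_poly_comm_ring_hom \<phi> ..
  have "poly (map_poly \<phi> (monom 1 i * f)) a = poly (map_poly \<phi> ((\<Sum>j<n. monom (c j) j) + h * q)) a"
    by (simp only: M)
  then show ?thesis
    by (simp add: mp.hom_mult mp.hom_add mp.hom_sum poly_sum poly_monom root mult.commute)
qed

lemma vanishing_polynomial:
  fixes v :: "nat \<Rightarrow> 'a::idom"
  assumes "inj_on a {..<n}" "\<And>k. k < n \<Longrightarrow> (\<Sum>j<n. v j * a k ^ j) = 0" "j < n"
  shows "v j = 0"
proof -
  define p where "p = (\<Sum>j<n. monom (v j) j)"
  have "degree p < n"
    unfolding p_def using assms(3) by (intro degree_sum_less) (auto intro: le_less_trans[OF degree_monom_le])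
  have "p = 0"
  proof (rule ccontr)
    assume nz: "p \<noteq> 0"
    have "a ` {..<n} \<subseteq> {x. poly p x = 0}"
      using assms(2) by (auto simp: p_def poly_sum poly_monom)
    then have "card (a ` {..<n}) \<le> card {x. poly p x = 0}"
      by (rule card_mono[OF poly_roots_finite[OF nz]])
    then have "n \<le> card {x. poly p x = 0}"
      by (simp add: card_image[OF assms(1)])
    then show False
      using card_poly_roots_bound[OF nz] \<open>degree p < n\<close> by simp
  qed
  moreover have "coeff p j = v j"
    using assms(3) by (simp add: p_def coeff_sum sum.delta)
  ultimately show ?thesis
    by simp
qed

text \<open>The eigenvectors form a Vandermonde matrix \<open>X\<close>, invertible since the nodes
  are distinct, and \<open>M * X\<close> equals \<open>X\<close> times the diagonal matrix of the
  \<open>b k\<close>.\<close>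

lemma det_eq_prod_eigenvalues:
  fixes M :: "'a::field mat"
  assumes M: "M \<in> carrier_mat n n" and inj: "inj_on a {..<n}"
    and eigen: "\<And>i k. i < n \<Longrightarrow> k < n \<Longrightarrow> (\<Sum>j<n. index_mat M (i, j) * a k ^ j) = b k * a k ^ i"
  shows "det M = (\<Prod>k<n. b k)"
proof -
  define X where "X = Matrix.mat n n (\<lambda>(j, k). a k ^ j)"
  have X: "X \<in> carrier_mat n n"
    by (simp add: X_def)
  have "M * X = X * mat_diag n b"
  proof (rule eq_matI)
    fix i k
    assume "i < dim_row (X * mat_diag n b)" "k < dim_col (X * mat_diag n b)"
    then have ik: "i < n" "k < n"
      using X by (auto simp: mat_diag_def)
    show "index_mat (M * X) (i, k) = index_mat (X * mat_diag n b) (i, k)"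
      using eigen[OF ik] ik M X
      by (subst mat_diag_mult_right[OF X])
        (simp add: X_def scalar_prod_def mult.commute flip: lessThan_atLeast0)
  qed (use M X in \<open>auto simp: mat_diag_def\<close>)
  then have "det M * det X = det X * det (mat_diag n b)"
    by (metis M X det_mult mat_diag_dim)
  moreover have "det (mat_diag n b) = (\<Prod>k<n. b k)"
  proof -
    have "det (mat_diag n b) = prod_list (diag_mat (mat_diag n b))"
      by (rule det_upper_triangular[of _ n]) (auto simp: mat_diag_def)
    also have "diag_mat (mat_diag n b) = map b [0..<n]"
      by (auto simp: diag_mat_def mat_diag_def)
    finally show ?thesis
      by (simp add: prod.list_conv_set_nth lessThan_atLeast0)
  qed
  moreover have "det X \<noteq> 0"
  proof
    assume "det X = 0"
    then have "det (transpose_mat X) = 0"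
      using det_transpose[OF X] by simp
    then obtain v where v: "v \<in> carrier_vec n" "v \<noteq> 0\<^sub>v n" "transpose_mat X *\<^sub>v v = 0\<^sub>v n"
      using det_0_iff_vec_prod_zero[of "transpose_mat X" n] X by auto
    have "(\<Sum>j<n. vec_index v j * a k ^ j) = 0" if "k < n" for k
    proof -
      have "vec_index (transpose_mat X *\<^sub>v v) k = 0"
        using that v(3) by simp
      then show ?thesis
        using that v(1) by (simp add: X_def scalar_prod_def mult.commute flip: lessThan_atLeast0)
    qed
    then have "vec_index v j = 0" if "j < n" for j
      using vanishing_polynomial[OF inj] that by blast
    then have "v = 0\<^sub>v n"
      using v(1) by (intro eq_vecI) auto
    then show False
      using v(2) by simp
  qed
  ultimately show ?thesis
    by simp
qed

text \<open>Over C the linear factors of \<open>h\<close> can be cancelled one by one: a root of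
  \<open>h\<close> is not a root of \<open>f\<close>, hence is a root of \<open>p\<close>.\<close>

lemma dvd_if_no_common_root:
  fixes h f p :: "complex poly"
  assumes "h \<noteq> 0" "h dvd p * f" "\<nexists>z. poly h z = 0 \<and> poly f z = 0"
  shows "h dvd p"
  using assms
proof (induction "degree h" arbitrary: h p)
  case 0
  then show ?case
    by (metis dvd_trans is_unit_iff_degree one_dvd)
next
  case (Suc n)
  obtain z where z: "poly h z = 0"
    using fundamental_theorem_of_algebra[of h] constant_degree[of h] Suc.hyps(2) by auto
  then obtain h' where h': "h = [:- z, 1:] * h'"
    by (meson poly_eq_0_iff_dvd dvdE)
  obtain k where "p * f = h * k"
    using Suc.prems(2) ..
  then have "poly (p * f) z = poly (h * k) z"
    by (simp only:)
  then have "poly p z = 0"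
    using z Suc.prems(3) by auto
  then obtain p' where p': "p = [:- z, 1:] * p'"
    by (meson poly_eq_0_iff_dvd dvdE)
  have "h' \<noteq> 0"
    using Suc.prems(1) h' by auto
  moreover have "[:- z, 1:] * h' dvd [:- z, 1:] * (p' * f)"
    using Suc.prems(2) unfolding h' p' by (simp only: mult.assoc)
  then have "h' dvd p' * f"
    by (subst (asm) dvd_times_left_cancel_iff) auto
  moreover have "degree h = Suc (degree h')"
    unfolding h' using \<open>h' \<noteq> 0\<close> by (subst degree_mult_eq) auto
  then have "n = degree h'"
    using Suc.hyps(2) by simp
  moreover have "\<nexists>z. poly h' z = 0 \<and> poly f z = 0"
    using Suc.prems(3) by (auto simp: h')
  ultimately have "h' dvd p'"
    using Suc.hyps(1) by blast
  then show ?case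
    unfolding h' p' by (rule mult_dvd_mono[OF dvd_refl])
qed

text \<open>A kernel vector of the transpose is a nonzero \<open>p\<close> of degree below
  \<open>degree h\<close> with \<open>h dvd p * f\<close>. Without a common root \<open>h\<close>
  would divide \<open>p\<close> itself.\<close>

lemma common_root_if_det_0:
  fixes h f :: "complex poly"
  assumes M: "M \<in> carrier_mat (degree h) (degree h)"
    "\<And>i. i < degree h \<Longrightarrow> monom 1 i * f = (\<Sum>j<degree h. monom (index_mat M (i, j)) j) + h * q i"
    and "det M = 0" and h: "h \<noteq> 0"
  shows "\<exists>z. poly h z = 0 \<and> poly f z = 0"
proof -
  let ?n = "degree h"
  have "det (transpose_mat M) = 0"
    using det_transpose[OF M(1)] assms(3) by simp
  then obtain v where v: "v \<in> carrier_vec ?n" "v \<noteq> 0\<^sub>v ?n" "transpose_mat M *\<^sub>v v = 0\<^sub>v ?n"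
    using det_0_iff_vec_prod_zero[of "transpose_mat M" ?n] M(1) by auto
  have vM: "(\<Sum>i<?n. vec_index v i * index_mat M (i, j)) = 0" if "j < ?n" for j
  proof -
    have "vec_index (transpose_mat M *\<^sub>v v) j = 0"
      using that v(3) by simp
    then show ?thesis
      using that v(1) M(1) by (simp add: scalar_prod_def mult.commute flip: lessThan_atLeast0)
  qed
  define p where "p = (\<Sum>i<?n. monom (vec_index v i) i)"
  have "p * f = (\<Sum>i<?n. smult (vec_index v i) (monom 1 i * f))"
    by (simp add: p_def sum_distrib_right smult_monom flip: mult_smult_left)
  also have "\<dots> = (\<Sum>i<?n. smult (vec_index v i) ((\<Sum>j<?n. monom (index_mat M (i, j)) j) + h * q i))"
    using M(2) by (intro sum.cong) auto
  also have "\<dots> = (\<Sum>i<?n. \<Sum>j<?n. monom (vec_index v i * index_mat M (i, j)) j) + h * (\<Sum>i<?n. smult (vec_index v i) (q i))"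
    by (simp add: smult_add_right sum.distrib smult_sum2 smult_monom sum_distrib_left)
  also have "(\<Sum>i<?n. \<Sum>j<?n. monom (vec_index v i * index_mat M (i, j)) j) = 0"
    by (subst sum.swap) (simp add: vM flip: monom_sum)
  finally have "h dvd p * f"
    by simp
  have "p \<noteq> 0"
  proof
    assume "p = 0"
    have "vec_index v i = 0" if "i < ?n" for i
      using arg_cong[OF \<open>p = 0\<close>, of "\<lambda>p. coeff p i"] that by (simp add: p_def coeff_sum sum.delta)
    then have "v = 0\<^sub>v ?n"
      using v(1) by (intro eq_vecI) auto
    then show False
      using v(2) by simp
  qed
  moreover have "degree p < ?n"
  proof -
    have "?n \<noteq> 0"
      using \<open>p \<noteq> 0\<close> by (auto simp: p_def)
    then show ?thesis
      unfolding p_def by (intro degree_sum_less) (auto intro: le_less_trans[OF degree_monom_le])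
  qed
  ultimately have "\<not> h dvd p"
    using dvd_imp_degree_le[of h p] by auto
  then show ?thesis
    using dvd_if_no_common_root[OF h] \<open>h dvd p * f\<close> by blast
qed

text \<open>The coefficients of \<open>A\<close> are found from the top downwards: adding
  \<open>monom c e\<close> changes the coefficient of \<open>A ^ d\<close> at (d - 1) N + e by d c
  and none above it. Only d has to be a unit, so this applies over C[u].\<close>

lemma exists_approximate_root_idom:
  fixes P :: "'a::idom poly"
  assumes "2 \<le> d" "0 < N" and P: "degree P = d * N" "lead_coeff P = 1" and r: "of_nat d * r = (1 :: 'a)"
  shows "\<exists>A. degree A = N \<and> lead_coeff A = 1 \<and> degree (P - A ^ d) < (d - 1) * N"
proof -
  obtain d' where d: "d = Suc (Suc d')"
    using \<open>2 \<le> d\<close> by (metis add_2_eq_Suc le_Suc_ex)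
  have "\<exists>A. degree A = N \<and> lead_coeff A = 1 \<and> (\<forall>j\<ge>d * N - k. coeff (P - A ^ d) j = 0)" if "k \<le> N" for k
    using that
  proof (induction k)
    case 0
    have A: "degree (monom (1::'a) N ^ d) = d * N" "lead_coeff (monom (1::'a) N ^ d) = 1"
      by (simp_all add: monom_power degree_monom_eq mult.commute)
    have "coeff (P - monom 1 N ^ d) j = 0" if "d * N \<le> j" for j
    proof (cases "j = d * N")
      case True
      then show ?thesis
        using A P by simp
    next
      case False
      then have "degree P < j" "degree (monom (1::'a) N ^ d) < j"
        using that A P by simp_all
      then show ?thesis
        by (simp only: coeff_diff coeff_eq_0 diff_self)
    qed
    then show ?case
      by (intro exI[of _ "monom 1 N"]) (simp add: degree_monom_eq)
  next
    case (Suc k)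
    then obtain A where A: "degree A = N" "lead_coeff A = 1" "\<forall>j\<ge>d * N - k. coeff (P - A ^ d) j = 0"
      by auto
    define e where "e = N - Suc k"
    have e: "e < N" "d * N - Suc k = (d - 1) * N + e" "d * N - k = Suc ((d - 1) * N + e)"
      using Suc.prems by (auto simp: e_def d)
    define c where "c = r * coeff (P - A ^ d) ((d - 1) * N + e)"
    define h where "h = monom c e"
    have h: "degree h \<le> e" "degree h < N"
      using e(1) degree_monom_le[of c e] by (simp_all add: h_def)
    define Z where "Z = (A + h) ^ d - A ^ d - of_nat d * h * A ^ (d - 1)"
    have "degree Z \<le> (d - 2) * N + 2 * degree h"
      unfolding Z_def using A(1) h(2) \<open>2 \<le> d\<close> by (rule degree_binomial_remainder)
    also have "\<dots> < (d - 1) * N + e"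
      using h e(1) by (simp add: d)
    finally have Z: "coeff Z j = 0" if "(d - 1) * N + e \<le> j" for j
      using that by (intro coeff_eq_0) simp
    have "A \<noteq> 0"
      using A(2) by auto
    then have Ad: "degree (A ^ (d - 1)) = (d - 1) * N" "lead_coeff (A ^ (d - 1)) = 1"
      using A(1,2) by (simp add: degree_power_eq, simp only: lead_coeff_power power_one)
    have hA: "coeff (of_nat d * h * A ^ (d - 1)) j = of_nat d * c * (if j < e then 0 else coeff (A ^ (d - 1)) (j - e))" for j
    proof -
      have "of_nat d * h * A ^ (d - 1) = smult (of_nat d) (monom c e * A ^ (d - 1))"
        by (simp add: h_def of_nat_poly)
      then show ?thesis
        by (simp only: coeff_smult coeff_monom_mult) simp
    qed
    have "coeff (P - (A + h) ^ d) j = 0" if j: "d * N - Suc k \<le> j" for j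
    proof -
      have "P - (A + h) ^ d = (P - A ^ d) - of_nat d * h * A ^ (d - 1) - Z"
        by (simp add: Z_def)
      then have "coeff (P - (A + h) ^ d) j = coeff (P - A ^ d) j - coeff (of_nat d * h * A ^ (d - 1)) j"
        using Z[of j] j e(2) by (simp only: coeff_diff) simp
      also have "\<dots> = 0"
      proof (cases "j = (d - 1) * N + e")
        case True
        then have "coeff (A ^ (d - 1)) (j - e) = 1"
          using Ad by simp
        then show ?thesis
          using True r by (simp only: hA c_def) (simp add: mult.assoc[symmetric])
      next
        case False
        then have lt: "(d - 1) * N + e < j"
          using j e(2) by linarith
        then have "coeff (P - A ^ d) j = 0"
          using A(3) e(3) by simp
        moreover have "coeff (A ^ (d - 1)) (j - e) = 0"
          using lt Ad(1) by (intro coeff_eq_0) simp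
        ultimately show ?thesis
          by (simp only: hA) simp
      qed
      finally show ?thesis .
    qed
    moreover have "degree (A + h) = N" "lead_coeff (A + h) = 1"
      using A h by (simp_all add: degree_add_eq_left coeff_eq_0)
    ultimately show ?case
      by blast
  qed
  from this[of N] obtain A where A: "degree A = N" "lead_coeff A = 1" "\<forall>j\<ge>(d - 1) * N. coeff (P - A ^ d) j = 0"
    by (auto simp: d)
  have "degree (P - A ^ d) < (d - 1) * N"
  proof (rule ccontr)
    assume *: "\<not> ?thesis"
    then have "lead_coeff (P - A ^ d) = 0"
      using A(3) by auto
    then have "P - A ^ d = 0"
      by (simp only: leading_coeff_0_iff)
    then show False
      using * \<open>0 < N\<close> by (simp add: d del: right_minus_eq)
  qed
  then show ?thesis
    using A by blast
qed

section \<open>The parameter of the line as a series at infinity\<close>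

lemma fps_compose_of_poly:
  fixes p :: "'a::idom poly"
  assumes "fps_nth z 0 = 0"
  shows "fps_compose (fps_of_poly p) z = poly (map_poly fps_const p) z"
proof (induction p)
  case (pCons c p)
  have "fps_compose (fps_of_poly (pCons c p)) z = fps_const c + z * fps_compose (fps_of_poly p) z"
    using assms by (simp add: fps_of_poly_pCons fps_compose_add_distrib fps_compose_mult_distrib)
  also have "\<dots> = poly (map_poly fps_const (pCons c p)) z"
    using pCons.hyps by (simp add: pCons.IH map_poly_pCons)
  finally show ?case .
qed simp

lemma fps_to_fls_poly:
  fixes p :: "'a::idom poly"
  shows "fps_to_fls (poly (map_poly fps_const p) z) = poly (map_poly fls_const p) (fps_to_fls z)"
  by (induction p) (simp_all add: map_poly_pCons fls_times_fps_to_fls)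

lemma fls_const_hom: "inj_idom_hom (fls_const :: 'a::field \<Rightarrow> 'a fls)"
  by unfold_locales (simp_all add: fls_plus_const)

definition eval_at :: "'a::field fls \<Rightarrow> 'a poly \<Rightarrow> 'a fls" where
  "eval_at T f = poly (map_poly fls_const f) T"

lemma eval_at_hom: "comm_ring_hom (eval_at T)"
proof -
  interpret c: inj_idom_hom "fls_const :: 'a \<Rightarrow> 'a fls"
    by (rule fls_const_hom)
  interpret p: map_poly_inj_idom_hom "fls_const :: 'a \<Rightarrow> 'a fls" ..
  show ?thesis
    unfolding eval_at_def by unfold_locales (simp_all add: p.hom_add p.hom_mult)
qed

lemma eval_at_0 [simp]: "eval_at T 0 = 0"
  by (simp add: eval_at_def)

lemma eval_at_pCons: "eval_at T (pCons c p) = fls_const c + T * eval_at T p"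
  by (cases "c = 0 \<and> p = 0") (auto simp: eval_at_def map_poly_pCons)

lemma eval_at_const [simp]: "eval_at T [:c:] = fls_const c"
  by (simp add: eval_at_pCons)

lemma eval_at_X [simp]: "eval_at T [:0, 1:] = T"
  by (simp add: eval_at_pCons)

text \<open>Writing \<open>T = 1 / z\<close>, the equation \<open>u(T) = \<tau>\<^sup>m\<close> becomes \<open>z / \<rho>(z)\<^bsup>1/m\<^esup> = X\<close> with the reflected
  polynomial \<open>\<rho>\<close>, and is solved by inverting a power series.\<close>

lemma exists_root_at_infinity:
  fixes u :: "'a::field_char_0 poly"
  assumes "lead_coeff u = 1" "0 < degree u"
  obtains T where "eval_at T u = fls_X_inv ^ degree u" "fls_subdegree T = - 1"
proof -
  define m where "m = degree u"
  obtain m' where m': "m = Suc m'"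
    using assms(2) by (auto simp: m_def gr0_conv_Suc)
  define \<rho> where "\<rho> = fps_of_poly (reflect_poly u)"
  have \<rho>0: "fps_nth \<rho> 0 = 1"
    using assms(1) by (simp add: \<rho>_def coeff_0_reflect_poly)
  \<comment> \<open>The constant term of \<rho> is the leading coefficient 1 of \<open>u\<close>, so
    1 is a valid choice of its m-th root.\<close>
  define \<rho>' where "\<rho>' = fps_radical (\<lambda>_ _. 1) m \<rho>"
  have \<rho>'_power: "\<rho>' ^ m = \<rho>"
    unfolding \<rho>'_def m' using power_radical[of \<rho> "\<lambda>_ _. 1" m'] \<rho>0 by simp
  have \<rho>'0: "fps_nth \<rho>' 0 = 1"
    by (simp add: \<rho>'_def m')
  define f where "f = fps_X * inverse \<rho>'"
  have f: "fps_nth f 0 = 0" "fps_nth f 1 \<noteq> 0"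
    using \<rho>'0 by (simp_all add: f_def)
  define z where "z = fps_inv f"
  have z0: "fps_nth z 0 = 0"
    by (simp add: z_def fps_inv_def)
  have "fps_compose f z = fps_X"
    unfolding z_def using f by (rule fps_inv_right)
  then have "z * fps_compose (inverse \<rho>') z = fps_X"
    using z0 by (simp add: f_def fps_compose_mult_distrib)
  then have "z * (fps_compose (inverse \<rho>') z * fps_compose \<rho>' z) = fps_X * fps_compose \<rho>' z"
    by (simp only: mult.assoc[symmetric])
  moreover have "fps_compose (inverse \<rho>') z * fps_compose \<rho>' z = 1"
    using z0 \<rho>'0 by (simp add: fps_compose_mult_distrib[symmetric] inverse_mult_eq_1)
  ultimately have z: "z = fps_X * fps_compose \<rho>' z"
    by simp
  then have "z ^ m = fps_X ^ m * fps_compose \<rho>' z ^ m"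
    by (metis power_mult_distrib)
  also have "fps_compose \<rho>' z ^ m = fps_compose (\<rho>' ^ m) z"
    by (induction m) (simp_all add: fps_compose_mult_distrib[OF z0])
  also have "\<dots> = poly (map_poly fps_const (reflect_poly u)) z"
    using z0 by (simp only: \<rho>'_power) (simp only: \<rho>_def fps_compose_of_poly)
  finally have zm: "fps_to_fls z ^ m = fls_X ^ m * poly (map_poly fls_const (reflect_poly u)) (fps_to_fls z)"
    by (metis fps_to_fls_poly fls_times_fps_to_fls fps_to_fls_power fps_X_to_fls)
  define y where "y = fps_to_fls z"
  have "fps_nth (fps_compose \<rho>' z) 0 = 1"
    using \<rho>'0 by simp
  then have "subdegree z = 1"
    by (subst z, intro subdegreeI) simp_all
  then have ysub: "fls_subdegree y = 1"
    by (simp add: y_def fls_subdegree_fls_to_fps)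
  then have y0: "y \<noteq> 0"
    by auto
  have refl: "map_poly fls_const (reflect_poly u) = reflect_poly (map_poly fls_const u)"
  proof -
    interpret c: inj_idom_hom "fls_const :: 'a \<Rightarrow> 'a fls"
      by (rule fls_const_hom)
    show ?thesis
      by (rule poly_eqI) (simp add: coeff_reflect_poly c.degree_map_poly_hom)
  qed
  have dm: "degree (map_poly fls_const u) = m"
    unfolding m_def by (intro degree_map_poly) simp
  have "poly (map_poly fls_const (reflect_poly u)) y = y ^ m * eval_at (inverse y) u"
    unfolding refl poly_reflect_poly_nz[OF y0] dm eval_at_def ..
  then have "y ^ m = fls_X ^ m * (y ^ m * eval_at (inverse y) u)"
    using zm by (simp add: y_def)
  then have "fls_X ^ m * eval_at (inverse y) u = 1"
    using y0 by (simp add: mult.left_commute)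
  then have "eval_at (inverse y) u = inverse (fls_X ^ m)"
    by (simp add: inverse_unique)
  also have "\<dots> = fls_X_inv ^ m"
    by (simp add: fls_inverse_X power_inverse[symmetric])
  finally show ?thesis
    using that[of "inverse y"] ysub by (simp add: m_def)
qed

text \<open>\<open>T\<close> has a simple pole, so degrees in t are degrees in \<tau>. In particular
  a polynomial whose value at \<open>T\<close> has degree at most 0 is constant.\<close>

lemma eval_at_subdegree:
  assumes T: "fls_subdegree T = - 1" and f: "f \<noteq> 0"
  shows "eval_at T f \<noteq> 0 \<and> fls_subdegree (eval_at T f) = - int (degree f)"
  using f
proof (induction f)
  case (pCons c f)
  have "T \<noteq> 0"
    using T by auto
  show ?case
  proof (cases "f = 0")
    case True
    then show ?thesis
      using pCons.hyps by (simp add: eval_at_pCons)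
  next
    case False
    then have f: "eval_at T f \<noteq> 0" "fls_subdegree (eval_at T f) = - int (degree f)"
      using pCons.IH by auto
    then have "T * eval_at T f \<noteq> 0" "fls_subdegree (T * eval_at T f) = - int (Suc (degree f))"
      using \<open>T \<noteq> 0\<close> T by simp_all
    moreover from this have "fls_subdegree (T * eval_at T f + fls_const c) = fls_subdegree (T * eval_at T f)"
      by (intro fls_subdegree_add_eq1) auto
    ultimately show ?thesis
      using False by (auto simp: eval_at_pCons add.commute)
  qed
qed simp

lemma eval_at_rot:
  assumes "c \<noteq> 0"
  shows "rot c (eval_at T f) = eval_at (rot c T) f"
proof -
  interpret r: field_hom "rot c"
    using assms by (rule rot_field_hom)
  have "rot c (fls_const a) = fls_const a" for a
    by (rule fls_eqI) (simp add: nth_rot[OF assms])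
  then show ?thesis
    by (induction f) (simp_all add: eval_at_pCons r.hom_add r.hom_mult)
qed

lemma eval_at_pcompose: "eval_at T (pcompose f g) = eval_at (eval_at T g) f"
proof -
  interpret e: comm_ring_hom "eval_at T"
    by (rule eval_at_hom)
  show ?thesis
    by (induction f) (simp_all add: pcompose_pCons e.hom_add e.hom_mult eval_at_pCons)
qed

section \<open>Embedded lines\<close>

lemma primitive_root_of_unity:
  assumes "0 < m"
  shows "cis (2 * pi / real m) powi k = 1 \<longleftrightarrow> int m dvd k"
proof -
  have "cis (2 * pi / real m) powi k = 1 \<longleftrightarrow> (\<exists>n. of_int k * (2 * pi / real m) = of_int n * (2 * pi))"
    by (simp only: cis_power_int cis_eq_1_iff)
  also have "\<dots> \<longleftrightarrow> (\<exists>n. real_of_int k = real_of_int (int m * n))"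
    using assms by (simp add: field_simps)
  also have "\<dots> \<longleftrightarrow> int m dvd k"
    by (simp only: of_int_eq_iff dvd_def)
  finally show ?thesis .
qed

text \<open>With s as inner and t as outer variable this reads u(t) - u(s) = (t - s) H(s,
  t).\<close>

lemma difference_quotient:
  fixes u :: "'a::idom poly"
  obtains H where "map_poly (\<lambda>c. [:c:]) u - [:u:] = [:- [:0, 1:], 1:] * H"
proof -
  have "poly (map_poly (\<lambda>c. [:c:]) u) [:0, 1:] = u"
    by (induction u) (simp_all add: map_poly_pCons)
  then have "poly (map_poly (\<lambda>c. [:c:]) u - [:u:]) [:0, 1:] = 0"
    by simp
  then show ?thesis
    using that by (metis poly_eq_0_iff_dvd dvdE)
qed

lemma monic_diff_const:
  fixes u :: "'a::comm_ring_1 poly"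
  assumes "lead_coeff u = 1" "0 < degree u"
  shows "degree (map_poly (\<lambda>c. [:c:]) u - [:a:]) = degree u"
    "lead_coeff (map_poly (\<lambda>c. [:c:]) u - [:a:]) = 1"
proof -
  let ?U = "map_poly (\<lambda>c. [:c:]) u"
  have U: "degree ?U = degree u"
    by (intro degree_map_poly) simp
  have "degree (?U + - [:a:]) = degree ?U"
    using assms(2) U by (intro degree_add_eq_left) simp
  then show d: "degree (?U - [:a:]) = degree u"
    by (simp only: diff_conv_add_uminus U)
  have "coeff [:a:] (degree u) = 0"
    using assms(2) by (cases "degree u") simp_all
  then show "lead_coeff (?U - [:a:]) = 1"
    unfolding d using assms(1) by (simp add: coeff_map_poly)
qed

lemma difference_quotient_monic:
  fixes u :: "'a::idom poly"
  assumes H: "map_poly (\<lambda>c. [:c:]) u - [:u:] = [:- [:0, 1:], 1:] * H"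
    and "lead_coeff u = 1" "0 < degree u"
  shows "degree H = degree u - 1" "lead_coeff H = 1"
proof -
  note U = monic_diff_const[OF assms(2,3), of u]
  have "H \<noteq> 0"
    using U(2) unfolding H by auto
  then show "degree H = degree u - 1"
    using U(1) unfolding H by (subst (asm) degree_mult_eq) auto
  show "lead_coeff H = 1"
    using U(2) unfolding H lead_coeff_mult by simp
qed

lemma difference_quotient_hom:
  fixes u :: "'a::idom poly" and \<phi> :: "'a poly \<Rightarrow> 'b::idom"
  assumes hom: "comm_ring_hom \<phi>" and H: "map_poly (\<lambda>c. [:c:]) u - [:u:] = [:- [:0, 1:], 1:] * H"
  shows "map_poly (\<lambda>c. \<phi> [:c:]) u - [:\<phi> u:] = [:- \<phi> [:0, 1:], 1:] * map_poly \<phi> H"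
proof -
  interpret comm_ring_hom \<phi>
    by fact
  interpret mp: map_poly_comm_ring_hom \<phi> ..
  have "map_poly \<phi> (map_poly (\<lambda>c. [:c:]) u - [:u:]) = map_poly \<phi> ([:- [:0, 1:], 1:] * H)"
    by (simp only: H)
  moreover have "map_poly \<phi> (map_poly (\<lambda>c. [:c:]) u) = map_poly (\<lambda>c. \<phi> [:c:]) u"
    by (simp add: map_poly_map_poly comp_def)
  moreover have "map_poly \<phi> [:- [:0, 1:], 1:] = [:- \<phi> [:0, 1:], 1:]"
    using hom_uminus[of "[:0, 1:]"] by (simp add: map_poly_pCons)
  moreover have "map_poly \<phi> [:u:] = [:\<phi> u:]"
    by (cases "u = 0") (simp_all add: map_poly_pCons)
  ultimately show ?thesis
    by (simp only: mp.hom_mult mp.hom_minus)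
qed

lemma pderiv_difference_quotient:
  fixes u :: "'a::idom poly"
  assumes "u - [:poly u c:] = [:- c, 1:] * H"
  shows "poly (pderiv u) c = poly H c"
proof -
  have "pderiv (u - [:poly u c:]) = pderiv ([:- c, 1:] * H)"
    by (simp only: assms)
  then have "pderiv u = H + [:- c, 1:] * pderiv H"
    by (simp add: pderiv_diff pderiv_mult pderiv_pCons pderiv_smult)
  then show ?thesis
    by simp
qed

locale embedded_line =
  fixes u v :: "complex poly"
  assumes injective: "\<And>s t. poly u s = poly u t \<Longrightarrow> poly v s = poly v t \<Longrightarrow> s = t"
    and immersive: "\<And>t. poly (pderiv u) t \<noteq> 0 \<or> poly (pderiv v) t \<noteq> 0"
    and monic: "lead_coeff u = 1" and degree_u: "0 < degree u"
begin

definition m :: nat where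
  "m = degree u"

definition \<omega> :: complex where
  "\<omega> = cis (2 * pi / real m)"

definition T :: "complex fls" where
  "T = (SOME T. eval_at T u = fls_X_inv ^ m \<and> fls_subdegree T = - 1)"

definition V :: "complex fls" where
  "V = eval_at T v"

text \<open>The m solutions of u(T) = \<open>\<tau>\<^sup>m\<close>, see
  \<open>eval_at_T_conj\<close> and \<open>T_conj_inj\<close>.\<close>

definition T_conj :: "nat \<Rightarrow> complex fls" where
  "T_conj i = rot (\<omega> ^ i) T"

definition V_conj :: "nat \<Rightarrow> complex fls" where
  "V_conj i = rot (\<omega> ^ i) V"

lemma m_pos: "0 < m"
  using degree_u by (simp add: m_def)

lemma T: "eval_at T u = fls_X_inv ^ m" "fls_subdegree T = - 1"
proof -
  have "\<exists>T. eval_at T u = fls_X_inv ^ m \<and> fls_subdegree T = - 1"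
    unfolding m_def using exists_root_at_infinity[OF monic degree_u] by metis
  from someI_ex[OF this] show "eval_at T u = fls_X_inv ^ m" "fls_subdegree T = - 1"
    unfolding T_def[symmetric] by auto
qed

lemma primitive: "\<omega> powi k = 1 \<longleftrightarrow> int m dvd k"
  unfolding \<omega>_def using m_pos by (rule primitive_root_of_unity)

lemma omega: "\<omega> \<noteq> 0" and omega_power: "\<omega> ^ i \<noteq> 0"
  by (simp_all add: \<omega>_def)

lemma V_conj_eq: "V_conj i = eval_at (T_conj i) v"
  by (simp add: V_conj_def T_conj_def V_def eval_at_rot[OF omega_power])

lemma conj_0 [simp]: "T_conj 0 = T" "V_conj 0 = V"
  by (simp_all add: T_conj_def V_conj_def)

lemma rot_X_inv: "rot (\<omega> ^ i) (fls_X_inv ^ m) = fls_X_inv ^ m"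
proof (rule fls_eqI)
  fix k
  have "(\<omega> ^ i) powi (- int m) = \<omega> powi (int i * - int m)"
    by (simp only: power_int_mult power_int_of_nat)
  then have "(\<omega> ^ i) powi (- int m) = 1"
    using primitive by simp
  then show "rot (\<omega> ^ i) (fls_X_inv ^ m) $$ k = (fls_X_inv ^ m) $$ k"
    by (auto simp: nth_rot[OF omega_power] fls_X_inv_power_nth)
qed

lemma eval_at_T_conj: "eval_at (T_conj i) u = fls_X_inv ^ m"
  unfolding T_conj_def eval_at_rot[OF omega_power, symmetric] T(1) by (rule rot_X_inv)

lemma conj_diff:
  assumes "i \<le> j"
  shows "T_conj i - T_conj j = rot (\<omega> ^ i) (T - T_conj (j - i))"
    "V_conj i - V_conj j = rot (\<omega> ^ i) (V - V_conj (j - i))"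
proof -
  interpret r: field_hom "rot (\<omega> ^ i)"
    using omega_power by (rule rot_field_hom)
  have "\<omega> ^ i * \<omega> ^ (j - i) = \<omega> ^ j"
    using assms by (simp flip: power_add)
  then show "T_conj i - T_conj j = rot (\<omega> ^ i) (T - T_conj (j - i))"
    "V_conj i - V_conj j = rot (\<omega> ^ i) (V - V_conj (j - i))"
    by (simp_all add: T_conj_def V_conj_def r.hom_minus rot_rot[OF omega_power omega_power])
qed

lemma subdegree_T_diff:
  assumes "0 < i" "i < m"
  shows "fls_subdegree (T - T_conj i) = - 1"
proof (rule fls_subdegree_eqI)
  have "T \<noteq> 0"
    using T(2) by auto
  then have "T $$ (- 1) \<noteq> 0"
    using T(2) by (metis nth_fls_subdegree_nonzero)
  moreover have "(\<omega> ^ i) powi (- 1) \<noteq> 1"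
  proof
    assume "(\<omega> ^ i) powi (- 1) = 1"
    then have "\<omega> powi (int i * - 1) = 1"
      by (simp only: power_int_mult power_int_of_nat)
    then show False
      using assms primitive by (auto dest: zdvd_imp_le)
  qed
  ultimately show "(T - T_conj i) $$ (- 1) \<noteq> 0"
    by (auto simp: T_conj_def nth_rot[OF omega_power])
  show "(T - T_conj i) $$ k = 0" if "k < - 1" for k
    using that T(2) by (simp add: T_conj_def nth_rot[OF omega_power])
qed

lemma T_conj_inj: "inj_on T_conj {..<m}"
proof (rule linorder_inj_onI')
  fix i j
  assume ij: "i \<in> {..<m}" "j \<in> {..<m}" "i < j"
  then have "fls_subdegree (T_conj i - T_conj j) = - 1"
    using conj_diff(1)[of i j] subdegree_T_diff[of "j - i"]
    by (simp add: fls_subdegree_rot[OF omega_power])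
  then show "T_conj i \<noteq> T_conj j"
    by auto
qed

text \<open>\<open>det M\<close> is the resultant in t of the quotients H(s, t) and G(s, t) of
  \<open>u\<close> and \<open>v\<close>. A zero s = c gives a z at which both quotients vanish; then
  \<open>u\<close> and \<open>v\<close> agree at z and c, so z = c by injectivity, and both
  derivatives vanish at c, against immersivity. Hence \<open>det M\<close> is constant. For s =
  \<open>T\<close> the roots of H are the other conjugates of \<open>T\<close>, and the determinant
  becomes the product of the values G = (V - V_i) / (T - T_i).\<close>

lemma constant_resultant:
  obtains k where "k \<noteq> 0" "(\<Prod>i\<in>{0<..<m}. V - V_conj i) = fls_const k * (\<Prod>i\<in>{0<..<m}. T - T_conj i)"
proof -
  obtain H where H: "map_poly (\<lambda>c. [:c:]) u - [:u:] = [:- [:0, 1:], 1:] * H"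
    by (rule difference_quotient)
  obtain G where G: "map_poly (\<lambda>c. [:c:]) v - [:v:] = [:- [:0, 1:], 1:] * G"
    by (rule difference_quotient)
  have dH: "degree H = m - 1" "lead_coeff H = 1"
    using difference_quotient_monic[OF H monic degree_u] by (simp_all add: m_def)
  obtain M q where M: "M \<in> carrier_mat (degree H) (degree H)"
    "\<And>i. i < degree H \<Longrightarrow> monom 1 i * G = (\<Sum>j<degree H. monom (index_mat M (i, j)) j) + H * q i"
    by (rule multiplication_matrix[OF dH(2), where f = G]) blast
  have nonzero: "poly (det M) c \<noteq> 0" for c
  proof
    define \<phi> :: "complex poly \<Rightarrow> complex" where "\<phi> = (\<lambda>p. poly p c)"
    have \<phi>: "\<phi> p = poly p c" for p
      by (simp add: \<phi>_def)
    interpret e: comm_ring_hom \<phi>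
      unfolding \<phi>_def by unfold_locales simp_all
    interpret mp: map_poly_comm_ring_hom \<phi> ..
    let ?H = "map_poly \<phi> H" and ?G = "map_poly \<phi> G"
    assume "poly (det M) c = 0"
    then have det: "det (map_mat \<phi> M) = 0"
      by (simp add: \<phi>)
    have dH': "degree ?H = degree H" "?H \<noteq> 0"
    proof -
      show "degree ?H = degree H"
        using dH(2) by (intro degree_map_poly) (simp add: \<phi>, auto)
      have "coeff ?H (degree H) = 1"
        by (simp only: e.coeff_map_poly_hom dH(2) e.hom_one)
      then show "?H \<noteq> 0"
        by (metis coeff_0 zero_neq_one)
    qed
    have "\<exists>z. poly ?H z = 0 \<and> poly ?G z = 0"
    proof (rule common_root_if_det_0[OF _ _ det dH'(2)])
      show "map_mat \<phi> M \<in> carrier_mat (degree ?H) (degree ?H)"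
        using M(1) dH' by simp
      fix i
      assume "i < degree ?H"
      then have i: "i < degree H"
        using dH' by simp
      have "map_poly \<phi> (monom 1 i * G) =
          map_poly \<phi> ((\<Sum>j<degree H. monom (index_mat M (i, j)) j) + H * q i)"
        by (simp only: M(2)[OF i])
      then show "monom 1 i * ?G = (\<Sum>j<degree ?H. monom (index_mat (map_mat \<phi> M) (i, j)) j) +
          ?H * map_poly \<phi> (q i)"
        using M(1) i dH'(1) by (simp add: mp.hom_mult mp.hom_add mp.hom_sum)
    qed
    then obtain z where z: "poly ?H z = 0" "poly ?G z = 0"
      by blast
    have *: "w - [:poly w c:] = [:- c, 1:] * map_poly \<phi> K"
      if "map_poly (\<lambda>c. [:c:]) w - [:w:] = [:- [:0, 1:], 1:] * K" for w K
      using difference_quotient_hom[OF e.comm_ring_hom_axioms that] by (simp add: \<phi> map_poly_id')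
    have "poly w z = poly w c"
      if "map_poly (\<lambda>c. [:c:]) w - [:w:] = [:- [:0, 1:], 1:] * K" "poly (map_poly \<phi> K) z = 0" for w K
    proof -
      have "poly (w - [:poly w c:]) z = poly ([:- c, 1:] * map_poly \<phi> K) z"
        by (simp only: *[OF that(1)])
      then show ?thesis
        using that(2) by simp
    qed
    then have "z = c"
      using injective H G z by blast
    then show False
      using immersive[of c] z pderiv_difference_quotient[OF *[OF H]] pderiv_difference_quotient[OF *[OF G]] by simp
  qed
  then have "degree (det M) = 0"
    using fundamental_theorem_of_algebra[of "det M"] constant_degree by metis
  then obtain k where k: "det M = [:k:]"
    by (rule degree_eq_zeroE)
  have "k \<noteq> 0"
    using nonzero[of 0] by (simp add: k)
  interpret e: comm_ring_hom "eval_at T"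
    by (rule eval_at_hom)
  have eq: "eval_at x w - eval_at T w = (x - T) * poly (map_poly (eval_at T) K) x"
    if "map_poly (\<lambda>c. [:c:]) w - [:w:] = [:- [:0, 1:], 1:] * K" for w K x
  proof -
    have "poly (map_poly (\<lambda>c. eval_at T [:c:]) w - [:eval_at T w:]) x =
        poly ([:- eval_at T [:0, 1:], 1:] * map_poly (eval_at T) K) x"
      by (simp only: difference_quotient_hom[OF eval_at_hom that])
    then show ?thesis
      by (simp add: eval_at_def[symmetric] left_diff_distrib)
  qed
  \<comment> \<open>Indices start at 1, because division by t - s has removed the root
    \<open>T\<close> belonging to index 0.\<close>
  let ?b = "\<lambda>i. poly (map_poly (eval_at T) G) (T_conj (Suc i))"
  have "det (map_mat (eval_at T) M) = (\<Prod>i<degree H. ?b i)"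
  proof (rule det_eq_prod_eigenvalues)
    show "map_mat (eval_at T) M \<in> carrier_mat (degree H) (degree H)"
      using M(1) by simp
    have "inj_on (T_conj \<circ> Suc) {..<degree H}"
      using dH m_pos by (intro comp_inj_on inj_on_subset[OF T_conj_inj]) auto
    then show "inj_on (\<lambda>i. T_conj (Suc i)) {..<degree H}"
      by (simp add: comp_def)
    fix i k
    assume ik: "i < degree H" "k < degree H"
    have "Suc k < m"
      using ik dH(1) by simp
    then have "T_conj (Suc k) - T \<noteq> 0"
      using subdegree_T_diff[of "Suc k"] by auto
    then have "poly (map_poly (eval_at T) H) (T_conj (Suc k)) = 0"
      using eq[OF H, of "T_conj (Suc k)"] by (simp add: eval_at_T_conj T(1))
    from multiplication_matrix_root[OF eval_at_hom M(2)[OF ik(1)] this]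
    show "(\<Sum>j<degree H. index_mat (map_mat (eval_at T) M) (i, j) * T_conj (Suc k) ^ j) =
        ?b k * T_conj (Suc k) ^ i"
      using M(1) ik by simp
  qed
  moreover have "det (map_mat (eval_at T) M) = fls_const k"
    by (simp add: k)
  ultimately have prod: "(\<Prod>i<m - 1. ?b i) = fls_const k"
    by (simp add: dH)
  have "(\<Prod>i\<in>{0<..<m}. V - V_conj i) = (\<Prod>i<m - 1. V - V_conj (Suc i))"
    by (rule prod.reindex_bij_witness[of _ Suc "\<lambda>i. i - 1"]) auto
  also have "\<dots> = (\<Prod>i<m - 1. (T - T_conj (Suc i)) * ?b i)"
  proof (rule prod.cong)
    fix i
    have "V_conj (Suc i) - V = (T_conj (Suc i) - T) * ?b i"
      using eq[OF G, of "T_conj (Suc i)"] by (simp add: V_conj_eq V_def)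
    then show "V - V_conj (Suc i) = (T - T_conj (Suc i)) * ?b i"
      by (metis minus_diff_eq minus_mult_left)
  qed simp
  also have "\<dots> = fls_const k * (\<Prod>i<m - 1. T - T_conj (Suc i))"
    by (simp only: prod.distrib prod mult.commute)
  also have "(\<Prod>i<m - 1. T - T_conj (Suc i)) = (\<Prod>i\<in>{0<..<m}. T - T_conj i)"
    by (rule prod.reindex_bij_witness[of _ "\<lambda>i. i - 1" Suc]) auto
  finally show ?thesis
    using that \<open>k \<noteq> 0\<close> by blast
qed

lemma T_diff_nonzero: "0 < i \<Longrightarrow> i < m \<Longrightarrow> T - T_conj i \<noteq> 0"
  using subdegree_T_diff[of i] by auto

lemma V_diff_nonzero: "0 < i \<Longrightarrow> i < m \<Longrightarrow> V - V_conj i \<noteq> 0"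
proof -
  assume i: "0 < i" "i < m"
  obtain k where k: "k \<noteq> 0" "(\<Prod>i\<in>{0<..<m}. V - V_conj i) = fls_const k * (\<Prod>i\<in>{0<..<m}. T - T_conj i)"
    by (rule constant_resultant)
  have "(\<Prod>i\<in>{0<..<m}. V - V_conj i) \<noteq> 0"
    using k T_diff_nonzero by (auto simp: fls_const_eq_0_iff)
  moreover have "i \<in> {0<..<m}"
    using i by simp
  ultimately show ?thesis
    by (metis finite_greaterThanLessThan prod_zero_iff)
qed

lemma different_degree: "(\<Sum>i\<in>{0<..<m}. - fls_subdegree (V - V_conj i)) = int m - 1"
proof -
  obtain k where k: "k \<noteq> 0" "(\<Prod>i\<in>{0<..<m}. V - V_conj i) = fls_const k * (\<Prod>i\<in>{0<..<m}. T - T_conj i)"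
    by (rule constant_resultant)
  have "(\<Sum>i\<in>{0<..<m}. fls_subdegree (V - V_conj i)) = fls_subdegree (\<Prod>i\<in>{0<..<m}. V - V_conj i)"
    using V_diff_nonzero by (intro fls_subdegree_prod[symmetric]) auto
  also have "\<dots> = fls_subdegree (\<Prod>i\<in>{0<..<m}. T - T_conj i)"
    using k(1) T_diff_nonzero unfolding k(2) by (subst fls_subdegree_mult) auto
  also have "\<dots> = (\<Sum>i\<in>{0<..<m}. fls_subdegree (T - T_conj i))"
    using T_diff_nonzero by (intro fls_subdegree_prod) auto
  also have "\<dots> = (\<Sum>i\<in>{0<..<m}. - 1)"
    using subdegree_T_diff by (intro sum.cong) auto
  finally show ?thesis
    using m_pos by (simp add: sum_negf of_nat_diff)
qed

lemma V_conj_inj: "inj_on V_conj {..<m}"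
proof (rule linorder_inj_onI')
  fix i j
  assume ij: "i \<in> {..<m}" "j \<in> {..<m}" "i < j"
  interpret r: field_hom "rot (\<omega> ^ i)"
    using omega_power by (rule rot_field_hom)
  have "V - V_conj (j - i) \<noteq> 0"
    using ij by (intro V_diff_nonzero) auto
  then have "V_conj i - V_conj j \<noteq> 0"
    using ij conj_diff(2)[of i j] by simp
  then show "V_conj i \<noteq> V_conj j"
    by auto
qed

text \<open>Multiplication by \<open>v\<close> on C[t], which is free over C[u] with basis 1, t,
  ..., t^(m-1); the coefficient variable of \<open>P\<close> stands for u. After u becomes
  \<open>\<tau>\<^sup>m\<close>, the powers of the k-th conjugate of \<open>T\<close> form an
  eigenvector with eigenvalue \<open>V_conj k\<close>, and these m eigenvalues are distinct.\<close>

lemma characteristic_polynomial: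
  obtains P :: "complex poly poly" where "degree P = m" "lead_coeff P = 1"
    "map_poly (eval_at (fls_X_inv ^ m)) P = (\<Prod>i<m. [:- V_conj i, 1:])"
proof -
  define h where "h = map_poly (\<lambda>c. [:c:]) u - [:[:0, 1:]:]"
  define f where "f = map_poly (\<lambda>c. [:c:]) v"
  have h: "degree h = m" "lead_coeff h = 1"
    using monic_diff_const[OF monic degree_u, of "[:0, 1:]"] by (simp_all add: h_def m_def)
  obtain M q where M: "M \<in> carrier_mat m m"
    "\<And>i. i < m \<Longrightarrow> monom 1 i * f = (\<Sum>j<m. monom (index_mat M (i, j)) j) + h * q i"
    by (rule multiplication_matrix[OF h(2), where f = f, unfolded h(1)]) blast
  define \<epsilon> where "\<epsilon> = eval_at (fls_X_inv ^ m :: complex fls)"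
  have hom: "comm_ring_hom \<epsilon>"
    unfolding \<epsilon>_def by (rule eval_at_hom)
  interpret e: comm_ring_hom \<epsilon>
    by (rule hom)
  interpret mp: map_poly_comm_ring_hom \<epsilon> ..
  have map_const: "poly (map_poly \<epsilon> (map_poly (\<lambda>c. [:c:]) w)) x = eval_at x w" for w x
    by (simp add: map_poly_map_poly comp_def \<epsilon>_def) (simp add: eval_at_def)
  have root: "poly (map_poly \<epsilon> h) (T_conj k) = 0" for k
  proof -
    have "map_poly \<epsilon> [:[:0, 1:]:] = [:fls_X_inv ^ m:]"
      by (simp add: map_poly_pCons) (simp add: \<epsilon>_def)
    then show ?thesis
      by (simp only: h_def mp.hom_minus poly_diff map_const eval_at_T_conj) simp
  qed
  define M' where "M' = map_mat \<epsilon> M"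
  have M': "M' \<in> carrier_mat m m"
    using M(1) by (simp add: M'_def)
  have eigen: "poly (char_poly M') (V_conj k) = 0" for k
  proof -
    define w where "w = vec m (\<lambda>j. T_conj k ^ j)"
    have "M' *\<^sub>v w = V_conj k \<cdot>\<^sub>v w"
    proof (rule eq_vecI)
      fix i
      assume "i < dim_vec (V_conj k \<cdot>\<^sub>v w)"
      then have i: "i < m"
        by (simp add: w_def)
      have "(\<Sum>j<m. \<epsilon> (index_mat M (i, j)) * T_conj k ^ j) = V_conj k * T_conj k ^ i"
        using multiplication_matrix_root[OF hom M(2)[OF i] root] by (simp add: f_def map_const V_conj_eq)
      then show "vec_index (M' *\<^sub>v w) i = vec_index (V_conj k \<cdot>\<^sub>v w) i"
        using i M(1) by (simp add: M'_def w_def scalar_prod_def flip: lessThan_atLeast0)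
    qed (use M' in \<open>simp add: w_def\<close>)
    moreover have "w \<noteq> 0\<^sub>v m"
    proof
      assume "w = 0\<^sub>v m"
      then have "vec_index w 0 = 0"
        using m_pos by simp
      then show False
        using m_pos by (simp add: w_def)
    qed
    ultimately have "eigenvector M' w (V_conj k)"
      using M' by (simp add: eigenvector_def w_def)
    then show ?thesis
      using eigenvalue_root_char_poly[OF M'] by (auto simp: eigenvalue_def)
  qed
  have deg: "degree (char_poly M') = m" "lead_coeff (char_poly M') = 1"
    using degree_monic_char_poly[OF M'] by auto
  define Q where "Q = (\<Prod>i<m. [:- V_conj i, 1:])"
  have Q: "degree Q = m" "lead_coeff Q = 1"
    unfolding Q_def by (subst degree_prod_eq_sum_degree) (auto simp only: lead_coeff_prod lead_coeff_pCons, auto)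
  have "char_poly M' = Q"
  proof (rule ccontr)
    assume "char_poly M' \<noteq> Q"
    then have nz: "char_poly M' - Q \<noteq> 0"
      by simp
    have "degree (char_poly M' - Q) \<le> m"
      using deg Q by (intro degree_diff_le) auto
    moreover have "coeff (char_poly M' - Q) m = 0"
      using deg Q by simp
    ultimately have less: "degree (char_poly M' - Q) < m"
      using nz by (metis leading_coeff_0_iff le_neq_implies_less)
    have "V_conj ` {..<m} \<subseteq> {x. poly (char_poly M' - Q) x = 0}"
      using eigen by (auto simp: Q_def poly_prod)
    then have "card (V_conj ` {..<m}) \<le> card {x. poly (char_poly M' - Q) x = 0}"
      by (rule card_mono[OF poly_roots_finite[OF nz]])
    then show False
      using card_poly_roots_bound[OF nz] less by (simp add: card_image[OF V_conj_inj])
  qed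
  moreover have "char_poly M' = map_poly \<epsilon> (char_poly M)"
    unfolding M'_def by (rule e.char_poly_hom[OF M(1)])
  ultimately show ?thesis
    using that[of "char_poly M"] degree_monic_char_poly[OF M(1)] by (simp add: Q_def \<epsilon>_def)
qed

text \<open>Take the approximate root \<open>A0\<close> over C[u]. Its value at \<open>v\<close> is
  a polynomial \<open>a\<close> in t; were its degree at \<open>T\<close> at most 0, it would be a
  constant k. Conjugation fixes k and the coefficients of \<open>A\<close>, so \<open>A - k\<close>
  would have the m distinct conjugates of \<open>V\<close> as roots, while its degree is N <
  m.\<close>

lemma approx_root:
  assumes "2 \<le> d" "m = d * N"
  shows "\<exists>A. degree A = N \<and> lead_coeff A = 1 \<and>
    degree ((\<Prod>i<m. [:- V_conj i, 1:]) - A ^ d) < (d - 1) * N \<and> \<not> deg_le (poly A V) 0"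
proof -
  obtain P :: "complex poly poly" where P: "degree P = m" "lead_coeff P = 1"
    "map_poly (eval_at (fls_X_inv ^ m)) P = (\<Prod>i<m. [:- V_conj i, 1:])"
    by (rule characteristic_polynomial)
  have "0 < N"
    using assms m_pos by (cases N) auto
  have "of_nat d * [:1 / of_nat d:] = (1 :: complex poly)"
    using assms(1) by (simp add: of_nat_poly)
  moreover have "degree P = d * N"
    using P(1) assms(2) by simp
  ultimately obtain A0 where A0: "degree A0 = N" "lead_coeff A0 = 1" "degree (P - A0 ^ d) < (d - 1) * N"
    using exists_approximate_root_idom[OF assms(1) \<open>0 < N\<close> _ P(2), where r = "[:1 / of_nat d:]"] by metis
  define \<epsilon> where "\<epsilon> = eval_at (fls_X_inv ^ m :: complex fls)"
  interpret e: comm_ring_hom \<epsilon>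
    unfolding \<epsilon>_def by (rule eval_at_hom)
  interpret mp: map_poly_comm_ring_hom \<epsilon> ..
  define A where "A = map_poly \<epsilon> A0"
  have lA: "coeff A N = 1"
    using A0(1,2) by (simp add: A_def e.coeff_map_poly_hom)
  have dA: "degree A = N"
    using degree_map_poly_le[of \<epsilon> A0] le_degree[of A N] lA A0(1) by (simp add: A_def)
  have "(\<Prod>i<m. [:- V_conj i, 1:]) - A ^ d = map_poly \<epsilon> (P - A0 ^ d)"
    by (simp only: P(3)[symmetric] A_def \<epsilon>_def[symmetric] mp.hom_minus mp.hom_power)
  then have "degree ((\<Prod>i<m. [:- V_conj i, 1:]) - A ^ d) < (d - 1) * N"
    using degree_map_poly_le[of \<epsilon> "P - A0 ^ d"] A0(3) by simp
  moreover have "\<not> deg_le (poly A V) 0"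
  proof
    assume le: "deg_le (poly A V) 0"
    interpret t: comm_ring_hom "eval_at T"
      by (rule eval_at_hom)
    define a where "a = poly (map_poly (\<lambda>c. pcompose c u) A0) v"
    have "map_poly (eval_at T) (map_poly (\<lambda>c. pcompose c u) A0) = A"
      by (simp add: map_poly_map_poly comp_def eval_at_pcompose T(1) A_def \<epsilon>_def)
    then have a: "poly A V = eval_at T a"
      unfolding a_def V_def by (metis t.poly_map_poly)
    have "degree a = 0"
    proof (cases "a = 0")
      case False
      then show ?thesis
        using eval_at_subdegree[OF T(2), of a] le by (simp add: a deg_le_iff_subdegree)
    qed simp
    then obtain k where k: "a = [:k:]"
      by (rule degree_eq_zeroE)
    define B where "B = A - [:fls_const k:]"
    have "poly A (V_conj i) = fls_const k" for i
    proof -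
      interpret r: field_hom "rot (\<omega> ^ i)"
        using omega_power by (rule rot_field_hom)
      have "rot (\<omega> ^ i) (\<epsilon> c) = \<epsilon> c" for c
        by (simp add: \<epsilon>_def eval_at_rot[OF omega_power] rot_X_inv)
      then have "map_poly (rot (\<omega> ^ i)) A = A"
        by (simp add: A_def map_poly_map_poly comp_def)
      then have "poly A (V_conj i) = rot (\<omega> ^ i) (poly A V)"
        unfolding V_conj_def by (metis r.poly_map_poly)
      also have "\<dots> = fls_const k"
        by (rule fls_eqI) (simp add: a k nth_rot[OF omega_power])
      finally show ?thesis .
    qed
    then have sub: "V_conj ` {..<m} \<subseteq> {x. poly B x = 0}"
      by (auto simp: B_def)
    have "N < m"
      using assms \<open>0 < N\<close> by simp
    have "coeff B N = 1"
      using lA \<open>0 < N\<close> by (cases N) (simp_all add: B_def)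
    then have nz: "B \<noteq> 0"
      by auto
    have "degree B \<le> N"
      unfolding B_def using dA by (intro degree_diff_le) auto
    then show False
      using card_mono[OF poly_roots_finite[OF nz] sub] card_poly_roots_bound[OF nz] \<open>N < m\<close>
      by (simp add: card_image[OF V_conj_inj])
  qed
  ultimately show ?thesis
    using dA lA by blast
qed

sublocale one_place m \<omega> V
proof
  show "V \<noteq> rot (\<omega> ^ i) V" if "0 < i" "i < m" for i
    using V_diff_nonzero[OF that] by (simp add: V_conj_def)
  show "(\<Sum>i\<in>{0<..<m}. - fls_subdegree (V - rot (\<omega> ^ i) V)) = int m - 1"
    using different_degree by (simp add: V_conj_def)
qed (use m_pos omega primitive approx_root in \<open>simp_all add: V_conj_def\<close>)

theorem degrees_divide:
  assumes "0 < degree v"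
  shows "degree u dvd degree v \<or> degree v dvd degree u"
proof (rule disjCI)
  assume "\<not> degree v dvd degree u"
  have "v \<noteq> 0"
    using assms by auto
  then have V: "V \<noteq> 0" "fls_subdegree V = - int (degree v)"
    using eval_at_subdegree[OF T(2)] by (simp_all add: V_def)
  have "V $$ (- int (degree v)) \<noteq> 0"
    using V by (metis nth_fls_subdegree_nonzero)
  moreover have "deg_le V (int (degree v))"
    using V by (simp add: deg_le_iff_subdegree)
  ultimately have "int m dvd int (degree v)"
    using degree_divides[of "int (degree v)"] \<open>\<not> degree v dvd degree u\<close> unfolding m_def by auto
  then show "degree u dvd degree v"
    by (simp add: m_def)
qed

end

theorem line_embedding_degrees:
  fixes u v :: "complex poly"
  assumes injective: "\<And>s t. poly u s = poly u t \<Longrightarrow> poly v s = poly v t \<Longrightarrow> s = t"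
    and immersive: "\<And>t. poly (pderiv u) t \<noteq> 0 \<or> poly (pderiv v) t \<noteq> 0"
    and "0 < degree u" "0 < degree v"
  shows "degree u dvd degree v \<or> degree v dvd degree u"
proof -
  \<comment> \<open>Scaling makes \<open>u\<close> monic and preserves the hypotheses and the
    degrees.\<close>
  define c where "c = inverse (lead_coeff u)"
  have "c \<noteq> 0"
    using assms(3) by (auto simp: c_def)
  then interpret embedded_line "Polynomial.smult c u" v
    using assms by unfold_locales (auto simp: pderiv_smult c_def)
  show ?thesis
    using degrees_divide[OF assms(4)] \<open>c \<noteq> 0\<close> by simp
qed

section \<open>Jacobian pairs in the plane\<close>

lemma bipoly_induct [case_names const x y add mult]:
  assumes const: "\<And>c. P (const2 c)" and x: "P var_x" and y: "P var_y"
    and add: "\<And>f g. P f \<Longrightarrow> P g \<Longrightarrow> P (f + g)" and mult: "\<And>f g. P f \<Longrightarrow> P g \<Longrightarrow> P (f * g)"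
  shows "P f"
proof -
  have "P [:a:]" for a
  proof (induction a)
    case 0
    show ?case
      using const[of 0] by (simp add: const2_def)
  next
    case (pCons c a)
    have "[:pCons c a:] = const2 c + var_x * [:a:]"
      by (simp add: const2_def var_x_def)
    then show ?case
      using add[OF const mult[OF x pCons.IH]] by simp
  qed
  then show ?thesis
  proof (induction f)
    case 0
    show ?case
      using const[of 0] by (simp add: const2_def)
  next
    case (pCons a f)
    have "pCons a f = [:a:] + var_y * f"
      by (simp add: var_y_def)
    then show ?case
      using add[OF pCons.prems mult[OF y pCons.IH[OF pCons.prems]]] by simp
  qed
qed

lemma const2_hom: "comm_ring_hom const2"
  by unfold_locales (simp_all add: const2_def one_pCons)

interpretation const2: comm_ring_hom const2
  by (rule const2_hom)

lemma polynomial_mapping_hom: "polynomial_mapping \<phi> \<Longrightarrow> comm_ring_hom \<phi>"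
proof -
  assume \<phi>: "polynomial_mapping \<phi>"
  have "\<phi> (const2 0) = const2 0" "\<phi> (const2 1) = const2 1"
    using \<phi> unfolding polynomial_mapping_def by blast+
  then show ?thesis
    using \<phi> by unfold_locales (simp_all add: polynomial_mapping_def)
qed

lemma polynomial_mapping_const2: "polynomial_mapping \<phi> \<Longrightarrow> \<phi> (const2 c) = const2 c"
  by (simp add: polynomial_mapping_def)

lemma polynomial_mapping_comp: "polynomial_mapping \<phi> \<Longrightarrow> polynomial_mapping \<psi> \<Longrightarrow> polynomial_mapping (\<phi> \<circ> \<psi>)"
  by (simp add: polynomial_mapping_def)

lemma polynomial_mapping_eq_id:
  assumes "polynomial_mapping \<phi>" "\<phi> var_x = var_x" "\<phi> var_y = var_y"
  shows "\<phi> f = f"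
  by (induction f rule: bipoly_induct) (use assms in \<open>simp_all add: polynomial_mapping_def\<close>)

lemma polynomial_mapping_bij:
  assumes "polynomial_mapping \<phi>" "polynomial_mapping \<psi>"
    and "\<phi> (\<psi> var_x) = var_x" "\<phi> (\<psi> var_y) = var_y" "\<psi> (\<phi> var_x) = var_x" "\<psi> (\<phi> var_y) = var_y"
  shows "bij \<phi>"
proof (rule o_bij)
  show "\<phi> \<circ> \<psi> = id" "\<psi> \<circ> \<phi> = id"
    using polynomial_mapping_eq_id[OF polynomial_mapping_comp[OF assms(1,2)]]
      polynomial_mapping_eq_id[OF polynomial_mapping_comp[OF assms(2,1)]] assms(3-6)
    by (auto simp: fun_eq_iff)
qed

definition subst2 :: "bipoly \<Rightarrow> bipoly \<Rightarrow> bipoly \<Rightarrow> bipoly" where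
  "subst2 p q f = poly (map_poly (\<lambda>c. poly (map_poly const2 c) p) f) q"

lemma polynomial_mapping_subst2: "polynomial_mapping (subst2 p q)"
  and subst2_x [simp]: "subst2 p q var_x = p" and subst2_y [simp]: "subst2 p q var_y = q"
  and subst2_const2 [simp]: "subst2 p q (const2 c) = const2 c"
proof -
  define h where "h = (\<lambda>c. poly (map_poly const2 c) p)"
  interpret mc: map_poly_comm_ring_hom const2 ..
  interpret h: comm_ring_hom h
    unfolding h_def by unfold_locales (simp_all add: mc.hom_mult mc.hom_add)
  interpret mh: map_poly_comm_ring_hom h ..
  have h: "h [:c:] = const2 c" for c
    by (cases "c = 0") (simp_all add: h_def map_poly_pCons)
  have hX: "h [:0, 1:] = p"
    by (simp add: h_def map_poly_pCons)
  have s: "subst2 p q f = poly (map_poly h f) q" for f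
    by (simp add: subst2_def h_def)
  show c: "subst2 p q (const2 c) = const2 c" for c
    by (cases "c = 0") (simp_all add: s const2_def map_poly_pCons, simp_all add: h flip: const2_def)
  show "subst2 p q var_x = p"
    by (simp add: s var_x_def map_poly_pCons hX)
  show "subst2 p q var_y = q"
    by (simp add: s var_y_def map_poly_pCons)
  show "polynomial_mapping (subst2 p q)"
    using c by (simp add: polynomial_mapping_def) (simp add: s mh.hom_add mh.hom_mult)
qed

lemma subst2_hom: "comm_ring_hom (subst2 p q)"
  by (rule polynomial_mapping_hom[OF polynomial_mapping_subst2])

lemma poly_poly_swap: "poly (poly f [:b:]) a = poly (map_poly (\<lambda>c. poly c a) f) b" for f :: bipoly
  by (induction f) (simp_all add: map_poly_pCons)

lemma eval2_simps [simp]: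
  "eval2 (f + g) z = eval2 f z + eval2 g z" "eval2 (f - g) z = eval2 f z - eval2 g z"
  "eval2 (f * g) z = eval2 f z * eval2 g z" "eval2 (f ^ n) z = eval2 f z ^ n"
  "eval2 (const2 c) z = c" "eval2 var_x z = fst z" "eval2 var_y z = snd z"
  by (simp_all add: eval2_def const2_def var_x_def var_y_def split: prod.split)

lemma eval2_polynomial_mapping:
  "polynomial_mapping \<phi> \<Longrightarrow> eval2 (\<phi> f) z = eval2 f (induced_map \<phi> z)"
  by (induction f rule: bipoly_induct) (simp_all add: polynomial_mapping_def induced_map_def)

lemma d_x_pCons: "d_x (pCons a f) = pCons (pderiv a) (d_x f)"
  by (rule poly_eqI) (simp add: d_x_def coeff_map_poly coeff_pCons split: nat.split)

lemma d_x_simps [simp]: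
  "d_x 0 = 0" "d_x 1 = 0" "d_x (const2 c) = 0" "d_x var_x = 1" "d_x var_y = 0"
proof -
  show *: "d_x 0 = 0"
    by (simp add: d_x_def)
  show "d_x 1 = 0" "d_x (const2 c) = 0" "d_x var_x = 1" "d_x var_y = 0"
    by (simp_all add: d_x_pCons * const2_def var_x_def var_y_def pderiv_pCons one_pCons)
qed

lemma d_x_add [simp]: "d_x (f + g) = d_x f + d_x g" and d_x_diff [simp]: "d_x (f - g) = d_x f - d_x g"
  by (rule poly_eqI, simp add: d_x_def coeff_map_poly pderiv_add pderiv_diff)+

lemma d_y_simps [simp]:
  "d_y (f + g) = d_y f + d_y g" "d_y (f - g) = d_y f - d_y g" "d_y (const2 c) = 0" "d_y var_x = 0" "d_y var_y = 1"
  "d_y (f * g) = d_y f * g + f * d_y g"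
  by (simp_all add: d_y_def const2_def var_x_def var_y_def pderiv_add pderiv_diff pderiv_pCons pderiv_mult mult.commute)

lemma d_x_smult: "d_x (Polynomial.smult a f) = Polynomial.smult (pderiv a) f + Polynomial.smult a (d_x f)"
  by (rule poly_eqI) (simp add: d_x_def coeff_map_poly pderiv_mult algebra_simps)

lemma d_x_mult [simp]: "d_x (f * g) = d_x f * g + f * d_x g"
proof (induction f)
  case 0
  show ?case
    by (simp add: d_x_def)
next
  case (pCons a f)
  then show ?case
    by (simp add: d_x_pCons d_x_smult algebra_simps)
qed

definition jac :: "bipoly \<Rightarrow> bipoly \<Rightarrow> bipoly" where
  "jac p q = d_x p * d_y q - d_y p * d_x q"

lemma chain_rule:
  assumes "polynomial_mapping \<alpha>"
  shows "d_x (\<alpha> f) = \<alpha> (d_x f) * d_x (\<alpha> var_x) + \<alpha> (d_y f) * d_x (\<alpha> var_y)"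
    and "d_y (\<alpha> f) = \<alpha> (d_x f) * d_y (\<alpha> var_x) + \<alpha> (d_y f) * d_y (\<alpha> var_y)"
proof -
  interpret comm_ring_hom \<alpha>
    by (rule polynomial_mapping_hom[OF assms])
  show "d_x (\<alpha> f) = \<alpha> (d_x f) * d_x (\<alpha> var_x) + \<alpha> (d_y f) * d_x (\<alpha> var_y)"
    by (induction f rule: bipoly_induct)
      (simp_all add: hom_add hom_mult polynomial_mapping_const2[OF assms] algebra_simps)
  show "d_y (\<alpha> f) = \<alpha> (d_x f) * d_y (\<alpha> var_x) + \<alpha> (d_y f) * d_y (\<alpha> var_y)"
    by (induction f rule: bipoly_induct)
      (simp_all add: hom_add hom_mult polynomial_mapping_const2[OF assms] algebra_simps)
qed

lemma jac_comp:
  assumes "polynomial_mapping \<alpha>"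
  shows "jac (\<alpha> p) (\<alpha> q) = \<alpha> (jac p q) * jac (\<alpha> var_x) (\<alpha> var_y)"
proof -
  interpret comm_ring_hom \<alpha>
    by (rule polynomial_mapping_hom[OF assms])
  show ?thesis
    unfolding jac_def chain_rule[OF assms, of p] chain_rule[OF assms, of q]
    by (simp add: hom_minus hom_mult algebra_simps)
qed

lemma unit_bipoly:
  fixes f g :: bipoly
  assumes "f * g = 1"
  obtains c where "c \<noteq> 0" "f = const2 c"
proof -
  have "f dvd 1"
    using assms by (metis dvd_triv_left)
  then obtain a where a: "f = [:a:]" "a dvd 1"
    unfolding is_unit_poly_iff by blast
  then obtain c where "a = [:c:]" "c dvd 1"
    unfolding is_unit_poly_iff by blast
  then show ?thesis
    using that a by (auto simp: const2_def)
qed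

lemma invertible_jacobian:
  assumes "invertible (jacobian_matrix \<phi>)"
  obtains c where "c \<noteq> 0" "jac (\<phi> var_x) (\<phi> var_y) = const2 c"
proof -
  obtain B where "jacobian_matrix \<phi> ** B = Finite_Cartesian_Product.mat 1"
    using assms by (auto simp: invertible_def)
  then have "Determinants.det (jacobian_matrix \<phi>) * Determinants.det B = 1"
    by (metis Determinants.det_I Determinants.det_mul)
  moreover have "Determinants.det (jacobian_matrix \<phi>) = jac (\<phi> var_x) (\<phi> var_y)"
    by (simp add: Determinants.det_2 jacobian_matrix_def jac_def)
  ultimately show ?thesis
    using that by (metis unit_bipoly)
qed

lemma d_x_power [simp]: "d_x (f ^ n) = of_nat n * f ^ (n - 1) * d_x f"
proof (induction n)
  case (Suc n)
  then show ?case
    by (cases n) (simp_all add: algebra_simps)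
qed simp

lemma d_y_power [simp]: "d_y (f ^ n) = of_nat n * f ^ (n - 1) * d_y f"
proof (induction n)
  case (Suc n)
  then show ?case
    by (cases n) (simp_all add: algebra_simps)
qed (simp add: d_y_def)

lemma jac_shear: "jac p (q - const2 c * p ^ n) = jac p q"
  by (simp add: jac_def algebra_simps)

lemma jac_swap: "jac q p = - jac p q"
  by (simp add: jac_def algebra_simps)

section \<open>Restriction to the line x = 0\<close>

definition at_x0 :: "bipoly \<Rightarrow> complex poly" where
  "at_x0 f = map_poly (\<lambda>c. poly c 0) f"

lemma at_x0_hom: "comm_ring_hom at_x0"
proof -
  interpret e: comm_ring_hom "\<lambda>c :: complex poly. poly c 0"
    by unfold_locales simp_all
  interpret m: map_poly_comm_ring_hom "\<lambda>c :: complex poly. poly c 0" ..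
  show ?thesis
    unfolding at_x0_def by (rule m.comm_ring_hom_axioms)
qed

interpretation at_x0: comm_ring_hom at_x0
  by (rule at_x0_hom)

lemma at_x0_const2 [simp]: "at_x0 (const2 c) = [:c:]"
  by (cases "c = 0") (simp_all add: at_x0_def const2_def map_poly_pCons)

lemma coeff_at_x0: "coeff (at_x0 f) n = coeff (coeff f n) 0"
  by (simp add: at_x0_def coeff_map_poly poly_0_coeff_0)

lemma poly_at_x0: "poly (at_x0 f) t = eval2 f (0, t)"
  by (simp add: at_x0_def eval2_def poly_poly_swap)

lemma pderiv_at_x0: "pderiv (at_x0 f) = at_x0 (d_y f)"
  by (rule poly_eqI) (simp add: coeff_pderiv coeff_at_x0 d_y_def of_nat_poly distrib_right)

section \<open>Newton polygons; \<open>cf f i j\<close> belongs to the monomial x^i y^j\<close>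

abbreviation cf :: "bipoly \<Rightarrow> nat \<Rightarrow> nat \<Rightarrow> complex" where
  "cf f i j \<equiv> coeff (coeff f j) i"

lemma cf_mult: "cf (f * g) i j = (\<Sum>b\<le>j. \<Sum>a\<le>i. cf f a b * cf g (i - a) (j - b))"
  by (simp add: coeff_mult coeff_sum)

lemma cf_euler_x: "cf (var_x * d_x f) i j = of_nat i * cf f i j"
proof -
  have "coeff (var_x * d_x f) j = [:0, 1:] * pderiv (coeff f j)"
    by (simp add: var_x_def d_x_def coeff_map_poly)
  then show ?thesis
    by (cases i) (simp_all add: coeff_pderiv)
qed

lemma cf_euler_y: "cf (var_y * d_y f) i j = of_nat j * cf f i j"
  by (cases j) (simp_all add: var_y_def d_y_def coeff_pderiv of_nat_poly)

text \<open>The factor x y turns the partial derivatives into Euler operators, which multiply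
  monomials by their exponents. Each pair of monomials then contributes the determinant of its
  exponent vectors, without index shifts.\<close>

lemma cf_J:
  "cf (var_x * var_y * jac p q) i j =
    (\<Sum>b\<le>j. \<Sum>a\<le>i. (of_nat a * of_nat (j - b) - of_nat b * of_nat (i - a)) * (cf p a b * cf q (i - a) (j - b)))"
proof -
  have "var_x * var_y * jac p q = (var_x * d_x p) * (var_y * d_y q) - (var_y * d_y p) * (var_x * d_x q)"
    by (simp add: jac_def algebra_simps)
  then have "cf (var_x * var_y * jac p q) i j =
      cf ((var_x * d_x p) * (var_y * d_y q)) i j - cf ((var_y * d_y p) * (var_x * d_x q)) i j"
    by simp
  also have "\<dots> = (\<Sum>b\<le>j. \<Sum>a\<le>i. (of_nat a * of_nat (j - b) - of_nat b * of_nat (i - a)) * (cf p a b * cf q (i - a) (j - b)))"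
    unfolding cf_mult[of "var_x * d_x p" "var_y * d_y q"] cf_mult[of "var_y * d_y p" "var_x * d_x q"]
      cf_euler_x cf_euler_y sum_subtractf[symmetric]
    by (intro sum.cong refl) (simp add: algebra_simps)
  finally show ?thesis .
qed

lemma finite_support: "finite {(i, j). cf f i j \<noteq> 0}"
proof (rule finite_subset)
  show "{(i, j). cf f i j \<noteq> 0} \<subseteq> (\<Union>j\<le>degree f. {..degree (coeff f j)} \<times> {j})"
  proof clarify
    fix i j
    assume *: "cf f i j \<noteq> 0"
    then have "coeff f j \<noteq> 0"
      by auto
    with * show "(i, j) \<in> (\<Union>j\<le>degree f. {..degree (coeff f j)} \<times> {j})"
      by (auto intro: le_degree)
  qed
qed simp

text \<open>For a weight under which \<open>x\<close> and \<open>y\<close> are leading monomials of \<open>p\<close> and \<open>q\<close>, the vertices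
  \<open>(i\<^sub>0, j\<^sub>0)\<close> and \<open>(i\<^sub>1, j\<^sub>1)\<close> at the far end of the two leading edges contribute
  the only term of their degree to the Jacobian, and its coefficient is not zero.\<close>

lemma jac_extremal_coefficient:
  fixes A B :: int
  assumes A: "0 < A" and B: "0 < B"
    and p: "\<And>i j. cf p i j \<noteq> 0 \<Longrightarrow> int j * A \<le> B * (int i - 1)"
    and q: "\<And>i j. cf q i j \<noteq> 0 \<Longrightarrow> (int j - 1) * A \<le> B * int i"
    and p0: "cf p i0 j0 \<noteq> 0" "int j0 * A = B * (int i0 - 1)"
      "\<And>i j. cf p i j \<noteq> 0 \<Longrightarrow> int j * A = B * (int i - 1) \<Longrightarrow> i \<le> i0"
    and q0: "cf q i1 j1 \<noteq> 0" "(int j1 - 1) * A = B * int i1"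
      "\<And>i j. cf q i j \<noteq> 0 \<Longrightarrow> (int j - 1) * A = B * int i \<Longrightarrow> i \<le> i1"
  shows "cf (var_x * var_y * jac p q) (i0 + i1) (j0 + j1) \<noteq> 0"
proof -
  let ?t = "\<lambda>a b. (of_nat a * of_nat (j0 + j1 - b) - of_nat b * of_nat (i0 + i1 - a)) *
    (cf p a b * cf q (i0 + i1 - a) (j0 + j1 - b))"
  have zero: "?t a b = 0" if ab: "a \<le> i0 + i1" "b \<le> j0 + j1" "(a, b) \<noteq> (i0, j0)" for a b
  proof (rule ccontr)
    assume "?t a b \<noteq> 0"
    then have nz: "cf p a b \<noteq> 0" "cf q (i0 + i1 - a) (j0 + j1 - b) \<noteq> 0"
      by auto
    have le: "int b * A \<le> B * (int a - 1)" "(int (j0 + j1 - b) - 1) * A \<le> B * int (i0 + i1 - a)"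
      using p[OF nz(1)] q[OF nz(2)] by auto
    have "int b * A + (int (j0 + j1 - b) - 1) * A = int j0 * A + (int j1 - 1) * A"
      using ab(2) by (simp add: of_nat_diff algebra_simps)
    also have "\<dots> = B * (int i0 - 1) + B * int i1"
      by (simp only: p0(2) q0(2))
    also have "\<dots> = B * (int a - 1) + B * int (i0 + i1 - a)"
      using ab(1) by (simp add: of_nat_diff algebra_simps)
    finally have eq: "int b * A = B * (int a - 1)" "(int (j0 + j1 - b) - 1) * A = B * int (i0 + i1 - a)"
      using le by linarith+
    \<comment> \<open>Both monomials lie on the leading edges, so neither x-exponent exceeds that of
      the vertex; their sum is that of the two vertices.\<close>
    have "a = i0"
      using p0(3)[OF nz(1) eq(1)] q0(3)[OF nz(2) eq(2)] ab(1) by linarith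
    then have "int b * A = int j0 * A"
      using eq(1) p0(2) by simp
    then show False
      using A \<open>a = i0\<close> ab(3) by simp
  qed
  have "cf (var_x * var_y * jac p q) (i0 + i1) (j0 + j1) = (\<Sum>b\<le>j0 + j1. \<Sum>a\<le>i0 + i1. ?t a b)"
    by (rule cf_J)
  also have "\<dots> = (\<Sum>b\<in>{j0}. \<Sum>a\<le>i0 + i1. ?t a b)"
    by (intro sum.mono_neutral_right ballI sum.neutral zero) auto
  also have "\<dots> = (\<Sum>a\<le>i0 + i1. ?t a j0)"
    by (simp only: sum.insert finite.emptyI empty_iff not_False_eq_True sum.empty add_0_right)
  also have "\<dots> = (\<Sum>a\<in>{i0}. ?t a j0)"
    by (intro sum.mono_neutral_right ballI zero) auto
  also have "\<dots> = (of_nat i0 * of_nat j1 - of_nat j0 * of_nat i1) * (cf p i0 j0 * cf q i1 j1)"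
    by simp
  also have "\<dots> \<noteq> 0"
  proof -
    have "1 \<le> int i0"
    proof -
      have "0 \<le> B * (int i0 - 1)"
        using p0(2) A by (metis mult_nonneg_nonneg of_nat_0_le_iff order_less_imp_le)
      then show ?thesis
        using B by (simp add: zero_le_mult_iff)
    qed
    \<comment> \<open>Inserting the two edge equations cancels the products of \<open>i0\<close> and
      \<open>i1\<close> and leaves a positive quantity.\<close>
    have "(int i0 * int j1 - int j0 * int i1) * A = int i0 * ((int j1 - 1) * A) + int i0 * A - (int j0 * A) * int i1"
      by (simp add: algebra_simps)
    also have "\<dots> = int i0 * A + B * int i1"
      unfolding p0(2) q0(2) by (simp add: algebra_simps)
    also have "\<dots> > 0"
      using A B \<open>1 \<le> int i0\<close> by (intro add_pos_nonneg mult_pos_pos) auto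
    finally have "int i0 * int j1 - int j0 * int i1 \<noteq> 0"
      by auto
    then have "of_int (int i0 * int j1 - int j0 * int i1) \<noteq> (0 :: complex)"
      by (simp only: of_int_eq_0_iff not_False_eq_True)
    then have "of_nat i0 * of_nat j1 - of_nat j0 * of_nat i1 \<noteq> (0 :: complex)"
      by simp
    then show ?thesis
      using p0(1) q0(1) by simp
  qed
  finally show ?thesis .
qed

lemma exists_max_slope:
  fixes S :: "(int \<times> int) set"
  assumes "finite S" "S \<noteq> {}" "\<And>a b. (a, b) \<in> S \<Longrightarrow> 0 < a"
  obtains A B where "(A, B) \<in> S" "\<And>a b. (a, b) \<in> S \<Longrightarrow> b * A \<le> B * a"
proof -
  define f where "f = (\<lambda>(a, b). real_of_int b / real_of_int a)"
  have "Max (f ` S) \<in> f ` S"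
    using assms by (intro Max_in) auto
  then obtain A B where AB: "(A, B) \<in> S" "f (A, B) = Max (f ` S)"
    by force
  have "b * A \<le> B * a" if "(a, b) \<in> S" for a b
  proof -
    have "f (a, b) \<le> f (A, B)"
      using that assms(1) AB(2) by simp
    then have "real_of_int b * real_of_int A \<le> real_of_int B * real_of_int a"
      using assms(3)[OF that] assms(3)[OF AB(1)] by (simp add: f_def field_simps)
    then show ?thesis
      by (simp only: of_int_mult[symmetric] of_int_le_iff)
  qed
  then show ?thesis
    using that AB(1) by blast
qed

text \<open>\<open>S\<close> holds the vectors from x to the monomials of \<open>p\<close> that
  contain y, and from y to the monomials of \<open>q\<close> of y-degree at least 2. Their first
  entries are positive: on x = 0 \<open>p\<close> vanishes and \<open>q\<close> is y, so there the
  Jacobian is \<open>d_x p\<close>, and the part of \<open>p\<close> linear in x is c x. A steepest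
  vector in \<open>S\<close> would define leading edges whose far vertices give the Jacobian a
  forbidden monomial; so \<open>S\<close> is empty and only \<open>a'(x) * b(x) = c\<close> remains
  to be solved.\<close>

lemma normalized_jacobian_pair:
  assumes p0: "at_x0 p = 0" and q0: "at_x0 q = [:0, 1:]" and jac: "jac p q = const2 c" and "c \<noteq> 0"
  obtains l where "p = const2 c * var_x" "q = var_y + [:l:]"
proof -
  have cfp: "cf p 0 j = 0" for j
    using coeff_at_x0[of p j] p0 by simp
  have cfq: "cf q 0 j = (if j = 1 then 1 else 0)" for j
    using coeff_at_x0[of q j] q0 by (auto simp: coeff_pCons split: nat.splits)
  have cfJ: "cf (var_x * var_y * jac p q) i j = (if i = 1 \<and> j = 1 then c else 0)" for i j
    by (cases i; cases j) (auto simp: jac var_x_def var_y_def const2_def coeff_pCons split: nat.splits)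
  have cfp1: "cf p 1 j = (if j = 0 then c else 0)" for j
  proof -
    have "at_x0 (jac p q) = at_x0 (d_x p)"
      using pderiv_at_x0[of p] pderiv_at_x0[of q] p0 q0
      by (simp add: jac_def at_x0.hom_minus at_x0.hom_mult pderiv_pCons flip: one_pCons)
    then have "cf (d_x p) 0 j = coeff [:c:] j"
      by (metis jac at_x0_const2 coeff_at_x0)
    then show ?thesis
      by (simp add: d_x_def coeff_map_poly coeff_pderiv coeff_pCons split: nat.splits)
  qed
  define S where "S = (\<lambda>(i, j). (int i - 1, int j)) ` {(i, j). cf p i j \<noteq> 0 \<and> 1 \<le> j} \<union>
    (\<lambda>(i, j). (int i, int j - 1)) ` {(i, j). cf q i j \<noteq> 0 \<and> 2 \<le> j}"
  have S_p: "(int i - 1, int j) \<in> S" if "cf p i j \<noteq> 0" "1 \<le> j" for i j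
    using that by (force simp: S_def)
  have S_q: "(int i, int j - 1) \<in> S" if "cf q i j \<noteq> 0" "2 \<le> j" for i j
    using that by (force simp: S_def)
  have fin: "finite S"
    unfolding S_def
    by (intro finite_UnI finite_imageI finite_subset[OF _ finite_support[of p]] finite_subset[OF _ finite_support[of q]]) auto
  have nonneg: "0 \<le> a" "0 < b" if "(a, b) \<in> S" for a b
  proof -
    have "i \<noteq> 0" if "cf p i j \<noteq> 0" for i j
      using cfp[of j] that by (cases i) auto
    then show "0 \<le> a" "0 < b"
      using that by (fastforce simp: S_def)+
  qed
  have edge: False if AB: "0 < A" "(A, B) \<in> S" "\<And>a b. (a, b) \<in> S \<Longrightarrow> b * A \<le> B * a" for A B
  proof -
    have B: "0 < B"
      using nonneg AB(2) by blast
    have p: "int j * A \<le> B * (int i - 1)" if "cf p i j \<noteq> 0" for i j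
    proof (cases "j = 0")
      case True
      have "i \<noteq> 0"
        using cfp[of j] that by (cases i) auto
      then show ?thesis
        using True B by simp
    qed (use AB(3) S_p that in auto)
    have q: "(int j - 1) * A \<le> B * int i" if "cf q i j \<noteq> 0" for i j
    proof (cases "j \<le> 1")
      case True
      then have "(int j - 1) * A \<le> 0" "0 \<le> B * int i"
        using AB(1) B by (simp_all add: mult_nonpos_nonneg)
      then show ?thesis
        by linarith
    qed (use AB(3) S_q that in auto)
    define Pe where "Pe = {(i, j). cf p i j \<noteq> 0 \<and> int j * A = B * (int i - 1)}"
    define Qe where "Qe = {(i, j). cf q i j \<noteq> 0 \<and> (int j - 1) * A = B * int i}"
    have fin': "finite Pe" "finite Qe"
      unfolding Pe_def Qe_def
      by (auto intro: finite_subset[OF _ finite_support[of p]] finite_subset[OF _ finite_support[of q]])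
    have ne: "(1, 0) \<in> Pe" "(0, 1) \<in> Qe"
      using cfp1[of 0] \<open>c \<noteq> 0\<close> cfq[of 1] by (simp_all add: Pe_def Qe_def)
    have vertex: "\<exists>i j. (i, j) \<in> E \<and> (\<forall>(i', j')\<in>E. i' \<le> i)" if "finite E" "E \<noteq> {}" for E :: "(nat \<times> nat) set"
    proof -
      have "Max (fst ` E) \<in> fst ` E"
        using that by (intro Max_in) auto
      then obtain i j where "(i, j) \<in> E" "i = Max (fst ` E)"
        by force
      moreover have "i' \<le> Max (fst ` E)" if "(i', j') \<in> E" for i' j'
        using that \<open>finite E\<close> by (intro Max_ge) force+
      ultimately show ?thesis
        by blast
    qed
    obtain i0 j0 where 0: "(i0, j0) \<in> Pe" "\<forall>(i', j')\<in>Pe. i' \<le> i0"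
      using vertex[OF fin'(1)] ne by blast
    obtain i1 j1 where 1: "(i1, j1) \<in> Qe" "\<forall>(i', j')\<in>Qe. i' \<le> i1"
      using vertex[OF fin'(2)] ne by blast
    have "cf (var_x * var_y * jac p q) (i0 + i1) (j0 + j1) \<noteq> 0"
      using 0 1 by (intro jac_extremal_coefficient[OF AB(1) B p q]) (auto simp: Pe_def Qe_def)
    \<comment> \<open>The Jacobian is constant, so x y times it has (1, 1) as its only exponent.
      Both vertices must then be the trivial ones, x and y.\<close>
    then have "i0 + i1 = 1"
      unfolding cfJ by (auto split: if_splits)
    moreover have "1 \<le> i0"
      using 0(2) ne(1) by auto
    ultimately have i: "i0 = 1" "i1 = 0"
      by auto
    from AB(2) show False
      unfolding S_def
    proof (elim UnE imageE)
      fix x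
      assume "(A, B) = (case x of (i, j) \<Rightarrow> (int i - 1, int j))" "x \<in> {(i, j). cf p i j \<noteq> 0 \<and> 1 \<le> j}"
      then have "x \<in> Pe" "fst x \<noteq> 1"
        using AB(1) by (auto simp: Pe_def)
      then show False
        using 0(2) i(1) AB(1) \<open>(A, B) = _\<close> by fastforce
    next
      fix x
      assume "(A, B) = (case x of (i, j) \<Rightarrow> (int i, int j - 1))" "x \<in> {(i, j). cf q i j \<noteq> 0 \<and> 2 \<le> j}"
      then have "x \<in> Qe" "fst x \<noteq> 0"
        using AB(1) by (auto simp: Qe_def)
      then show False
        using 1(2) i(2) by fastforce
    qed
  qed
  have pos: "0 < a" if ab: "(a, b) \<in> S" for a b
  proof (rule ccontr)
    assume "\<not> 0 < a"
    then have a: "a = 0"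
      using nonneg(1)[OF ab] by simp
    from ab show False
      unfolding S_def using cfp1 cfq by (auto simp: a split: if_splits)
  qed
  have "S = {}"
  proof (rule ccontr)
    assume "S \<noteq> {}"
    then obtain A B where "(A, B) \<in> S" "\<And>a b. (a, b) \<in> S \<Longrightarrow> b * A \<le> B * a"
      by (rule exists_max_slope[OF fin]) (use pos in blast, blast)
    then show False
      using edge pos by blast
  qed
  have "coeff p j = 0" if "1 \<le> j" for j
    using S_p[where j = j] that \<open>S = {}\<close> by (intro poly_eqI) auto
  then have "degree p = 0"
    by (metis One_nat_def leading_coeff_0_iff degree_0 not_less_eq_eq le0 not_one_le_zero less_one not_le)
  then obtain a where a: "p = [:a:]"
    by (rule degree_eq_zeroE)
  have "coeff q j = 0" if "2 \<le> j" for j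
    using S_q[where j = j] that \<open>S = {}\<close> by (intro poly_eqI) auto
  then have q: "q = [:coeff q 0, coeff q 1:]"
    by (intro poly_eqI) (auto simp: coeff_pCons numeral_2_eq_2 split: nat.splits)
  obtain l b where lb: "q = [:l, b:]"
    using q by blast
  have "[:pderiv a * b:] = [:[:c:]:]"
    using jac by (simp add: jac_def a lb d_x_pCons d_y_def pderiv_pCons const2_def mult.commute)
  then have ab: "pderiv a * b = [:c:]"
    by simp
  then have nz: "pderiv a \<noteq> 0" "b \<noteq> 0"
    using \<open>c \<noteq> 0\<close> by auto
  then have "degree (pderiv a) + degree b = 0"
    using arg_cong[OF ab, of degree] by (simp add: degree_mult_eq)
  then have deg: "degree b = 0" "degree a \<le> 1"
    by (auto simp: degree_pderiv)
  then obtain b0 where "b = [:b0:]"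
    by (auto elim: degree_eq_zeroE)
  moreover have "coeff b 0 = 1"
    using cfq[of 1] by (simp add: lb)
  ultimately have b: "b = 1"
    by (simp add: one_pCons)
  have "coeff a 0 = 0" "coeff a 1 = c"
    using cfp[of 0] cfp1[of 0] by (simp_all add: a)
  then have "a = [:0, c:]"
    using deg(2) by (intro poly_eqI) (auto simp: coeff_pCons coeff_eq_0 split: nat.splits)
  then have "p = const2 c * var_x"
    by (simp add: a const2_def var_x_def)
  moreover have "q = var_y + [:l:]"
    by (simp add: lb b var_y_def)
  ultimately show ?thesis
    using that by blast
qed

section \<open>Reduction by elementary automorphisms\<close>

lemma bij_right_factor:
  assumes "bij (\<phi> \<circ> \<psi>)" "bij \<psi>"
  shows "bij \<phi>"
proof -
  have "\<phi> = (\<phi> \<circ> \<psi>) \<circ> inv_into UNIV \<psi>"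
    using assms(2) by (simp add: fun_eq_iff bij_is_surj surj_f_inv_f)
  then show ?thesis
    using assms by (metis bij_comp bij_imp_bij_inv)
qed

lemma bij_left_factor:
  assumes "bij (\<psi> \<circ> \<phi>)" "bij \<psi>"
  shows "bij \<phi>"
proof -
  have "\<phi> = inv_into UNIV \<psi> \<circ> (\<psi> \<circ> \<phi>)"
    using assms(2) by (simp add: fun_eq_iff bij_is_inj inv_f_f)
  then show ?thesis
    using assms by (metis bij_comp bij_imp_bij_inv)
qed

lemma bij_shear: "bij (subst2 var_x (var_y - const2 c * var_x ^ n))"
proof (rule polynomial_mapping_bij)
  let ?\<phi> = "subst2 var_x (var_y - const2 c * var_x ^ n)" and ?\<psi> = "subst2 var_x (var_y + const2 c * var_x ^ n)"
  interpret p: comm_ring_hom ?\<phi> by (rule subst2_hom)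
  interpret q: comm_ring_hom ?\<psi> by (rule subst2_hom)
  show "?\<phi> (?\<psi> var_x) = var_x" "?\<phi> (?\<psi> var_y) = var_y" "?\<psi> (?\<phi> var_x) = var_x" "?\<psi> (?\<phi> var_y) = var_y"
    by (simp_all add: p.hom_add p.hom_mult p.hom_power q.hom_minus q.hom_mult q.hom_power)
qed (rule polynomial_mapping_subst2)+

lemma bij_swap: "bij (subst2 var_y var_x)"
  by (rule polynomial_mapping_bij[OF polynomial_mapping_subst2 polynomial_mapping_subst2]) simp_all

lemma const2_inverse: "c \<noteq> 0 \<Longrightarrow> const2 c * const2 (1 / c) = 1" "c \<noteq> 0 \<Longrightarrow> const2 (1 / c) * const2 c = 1"
  by (simp_all flip: const2.hom_mult)

lemma bij_affine:
  assumes "u' * v - u * v' \<noteq> 0"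
  shows "bij (subst2 (const2 a + const2 u' * var_x + const2 u * var_y) (const2 b + const2 v' * var_x + const2 v * var_y))"
proof -
  define \<Delta> where "\<Delta> = u' * v - u * v'"
  define k where "k = const2 (1 / \<Delta>)"
  \<comment> \<open>Cramer's rule for the inverse affine map.\<close>
  define X where "X = k * (const2 v * (var_x - const2 a) - const2 u * (var_y - const2 b))"
  define Y where "Y = k * (const2 u' * (var_y - const2 b) - const2 v' * (var_x - const2 a))"
  let ?\<phi> = "subst2 (const2 a + const2 u' * var_x + const2 u * var_y) (const2 b + const2 v' * var_x + const2 v * var_y)"
  interpret p: comm_ring_hom ?\<phi> by (rule subst2_hom)
  interpret q: comm_ring_hom "subst2 X Y" by (rule subst2_hom)
  have k: "k * (const2 u' * const2 v - const2 u * const2 v') = 1"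
    using const2_inverse(2)[of \<Delta>] assms unfolding k_def \<Delta>_def[symmetric]
    by (simp add: \<Delta>_def const2.hom_minus const2.hom_mult)
  have \<phi>k: "?\<phi> k = k"
    by (simp add: k_def)
  show ?thesis
  proof (rule polynomial_mapping_bij[OF polynomial_mapping_subst2 polynomial_mapping_subst2[of X Y]])
    have "?\<phi> X = k * (const2 u' * const2 v - const2 u * const2 v') * var_x"
      by (simp add: X_def p.hom_mult p.hom_minus \<phi>k) (simp add: algebra_simps)
    then show "?\<phi> (subst2 X Y var_x) = var_x"
      by (simp add: k)
    have "?\<phi> Y = k * (const2 u' * const2 v - const2 u * const2 v') * var_y"
      by (simp add: Y_def p.hom_mult p.hom_minus \<phi>k) (simp add: algebra_simps)
    then show "?\<phi> (subst2 X Y var_y) = var_y"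
      by (simp add: k)
    have "const2 a + const2 u' * X + const2 u * Y =
        const2 a + k * (const2 u' * const2 v - const2 u * const2 v') * (var_x - const2 a)"
      by (simp add: X_def Y_def algebra_simps)
    then show "subst2 X Y (?\<phi> var_x) = var_x"
      by (simp add: q.hom_add q.hom_mult k)
    have "const2 b + const2 v' * X + const2 v * Y =
        const2 b + k * (const2 u' * const2 v - const2 u * const2 v') * (var_y - const2 b)"
      by (simp add: X_def Y_def algebra_simps)
    then show "subst2 X Y (?\<phi> var_y) = var_y"
      by (simp add: q.hom_add q.hom_mult k)
  qed
qed

text \<open>The hypotheses of the theorem for the line \<open>x = 0\<close>.\<close>

definition line_pair :: "(bipoly \<Rightarrow> bipoly) \<Rightarrow> bool" where
  "line_pair \<phi> \<longleftrightarrow> polynomial_mapping \<phi> \<and> (\<exists>c. c \<noteq> 0 \<and> jac (\<phi> var_x) (\<phi> var_y) = const2 c) \<and>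
    (\<forall>s t. poly (at_x0 (\<phi> var_x)) s = poly (at_x0 (\<phi> var_x)) t \<longrightarrow>
      poly (at_x0 (\<phi> var_y)) s = poly (at_x0 (\<phi> var_y)) t \<longrightarrow> s = t)"

lemma line_pair_immersive:
  assumes "line_pair \<phi>"
  shows "poly (pderiv (at_x0 (\<phi> var_x))) t \<noteq> 0 \<or> poly (pderiv (at_x0 (\<phi> var_y))) t \<noteq> 0"
proof (rule ccontr)
  obtain c where c: "c \<noteq> 0" "jac (\<phi> var_x) (\<phi> var_y) = const2 c"
    using assms by (auto simp: line_pair_def)
  assume "\<not> ?thesis"
  then have "eval2 (jac (\<phi> var_x) (\<phi> var_y)) (0, t) = 0"
    by (simp add: jac_def pderiv_at_x0 poly_at_x0)
  then show False
    using c by simp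
qed

text \<open>Composition of algebra maps reverses that of plane maps:
  \<open>\<phi> \<circ> \<psi>\<close> performs the shear in the target plane, so the line stays in
  place while (u, v) becomes (u, v - c u^n).\<close>

lemma line_pair_shear:
  fixes c :: complex and n :: nat
  assumes "line_pair \<phi>"
  defines "\<psi> \<equiv> subst2 var_x (var_y - const2 c * var_x ^ n)"
  shows "line_pair (\<phi> \<circ> \<psi>)" "(\<phi> \<circ> \<psi>) var_x = \<phi> var_x"
    "(\<phi> \<circ> \<psi>) var_y = \<phi> var_y - const2 c * \<phi> var_x ^ n"
proof -
  have \<phi>: "polynomial_mapping \<phi>"
    using assms(1) by (simp add: line_pair_def)
  interpret comm_ring_hom \<phi>
    by (rule polynomial_mapping_hom[OF \<phi>])
  show x: "(\<phi> \<circ> \<psi>) var_x = \<phi> var_x" and y: "(\<phi> \<circ> \<psi>) var_y = \<phi> var_y - const2 c * \<phi> var_x ^ n"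
    by (simp_all add: \<psi>_def hom_minus hom_mult hom_power polynomial_mapping_const2[OF \<phi>])
  have "polynomial_mapping (\<phi> \<circ> \<psi>)"
    unfolding \<psi>_def by (rule polynomial_mapping_comp[OF \<phi> polynomial_mapping_subst2])
  then show "line_pair (\<phi> \<circ> \<psi>)"
    using assms(1) unfolding line_pair_def x y jac_shear
    by (auto simp: at_x0.hom_minus at_x0.hom_mult at_x0.hom_power)
qed

lemma line_pair_swap:
  assumes "line_pair \<phi>"
  shows "line_pair (\<phi> \<circ> subst2 var_y var_x)"
proof -
  have "polynomial_mapping (\<phi> \<circ> subst2 var_y var_x)"
    using assms polynomial_mapping_comp[OF _ polynomial_mapping_subst2] by (simp add: line_pair_def)
  moreover obtain c where "c \<noteq> 0" "jac (\<phi> var_x) (\<phi> var_y) = const2 c"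
    using assms by (auto simp: line_pair_def)
  then have "- c \<noteq> 0 \<and> jac (\<phi> var_y) (\<phi> var_x) = const2 (- c)"
    by (simp add: jac_swap[of "\<phi> var_y"] const2.hom_uminus)
  ultimately show ?thesis
    unfolding line_pair_def
    by (intro conjI exI[of _ "- c"]) (use assms in \<open>auto simp: line_pair_def\<close>)
qed

text \<open>If u is constant, immersivity leaves the derivative of v without zeros, so v has degree
  1. An affine change of the target gives (0, t), and the resulting normal form (c x, y + l(x)) is
  inverted explicitly.\<close>

lemma line_pair_constant:
  assumes "line_pair \<phi>" and "degree (at_x0 (\<phi> var_x)) = 0"
  shows "bij \<phi>"
proof -
  let ?u = "at_x0 (\<phi> var_x)" and ?v = "at_x0 (\<phi> var_y)"
  have \<phi>: "polynomial_mapping \<phi>"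
    using assms(1) by (simp add: line_pair_def)
  interpret comm_ring_hom \<phi>
    by (rule polynomial_mapping_hom[OF \<phi>])
  obtain c where c: "c \<noteq> 0" "jac (\<phi> var_x) (\<phi> var_y) = const2 c"
    using assms(1) by (auto simp: line_pair_def)
  obtain a where a: "?u = [:a:]"
    using assms(2) by (rule degree_eq_zeroE)
  then have nz: "poly (pderiv ?v) t \<noteq> 0" for t
    using line_pair_immersive[OF assms(1), of t] by (simp add: pderiv_pCons)
  then have "degree (pderiv ?v) = 0"
    using fundamental_theorem_of_algebra[of "pderiv ?v"] constant_degree by metis
  then have "degree ?v \<le> 1"
    by (simp add: degree_pderiv)
  then obtain b k where v: "?v = [:b, k:]"
    by (metis One_nat_def degree1_coeffs degree_eq_zeroE le_Suc_eq le_zero_eq pCons_0_0)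
  have k: "k \<noteq> 0"
    using nz[of 0] by (simp add: v pderiv_pCons)
  define \<psi> where "\<psi> = subst2 (const2 (- a) + const2 1 * var_x + const2 0 * var_y)
    (const2 (- b / k) + const2 0 * var_x + const2 (1 / k) * var_y)"
  have \<psi>: "bij \<psi>"
    unfolding \<psi>_def using k by (intro bij_affine) simp
  define \<eta> where "\<eta> = \<phi> \<circ> \<psi>"
  have x: "\<eta> var_x = \<phi> var_x - const2 a" and y: "\<eta> var_y = const2 (1 / k) * \<phi> var_y + const2 (- b / k)"
    by (simp_all add: \<eta>_def \<psi>_def hom_add hom_mult hom_minus const2.hom_uminus polynomial_mapping_const2[OF \<phi>])
  have \<eta>: "polynomial_mapping \<eta>"
    unfolding \<eta>_def \<psi>_def by (rule polynomial_mapping_comp[OF \<phi> polynomial_mapping_subst2])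
  have "at_x0 (\<eta> var_x) = 0"
    by (simp add: x at_x0.hom_minus a)
  moreover have "at_x0 (\<eta> var_y) = [:0, 1:]"
    using k by (simp add: y at_x0.hom_add at_x0.hom_mult v)
  moreover have "jac (\<eta> var_x) (\<eta> var_y) = const2 (1 / k) * jac (\<phi> var_x) (\<phi> var_y)"
    by (simp add: x y jac_def algebra_simps)
  then have jac: "jac (\<eta> var_x) (\<eta> var_y) = const2 (c / k)"
    by (simp add: c(2) flip: const2.hom_mult)
  moreover have ck: "c / k \<noteq> 0"
    using c k by simp
  ultimately obtain l where l: "\<eta> var_x = const2 (c / k) * var_x" "\<eta> var_y = var_y + [:l:]"
    using normalized_jacobian_pair by blast
  have "bij \<eta>"
  proof -
    define d where "d = const2 (1 / (c / k)) * var_x"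
    \<comment> \<open>The inverse sends x to \<open>d\<close>, that is x divided by its factor, and
      y to y - l(d). The term \<open>subst2 d 0 [:l:]\<close> is l(d); the image 0 of y is a filler,
      as \<open>l\<close> does not contain y.\<close>
    define \<theta> where "\<theta> = subst2 d (var_y - subst2 d 0 [:l:])"
    interpret \<eta>: comm_ring_hom \<eta>
      by (rule polynomial_mapping_hom[OF \<eta>])
    interpret \<theta>: comm_ring_hom \<theta>
      unfolding \<theta>_def by (rule subst2_hom)
    have \<theta>x: "\<theta> var_x = d" and \<theta>y: "\<theta> var_y = var_y - subst2 d 0 [:l:]" and \<theta>c: "\<theta> (const2 e) = const2 e" for e
      by (simp_all add: \<theta>_def)
    have \<eta>d: "\<eta> d = var_x" and \<theta>d: "\<theta> (const2 (c / k) * var_x) = var_x"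
      using const2_inverse[OF ck]
      by (simp_all add: d_def \<theta>x \<eta>.hom_mult \<theta>.hom_mult polynomial_mapping_const2[OF \<eta>] \<theta>c l(1) flip: mult.assoc)
    have \<theta>l: "\<theta> [:l:] = subst2 d 0 [:l:]"
      by (cases "l = 0") (simp_all add: \<theta>_def subst2_def map_poly_pCons)
    have \<eta>l: "\<eta> (subst2 d 0 [:w:]) = [:w:]" for w
    proof (induction w)
      case 0
      show ?case
        by (simp add: subst2_def)
    next
      case (pCons e w)
      have "[:pCons e w:] = const2 e + var_x * [:w:]"
        by (simp add: const2_def var_x_def)
      moreover interpret s: comm_ring_hom "subst2 d 0"
        by (rule subst2_hom)
      have "\<eta> (subst2 d 0 (const2 e + var_x * [:w:])) = const2 e + var_x * [:w:]"
        by (simp only: s.hom_add s.hom_mult \<eta>.hom_add \<eta>.hom_mult polynomial_mapping_const2[OF \<eta>] pCons.IH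
            subst2_x subst2_const2 \<eta>d)
      ultimately show ?case
        by (simp only:)
    qed
    show ?thesis
    proof (rule polynomial_mapping_bij[OF \<eta>])
      show "polynomial_mapping \<theta>"
        unfolding \<theta>_def by (rule polynomial_mapping_subst2)
      show "\<eta> (\<theta> var_x) = var_x" "\<theta> (\<eta> var_x) = var_x"
        by (simp_all only: \<theta>x \<eta>d l(1) \<theta>d)
      show "\<eta> (\<theta> var_y) = var_y"
        by (simp add: \<theta>y \<eta>.hom_minus \<eta>l l(2))
      show "\<theta> (\<eta> var_y) = var_y"
        by (simp add: l(2) \<theta>.hom_add \<theta>l \<theta>y)
    qed
  qed
  then show ?thesis
    unfolding \<eta>_def using \<psi> by (rule bij_right_factor)
qed

lemma line_pair_bij: "line_pair \<phi> \<Longrightarrow> bij \<phi>"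
proof (induction "degree (at_x0 (\<phi> var_x)) + degree (at_x0 (\<phi> var_y))" arbitrary: \<phi> rule: less_induct)
  case less
  \<comment> \<open>Stated for every \<eta> with the same degree sum, so that it serves both \<phi>
    and its composition with the swap.\<close>
  have divides: "bij \<eta>"
    if \<eta>: "line_pair \<eta>"
      and sum: "degree (at_x0 (\<eta> var_x)) + degree (at_x0 (\<eta> var_y)) =
        degree (at_x0 (\<phi> var_x)) + degree (at_x0 (\<phi> var_y))"
      and pos: "0 < degree (at_x0 (\<eta> var_y))"
      and dvd: "degree (at_x0 (\<eta> var_x)) dvd degree (at_x0 (\<eta> var_y))" for \<eta>
  proof -
    let ?u = "at_x0 (\<eta> var_x)" and ?v = "at_x0 (\<eta> var_y)"
    obtain n where n: "degree ?v = degree ?u * n"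
      using dvd ..
    have u0: "?u \<noteq> 0" and v0: "?v \<noteq> 0"
      using pos n by auto
    \<comment> \<open>Chosen so that the leading terms of \<open>?v\<close> and of c times the n-th
      power of \<open>?u\<close> cancel.\<close>
    define c where "c = lead_coeff ?v / lead_coeff ?u ^ n"
    define \<psi> where "\<psi> = subst2 var_x (var_y - const2 c * var_x ^ n)"
    note sh = line_pair_shear[OF \<eta>, of c n, folded \<psi>_def]
    have c0: "c \<noteq> 0"
      using u0 v0 by (simp add: c_def)
    have d: "degree (Polynomial.smult c (?u ^ n)) = degree ?v"
      using c0 u0 n by (simp add: degree_power_eq mult.commute)
    have "lead_coeff (Polynomial.smult c (?u ^ n)) = c * lead_coeff ?u ^ n"
      by (simp only: lead_coeff_smult lead_coeff_power)
    then have "coeff (Polynomial.smult c (?u ^ n)) (degree ?v) = lead_coeff ?v"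
      unfolding d using u0 by (simp add: c_def)
    then have "degree (?v - Polynomial.smult c (?u ^ n)) < degree ?v"
      using d pos
      by (cases "?v = Polynomial.smult c (?u ^ n)") (auto intro!: degree_less_if_less_eqI degree_diff_le)
    moreover have "at_x0 ((\<eta> \<circ> \<psi>) var_y) = ?v - Polynomial.smult c (?u ^ n)"
      by (simp only: sh(3) at_x0.hom_minus at_x0.hom_mult at_x0.hom_power at_x0_const2) simp
    ultimately have "bij (\<eta> \<circ> \<psi>)"
      using sum sh(2) by (intro less.hyps[OF _ sh(1)]) simp
    then show ?thesis
      using bij_shear unfolding \<psi>_def by (rule bij_right_factor)
  qed
  let ?u = "at_x0 (\<phi> var_x)" and ?v = "at_x0 (\<phi> var_y)"
  let ?\<sigma> = "subst2 var_y var_x"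
  have swap: "bij \<phi>" if "bij (\<phi> \<circ> ?\<sigma>)"
    using that bij_swap by (rule bij_right_factor)
  note sw = line_pair_swap[OF less.prems]
  consider "degree ?u = 0" | "degree ?v = 0" | "0 < degree ?u" "0 < degree ?v"
    by auto
  then show ?case
  proof cases
    case 1
    then show ?thesis
      by (rule line_pair_constant[OF less.prems])
  next
    case 2
    then have "bij (\<phi> \<circ> ?\<sigma>)"
      by (intro line_pair_constant[OF sw]) simp
    then show ?thesis
      by (rule swap)
  next
    case 3
    have "degree ?u dvd degree ?v \<or> degree ?v dvd degree ?u"
      using less.prems line_pair_immersive[OF less.prems] 3
      by (intro line_embedding_degrees) (auto simp: line_pair_def)
    then show ?thesis
    proof
      assume "degree ?u dvd degree ?v"
      then show ?thesis
        using divides[OF less.prems] 3 by blast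
    next
      assume "degree ?v dvd degree ?u"
      then have "bij (\<phi> \<circ> ?\<sigma>)"
        using divides[OF sw] 3 by (simp add: add.commute)
      then show ?thesis
        by (rule swap)
    qed
  qed
qed

theorem corollary1p5:
  fixes \<phi> :: "bipoly \<Rightarrow> bipoly"
  assumes "polynomial_mapping \<phi>"
    and "invertible (jacobian_matrix \<phi>)"
    and "\<exists>L. complex_line L \<and> inj_on (induced_map \<phi>) L"
  shows "polynomial_automorphism \<phi>"
proof -
  obtain a b u v where uv: "(u, v) \<noteq> (0, 0)"
    and inj: "inj_on (induced_map \<phi>) (range (\<lambda>t. (a + t * u, b + t * v)))"
    using assms(3) by (auto simp: complex_line_def)
  obtain u' v' where \<Delta>: "u' * v - u * v' \<noteq> 0"
  proof (cases "u = 0")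
    case True
    then show ?thesis
      using uv that[of 1 0] by simp
  next
    case False
    then show ?thesis
      using that[of 0 1] by simp
  qed
  \<comment> \<open>The direction (u, v) is completed to a basis, so the plane map of \<alpha>
    carries the axis x = 0 to the given line. As algebra maps compose contravariantly,
    \<open>\<alpha> \<circ> \<phi>\<close> is the plane map of \<phi> after this coordinate
    change.\<close>
  define \<alpha> where "\<alpha> = subst2 (const2 a + const2 u' * var_x + const2 u * var_y) (const2 b + const2 v' * var_x + const2 v * var_y)"
  have \<alpha>: "polynomial_mapping \<alpha>" "bij \<alpha>"
    unfolding \<alpha>_def using polynomial_mapping_subst2 bij_affine[OF \<Delta>] by auto
  obtain c where c: "c \<noteq> 0" "jac (\<phi> var_x) (\<phi> var_y) = const2 c"
    using invertible_jacobian[OF assms(2)] by blast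
  have "jac (\<alpha> var_x) (\<alpha> var_y) = const2 (u' * v - u * v')"
    by (simp add: \<alpha>_def jac_def const2.hom_minus const2.hom_mult)
  then have jac: "jac (\<alpha> (\<phi> var_x)) (\<alpha> (\<phi> var_y)) = const2 (c * (u' * v - u * v'))"
    by (simp only: jac_comp[OF \<alpha>(1), of "\<phi> var_x"] c(2) polynomial_mapping_const2[OF \<alpha>(1)] const2.hom_mult)
  have ind: "induced_map \<alpha> (0, t) = (a + t * u, b + t * v)" for t
    by (simp add: induced_map_def \<alpha>_def mult.commute)
  have inj': "s = t"
    if "poly (at_x0 (\<alpha> (\<phi> var_x))) s = poly (at_x0 (\<alpha> (\<phi> var_x))) t"
      "poly (at_x0 (\<alpha> (\<phi> var_y))) s = poly (at_x0 (\<alpha> (\<phi> var_y))) t" for s t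
  proof -
    have "induced_map \<phi> (a + s * u, b + s * v) = induced_map \<phi> (a + t * u, b + t * v)"
      using that by (simp only: poly_at_x0 eval2_polynomial_mapping[OF \<alpha>(1)] ind) (simp add: induced_map_def)
    then have "(a + s * u, b + s * v) = (a + t * u, b + t * v)"
      by (rule inj_onD[OF inj]) auto
    then show ?thesis
      using uv by auto
  qed
  have "line_pair (\<alpha> \<circ> \<phi>)"
    using polynomial_mapping_comp[OF \<alpha>(1) assms(1)] jac c(1) \<Delta> inj'
    unfolding line_pair_def by (auto intro!: exI[of _ "c * (u' * v - u * v')"])
  then have "bij (\<alpha> \<circ> \<phi>)"
    by (rule line_pair_bij)
  then have "bij \<phi>"
    using \<alpha>(2) by (rule bij_left_factor)
  then show ?thesis
    using assms(1) by (simp add: polynomial_automorphism_def)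
qed

end
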